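(* Let $a\in\mathbb{R}$ and $\mu=1_{[a,+\infty)}$. Consider the linear system on $\mathbb{R}$ with control $u$: $$i\partial_t\xi=H\xi+u(t)\mu(x)\phi_0(t),\qquad \xi(0,\cdot)=0. \qquad (L)$$ **1.** Let $T>0$ and $u\in L^2((0,T),\mathbb{R})$. There exists a unique mild solution $\xi\in C([0,T],H_{h,a})$ of (L) such that $\xi(t)\in H_{h,a}\cap X_t$ for every $t\in[0,T]$, and it is defined by Duhamel's formula $$\xi(t)=-i\int_0^te^{-iH(t-s)}u(s)\mu\phi_0(s)\,ds\in H_{h,a}\cap X_t,\qquad t\in[0,T].$$ **2.** For any $T>\pi$ and any $\psi_1\in H_{h,a}\cap X_T$, there exists a control $u\in L^2((0,T),\mathbb{R})$ such that the corresponding mild solution $\xi$ of (L) with $\xi(0)=0$ satisfies $\xi(T)=\psi_1$.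
   Context: $\mathbb{N}=\{0,1,2,\dots\}$, $\mathbb{N}^*=\mathbb{N}\setminus\{0\}$. $L^2=L^2(\mathbb{R},\mathbb{C})$ with $\langle f,g\rangle_{L^2}=\int_{\mathbb{R}}f\overline{g}\,dx$. $H=-\Delta+x^2$ is the harmonic oscillator on $L^2(\mathbb{R},\mathbb{C})$ with domain $\{\psi\in L^2:(-\Delta+x^2)\psi\in L^2\}$. Its eigenvalues are $\lambda_k=2k+1$, $k\in\mathbb{N}$, with Hilbert basis of eigenfunctions the Hermite functions $$\phi_k(x)=(-1)^k(\sqrt\pi\,2^kk!)^{-1/2}e^{x^2/2}\frac{d^k}{dx^k}\big(e^{-x^2}\big),$$ and $\phi_0(t)=e^{-i\lambda_0t}\phi_0$. For $a\in\mathbb{R}$, $H_{h,a}=\{\psi\in L^2:\|\psi\|_{H_{h,a}}<\infty\}$ with $$\|\psi\|_{H_{h,a}}=\Big(|\langle\psi,\phi_0\rangle_{L^2}|^2+\sum_{k\in\mathbb{N}^*}k\,\phi_{k-1}^{-2}(a)\,|\langle\psi,\phi_k\rangle_{L^2}|^2\Big)^{1/2}.$$ For $t\ge0$, $X_t=\{\psi\in L^2:\Re(\langle\psi,\phi_0(t)\rangle_{L^2})=0\}$. *)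

theory Defs
  imports "HOL-Analysis.Analysis"
begin

section \<open>The space of square-integrable functions\<close>

text \<open>
  Elements of \<open>L\<^sup>2(\<real>, \<complex>)\<close> are represented by Borel functions; equality in \<open>L\<^sup>2\<close> is
  equality almost everywhere, \<open>ae_eq\<close>.
\<close>

definition L2 :: "(real \<Rightarrow> complex) set" where
  "L2 = {f \<in> borel_measurable lborel. integrable lborel (\<lambda>x. (cmod (f x))\<^sup>2)}"

definition ae_eq :: "(real \<Rightarrow> complex) \<Rightarrow> (real \<Rightarrow> complex) \<Rightarrow> bool" where
  "ae_eq f g \<longleftrightarrow> (AE x in lborel. f x = g x)"

definition L2_inner :: "(real \<Rightarrow> complex) \<Rightarrow> (real \<Rightarrow> complex) \<Rightarrow> complex" where
  "L2_inner f g = (LINT x|lborel. f x * cnj (g x))"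

definition L2_norm :: "(real \<Rightarrow> complex) \<Rightarrow> real" where
  "L2_norm f = sqrt (LINT x|lborel. (cmod (f x))\<^sup>2)"

definition continuous_L2 :: "real \<Rightarrow> (real \<Rightarrow> real \<Rightarrow> complex) \<Rightarrow> bool" where
  "continuous_L2 T \<xi> \<longleftrightarrow> (\<forall>t\<in>{0..T}. \<xi> t \<in> L2 \<and>
     ((\<lambda>s. L2_norm (\<lambda>x. \<xi> s x - \<xi> t x)) \<longlongrightarrow> 0) (at t within {0..T}))"

definition L2_real_on :: "real \<Rightarrow> real \<Rightarrow> (real \<Rightarrow> real) set" where
  "L2_real_on a b = {u. set_borel_measurable lborel {a<..<b} u \<and>
     set_integrable lborel {a<..<b} (\<lambda>s. (u s)\<^sup>2)}"

text \<open>
  The Bochner integral of \<open>L\<^sup>2\<close>-valued functions, as in the library's \<open>has_bochner_integral\<close>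
  (which needs a normed space as a type and therefore does not apply to \<open>L\<^sup>2\<close>): the limit of the
  integrals of simple functions that converge to the integrand in mean.  The simple function
  taking the value \<open>g\<close> on \<open>A\<close>, summed over all \<open>(A, g)\<close> in a list, is represented by that list.
\<close>

definition simple_val :: "(real set \<times> (real \<Rightarrow> complex)) list \<Rightarrow> real \<Rightarrow> real \<Rightarrow> complex" where
  "simple_val p s = (\<lambda>x. \<Sum>(A, g)\<leftarrow>p. indicator A s * g x)"

definition simple_int :: "(real set \<times> (real \<Rightarrow> complex)) list \<Rightarrow> real \<Rightarrow> complex" where
  "simple_int p = (\<lambda>x. \<Sum>(A, g)\<leftarrow>p. complex_of_real (measure lborel A) * g x)"

definition has_L2_integral ::
    "real set \<Rightarrow> (real \<Rightarrow> real \<Rightarrow> complex) \<Rightarrow> (real \<Rightarrow> complex) \<Rightarrow> bool" where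
  "has_L2_integral S F I \<longleftrightarrow> (\<forall>s\<in>S. F s \<in> L2) \<and> I \<in> L2 \<and>
     (\<exists>p. (\<forall>n. set (p n) \<subseteq> {A \<in> sets lborel. A \<subseteq> S \<and> emeasure lborel A < \<infinity>} \<times> L2) \<and>
          (\<forall>n. set_borel_measurable lborel S
                  (\<lambda>s. L2_norm (\<lambda>x. F s x - simple_val (p n) s x))) \<and>
          (\<lambda>n. \<integral>\<^sup>+s\<in>S. ennreal (L2_norm (\<lambda>x. F s x - simple_val (p n) s x)) \<partial>lborel)
             \<longlonglongrightarrow> 0 \<and>
          (\<lambda>n. L2_norm (\<lambda>x. simple_int (p n) x - I x)) \<longlonglongrightarrow> 0)"


section \<open>The harmonic oscillator and its propagator\<close>

definition dx :: "(real \<Rightarrow> complex) \<Rightarrow> real \<Rightarrow> complex" where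
  "dx f = (\<lambda>x. vector_derivative f (at x))"

definition schwartz :: "(real \<Rightarrow> complex) set" where
  "schwartz = {\<theta>. \<forall>n. (\<forall>x. (dx ^^ n) \<theta> differentiable (at x)) \<and>
     (\<forall>m. \<exists>C. \<forall>x. \<bar>x\<bar> ^ m * cmod ((dx ^^ n) \<theta> x) \<le> C)}"

text \<open>
  The graph of \<open>H = -\<Delta> + x\<^sup>2\<close> on its maximal domain: \<open>\<psi> \<in> D(H)\<close> and \<open>H \<psi> = g\<close>.  The expression
  \<open>(-\<Delta> + x\<^sup>2)\<psi>\<close> is taken in the sense of tempered distributions.
\<close>

definition harmonic_oscillator :: "(real \<Rightarrow> complex) \<Rightarrow> (real \<Rightarrow> complex) \<Rightarrow> bool" where
  "harmonic_oscillator \<psi> g \<longleftrightarrow> \<psi> \<in> L2 \<and> g \<in> L2 \<and>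
     (\<forall>\<theta>\<in>schwartz. (LINT x|lborel. \<psi> x * (- dx (dx \<theta>) x + complex_of_real (x\<^sup>2) * \<theta> x))
                    = (LINT x|lborel. g x * \<theta> x))"

text \<open>
  \<open>S\<close> is the strongly continuous one-parameter unitary group on \<open>L\<^sup>2\<close> generated by \<open>-\<i> A\<close>, where
  the operator \<open>A\<close> is given by its graph.  Compatibility of \<open>S t\<close> with \<open>ae_eq\<close> follows from
  linearity and isometry, surjectivity from the group law.
\<close>

definition generates_unitary_group ::
    "((real \<Rightarrow> complex) \<Rightarrow> (real \<Rightarrow> complex) \<Rightarrow> bool) \<Rightarrow>
     (real \<Rightarrow> (real \<Rightarrow> complex) \<Rightarrow> (real \<Rightarrow> complex)) \<Rightarrow> bool" where
  "generates_unitary_group A S \<longleftrightarrow>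
     (\<forall>t. \<forall>\<psi>\<in>L2. S t \<psi> \<in> L2 \<and> L2_norm (S t \<psi>) = L2_norm \<psi>) \<and>
     (\<forall>t c. \<forall>\<psi>\<in>L2. \<forall>\<eta>\<in>L2.
        ae_eq (S t (\<lambda>x. c * \<psi> x + \<eta> x)) (\<lambda>x. c * S t \<psi> x + S t \<eta> x)) \<and>
     (\<forall>\<psi>\<in>L2. ae_eq (S 0 \<psi>) \<psi>) \<and>
     (\<forall>s t. \<forall>\<psi>\<in>L2. ae_eq (S (s + t) \<psi>) (S s (S t \<psi>))) \<and>
     (\<forall>\<psi>\<in>L2. ((\<lambda>t. L2_norm (\<lambda>x. S t \<psi> x - \<psi> x)) \<longlongrightarrow> 0) (at 0)) \<and>
     (\<forall>\<psi>\<in>L2. \<forall>g\<in>L2. A \<psi> g \<longleftrightarrow>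
        ((\<lambda>t. L2_norm (\<lambda>x. (S t \<psi> x - \<psi> x) / complex_of_real t - (- \<i> * g x))) \<longlongrightarrow> 0) (at 0))"

text \<open>
  The group \<open>exp (-\<i> t H)\<close>; by Stone's theorem it exists and is unique up to the choice of
  representatives.
\<close>

definition propagator :: "real \<Rightarrow> (real \<Rightarrow> complex) \<Rightarrow> (real \<Rightarrow> complex)" where
  "propagator = (SOME S. generates_unitary_group harmonic_oscillator S)"

definition eigval :: "nat \<Rightarrow> real" where
  "eigval k = 2 * real k + 1"

definition hermite_fun :: "nat \<Rightarrow> real \<Rightarrow> real" where
  "hermite_fun k x = (- 1) ^ k * (sqrt pi * 2 ^ k * fact k) powr (- 1 / 2) * exp (x\<^sup>2 / 2)
     * (deriv ^^ k) (\<lambda>y. exp (- y\<^sup>2)) x"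

definition phi :: "nat \<Rightarrow> real \<Rightarrow> complex" where
  "phi k = (\<lambda>x. complex_of_real (hermite_fun k x))"

definition ground_state :: "real \<Rightarrow> real \<Rightarrow> complex" where
  "ground_state t = (\<lambda>x. exp (- \<i> * complex_of_real (eigval 0 * t)) * phi 0 x)"


section \<open>The spaces of attainable states\<close>

text \<open>
  The sum over \<open>k \<ge> 1\<close> is written with \<open>k = Suc j\<close> and evaluated in \<open>ennreal\<close>.  If \<open>\<phi>\<^sub>j(a) = 0\<close>
  then the weight is \<open>\<infinity>\<close>, and as \<open>\<infinity> * 0 = 0\<close> in \<open>ennreal\<close>, the norm is finite only if
  the corresponding coefficient vanishes.
\<close>

definition Hha_normsq :: "real \<Rightarrow> (real \<Rightarrow> complex) \<Rightarrow> ennreal" where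
  "Hha_normsq a \<psi> = ennreal ((cmod (L2_inner \<psi> (phi 0)))\<^sup>2)
     + (\<Sum>j. of_nat (Suc j) / ennreal ((hermite_fun j a)\<^sup>2)
              * ennreal ((cmod (L2_inner \<psi> (phi (Suc j))))\<^sup>2))"

definition Hha_norm :: "real \<Rightarrow> (real \<Rightarrow> complex) \<Rightarrow> ennreal" where
  "Hha_norm a \<psi> =
     (if Hha_normsq a \<psi> = \<infinity> then \<infinity> else ennreal (sqrt (enn2real (Hha_normsq a \<psi>))))"

definition Hha :: "real \<Rightarrow> (real \<Rightarrow> complex) set" where
  "Hha a = {\<psi> \<in> L2. Hha_norm a \<psi> < \<infinity>}"

definition continuous_Hha :: "real \<Rightarrow> real \<Rightarrow> (real \<Rightarrow> real \<Rightarrow> complex) \<Rightarrow> bool" where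
  "continuous_Hha a T \<xi> \<longleftrightarrow> (\<forall>t\<in>{0..T}. \<xi> t \<in> Hha a \<and>
     ((\<lambda>s. Hha_norm a (\<lambda>x. \<xi> s x - \<xi> t x)) \<longlongrightarrow> 0) (at t within {0..T}))"

definition X_space :: "real \<Rightarrow> (real \<Rightarrow> complex) set" where
  "X_space t = {\<psi> \<in> L2. Re (L2_inner \<psi> (ground_state t)) = 0}"


section \<open>Mild solutions\<close>

text \<open>
  Mild solutions on \<open>[0, T]\<close> of \<open>\<i> \<partial>\<^sub>t \<xi> = H \<xi> + f(t)\<close>, \<open>\<xi>(0) = \<xi>\<^sub>0\<close>.
\<close>

definition mild_solution ::
    "real \<Rightarrow> (real \<Rightarrow> real \<Rightarrow> complex) \<Rightarrow> (real \<Rightarrow> complex) \<Rightarrow> (real \<Rightarrow> real \<Rightarrow> complex) \<Rightarrow> bool" where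
  "mild_solution T f \<xi>\<^sub>0 \<xi> \<longleftrightarrow> continuous_L2 T \<xi> \<and>
     (\<forall>t\<in>{0..T}. \<exists>I. has_L2_integral {0<..<t} (\<lambda>s. propagator (t - s) (f s)) I \<and>
        ae_eq (\<xi> t) (\<lambda>x. propagator t \<xi>\<^sub>0 x - \<i> * I x))"

definition source ::
    "real \<Rightarrow> (real \<Rightarrow> real) \<Rightarrow> real \<Rightarrow> real \<Rightarrow> complex" where
  "source a u s = (\<lambda>x. complex_of_real (u s) * indicator {a..} x * ground_state s x)"

end

theory Submission
  imports Defs "HOL-Probability.Probability"
begin

text \<open>
  Expand in the Hermite basis.  The propagator multiplies the \<open>k\<close>-th coefficient by
  \<open>exp (- \<i> \<lambda>\<^sub>k t)\<close>, and \<open>\<lambda>\<^sub>k - \<lambda>\<^sub>0 = 2 k\<close>, so that the \<open>k\<close>-th coefficient of the mild solution is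
  \<open>- \<i> m\<^sub>k exp (- \<i> \<lambda>\<^sub>k t) U\<^sub>k(t)\<close> with the trigonometric moments \<open>U\<^sub>k(t) = \<integral>\<^sub>0\<^sup>t u(s) exp (2 \<i> k s) ds\<close>
  and \<open>m\<^sub>k = \<integral>\<^sub>a\<^sup>\<infinity> \<phi>\<^sub>0 \<phi>\<^sub>k\<close>.  The ladder relations integrate the product explicitly,
  \<open>m\<^sub>k\<^sub>+\<^sub>1 = \<phi>\<^sub>0(a) \<phi>\<^sub>k(a) / sqrt (2 (k + 1))\<close>, which is why the weights of \<open>H\<^sub>h\<^sub>,\<^sub>a\<close> are the right ones: a state is
  in \<open>H\<^sub>h\<^sub>,\<^sub>a\<close> iff it is given by square-summable moments.  Bessel's inequality for
  \<open>exp (- 2 \<i> k s)\<close> on an interval \<open>(0, N \<pi>)\<close> then yields regularity and continuity.  Conversely,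
  the functions \<open>exp (2 \<i> k s)\<close>, \<open>k \<in> \<int>\<close>, are orthogonal on \<open>(0, \<pi>)\<close>, so that every square-summable sequence of
  moments with \<open>U\<^sub>0\<close> real, which is the condition \<open>X_space\<close>, is attained by a real control.
\<close>

section \<open>The space of square-integrable functions\<close>

text \<open>\<open>propagator\<close> is given only by its generator. An explicit diagonal group
  shows that the choice in its definition is not vacuous; conversely, the equation y' = -i lambda_k
  y for the coefficients of \<open>propagator t (phi k)\<close>, together with the isometry, forces
  every group with this generator to be diagonal. Both directions rest on H being diagonal on its
  distributional domain, which is Green's identity against Schwartz functions. Since all equalities
  are checked coefficient by coefficient, the Hermite functions must be complete: if f is orthogonal
  to all of them, f phi_0 has zero Fourier transform, because phi_0 decays fast enough to integrate
  the exponential series termwise. Taking N with N pi >= T admits every time horizon in Bessel's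
  inequality; for controllability one period is enough and the control is zero after pi. If phi_j(a)
  = 0, the source does not excite the mode j + 1, and the infinite weight removes exactly this mode
  from the target space. The phases exp(-i lambda_k t) are not equicontinuous in k, so continuity in
  time combines Bessel's inequality for the moments with dominated convergence of series for the
  phases.\<close>

lemma L2_measurable: "f \<in> L2 \<Longrightarrow> f \<in> borel_measurable lborel"
  by (simp add: L2_def)

lemma L2_measurable_borel[measurable_dest]: "f \<in> L2 \<Longrightarrow> f \<in> borel_measurable borel"
  using L2_measurable by simp

lemma borel_measurable_cnj[measurable (raw)]:
  "f \<in> borel_measurable M \<Longrightarrow> (\<lambda>x. cnj (f x)) \<in> borel_measurable M"
  by (rule borel_measurable_continuous_on[where f=cnj]) (intro continuous_intros)+

lemma L2_square_integrable: "f \<in> L2 \<Longrightarrow> integrable lborel (\<lambda>x. (cmod (f x))\<^sup>2)"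
  by (simp add: L2_def)

lemma L2_zero[simp]: "(\<lambda>x. 0) \<in> L2"
  by (simp add: L2_def)

text \<open>The common criterion behind closure under scaling, conjugation and truncation:
  \<open>C\<close> is the factor, or 1 for an operation that does not increase the modulus.\<close>

lemma L2_bound:
  assumes g: "g \<in> borel_measurable lborel" and f: "f \<in> L2"
    and le: "AE x in lborel. cmod (g x) \<le> C * cmod (f x)"
  shows "g \<in> L2"
proof -
  have "integrable lborel (\<lambda>x. (cmod (g x))\<^sup>2)"
  proof (rule Bochner_Integration.integrable_bound)
    show "integrable lborel (\<lambda>x. C\<^sup>2 * (cmod (f x))\<^sup>2)"
      using L2_square_integrable[OF f] by simp
    show "AE x in lborel. norm ((cmod (g x))\<^sup>2) \<le> norm (C\<^sup>2 * (cmod (f x))\<^sup>2)"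
      using le
    proof eventually_elim
      case (elim x)
      then have "(cmod (g x))\<^sup>2 \<le> (C * cmod (f x))\<^sup>2"
        by (intro power_mono) auto
      then show ?case by (simp add: power_mult_distrib)
    qed
  qed (use g in measurable)
  then show ?thesis using g by (simp add: L2_def)
qed

lemma cmod_add_square_le: "(cmod (a + b))\<^sup>2 \<le> 2 * (cmod a)\<^sup>2 + 2 * (cmod b)\<^sup>2"
proof -
  have "(cmod (a + b))\<^sup>2 \<le> (cmod a + cmod b)\<^sup>2"
    by (intro power_mono norm_triangle_ineq) auto
  also have "\<dots> \<le> 2 * (cmod a)\<^sup>2 + 2 * (cmod b)\<^sup>2"
    using zero_le_power2[of "cmod a - cmod b"] by (simp add: power2_eq_square algebra_simps)
  finally show ?thesis .
qed

lemma L2_add: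
  assumes f: "f \<in> L2" and g: "g \<in> L2"
  shows "(\<lambda>x. f x + g x) \<in> L2"
proof -
  have "integrable lborel (\<lambda>x. (cmod (f x + g x))\<^sup>2)"
  proof (rule Bochner_Integration.integrable_bound)
    show "integrable lborel (\<lambda>x. 2 * (cmod (f x))\<^sup>2 + 2 * (cmod (g x))\<^sup>2)"
      using f g by (simp add: L2_def)
    show "AE x in lborel. norm ((cmod (f x + g x))\<^sup>2) \<le> norm (2 * (cmod (f x))\<^sup>2 + 2 * (cmod (g x))\<^sup>2)"
      using cmod_add_square_le by (auto intro!: always_eventually)
  qed (use f g in measurable)
  moreover have "(\<lambda>x. f x + g x) \<in> borel_measurable lborel" using f g by measurable
  ultimately show ?thesis by (simp add: L2_def)
qed

lemma L2_scale: "f \<in> L2 \<Longrightarrow> (\<lambda>x. c * f x) \<in> L2"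
  by (rule L2_bound[where f=f and C="cmod c"]) (auto simp: norm_mult L2_def)

lemma L2_cnj: "f \<in> L2 \<Longrightarrow> (\<lambda>x. cnj (f x)) \<in> L2"
  by (rule L2_bound[where f=f and C=1]) auto

lemma L2_diff: "f \<in> L2 \<Longrightarrow> g \<in> L2 \<Longrightarrow> (\<lambda>x. f x - g x) \<in> L2"
  using L2_add[of f "\<lambda>x. (- 1) * g x"] L2_scale[of g "- 1"] by simp

lemma L2_sum: "(\<And>i. i \<in> I \<Longrightarrow> f i \<in> L2) \<Longrightarrow> (\<lambda>x. \<Sum>i\<in>I. f i x) \<in> L2"
  by (induction I rule: infinite_finite_induct) (auto intro: L2_add)

lemma cmod_mult_le: "cmod (a * b) \<le> (cmod a)\<^sup>2 + (cmod b)\<^sup>2"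
proof -
  have "2 * (cmod a * cmod b) \<le> (cmod a)\<^sup>2 + (cmod b)\<^sup>2"
    using sum_squares_bound[of "cmod a" "cmod b"] by simp
  moreover have "0 \<le> cmod a * cmod b" by simp
  ultimately show ?thesis unfolding norm_mult by linarith
qed

text \<open>The crude bound |fg| <= |f|^2 + |g|^2 gives integrability. The product carries no
  conjugate so that it also covers the bilinear pairings with test functions in
  \<open>harmonic_oscillator\<close>.\<close>

lemma L2_mult_integrable:
  assumes f: "f \<in> L2" and g: "g \<in> L2"
  shows "integrable lborel (\<lambda>x. f x * g x)"
proof (rule Bochner_Integration.integrable_bound)
  show "integrable lborel (\<lambda>x. (cmod (f x))\<^sup>2 + (cmod (g x))\<^sup>2)"
    using f g by (simp add: L2_def)
  show "AE x in lborel. norm (f x * g x) \<le> norm ((cmod (f x))\<^sup>2 + (cmod (g x))\<^sup>2)"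
    by (rule always_eventually) (simp only: real_norm_def abs_of_nonneg[OF add_nonneg_nonneg[OF zero_le_power2 zero_le_power2]] cmod_mult_le, simp)
qed (use f g in measurable)

lemma L2_inner_integrable:
  "f \<in> L2 \<Longrightarrow> g \<in> L2 \<Longrightarrow> integrable lborel (\<lambda>x. f x * cnj (g x))"
  by (intro L2_mult_integrable L2_cnj)

lemma L2_inner_add_left:
  "f \<in> L2 \<Longrightarrow> g \<in> L2 \<Longrightarrow> h \<in> L2 \<Longrightarrow> L2_inner (\<lambda>x. f x + g x) h = L2_inner f h + L2_inner g h"
  by (simp add: L2_inner_def distrib_right Bochner_Integration.integral_add L2_inner_integrable)

lemma L2_inner_diff_left:
  "f \<in> L2 \<Longrightarrow> g \<in> L2 \<Longrightarrow> h \<in> L2 \<Longrightarrow> L2_inner (\<lambda>x. f x - g x) h = L2_inner f h - L2_inner g h"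
  by (simp add: L2_inner_def left_diff_distrib Bochner_Integration.integral_diff L2_inner_integrable)

lemma L2_inner_scale_left: "L2_inner (\<lambda>x. c * f x) h = c * L2_inner f h"
  by (simp add: L2_inner_def mult.assoc)

lemma L2_inner_zero_left[simp]: "L2_inner (\<lambda>x. 0) h = 0"
  by (simp add: L2_inner_def)

lemma L2_inner_sum_left:
  "(\<And>i. i \<in> I \<Longrightarrow> f i \<in> L2) \<Longrightarrow> h \<in> L2 \<Longrightarrow>
    L2_inner (\<lambda>x. \<Sum>i\<in>I. f i x) h = (\<Sum>i\<in>I. L2_inner (f i) h)"
  by (induction I rule: infinite_finite_induct) (auto simp: L2_inner_add_left L2_sum)

lemma L2_inner_commute: "L2_inner g f = cnj (L2_inner f g)"
  unfolding L2_inner_def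
  by (subst Bochner_Integration.integral_cnj[symmetric]) (simp add: mult.commute)

lemma L2_inner_add_right:
  "f \<in> L2 \<Longrightarrow> g \<in> L2 \<Longrightarrow> h \<in> L2 \<Longrightarrow> L2_inner h (\<lambda>x. f x + g x) = L2_inner h f + L2_inner h g"
  using L2_inner_add_left[of f g h] L2_inner_commute by (metis complex_cnj_add)

lemma L2_inner_scale_right: "L2_inner h (\<lambda>x. c * f x) = cnj c * L2_inner h f"
  using L2_inner_scale_left[of c f h] L2_inner_commute by (metis complex_cnj_mult)

lemma L2_norm_nonneg[simp]: "0 \<le> L2_norm f"
  by (simp add: L2_norm_def)

lemma L2_norm_square: "(L2_norm f)\<^sup>2 = (LINT x|lborel. (cmod (f x))\<^sup>2)"
  by (simp add: L2_norm_def)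

lemma L2_inner_self: "L2_inner f f = complex_of_real ((L2_norm f)\<^sup>2)"
  unfolding L2_norm_square L2_inner_def complex_norm_square[symmetric]
  by (simp only: of_real_power[symmetric] integral_complex_of_real)

lemma L2_norm_zero[simp]: "L2_norm (\<lambda>x. 0) = 0"
  by (simp add: L2_norm_def)

lemma L2_norm_scale: "L2_norm (\<lambda>x. c * f x) = cmod c * L2_norm f"
  by (simp add: L2_norm_def norm_mult power_mult_distrib real_sqrt_mult)

lemma L2_norm_minus_commute: "L2_norm (\<lambda>x. f x - g x) = L2_norm (\<lambda>x. g x - f x)"
  by (simp add: L2_norm_def norm_minus_commute)

lemma L2_norm_eq_0_iff: "f \<in> L2 \<Longrightarrow> L2_norm f = 0 \<longleftrightarrow> ae_eq f (\<lambda>x. 0)"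
  unfolding L2_norm_def ae_eq_def
  by (subst real_sqrt_eq_0_iff, subst integral_nonneg_eq_0_iff_AE)
     (auto simp: L2_square_integrable)

lemma ae_eq_refl[simp]: "ae_eq f f"
  by (simp add: ae_eq_def)

lemma ae_eq_sym: "ae_eq f g \<Longrightarrow> ae_eq g f"
  unfolding ae_eq_def by (auto elim: eventually_mono)

lemma L2_inner_ae_cong:
  assumes "ae_eq f f'" "f \<in> L2" "f' \<in> L2" "h \<in> L2"
  shows "L2_inner f h = L2_inner f' h"
  unfolding L2_inner_def
proof (rule integral_cong_AE)
  show "AE x in lborel. f x * cnj (h x) = f' x * cnj (h x)"
    using assms(1) unfolding ae_eq_def by eventually_elim simp
qed (use assms in measurable)

lemma L2_inner_ae_cong_right:
  assumes "ae_eq f f'" "f \<in> L2" "f' \<in> L2" "h \<in> L2"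
  shows "L2_inner h f = L2_inner h f'"
  using L2_inner_ae_cong[OF assms] L2_inner_commute by metis

lemma L2_norm_ae_cong:
  assumes "ae_eq f f'" "f \<in> L2" "f' \<in> L2"
  shows "L2_norm f = L2_norm f'"
proof -
  have "(LINT x|lborel. (cmod (f x))\<^sup>2) = (LINT x|lborel. (cmod (f' x))\<^sup>2)"
  proof (rule integral_cong_AE)
    show "AE x in lborel. (cmod (f x))\<^sup>2 = (cmod (f' x))\<^sup>2"
      using assms(1) unfolding ae_eq_def by eventually_elim simp
  qed (use assms in measurable)
  then show ?thesis by (simp add: L2_norm_def)
qed

lemma L2_norm_add_square:
  assumes "f \<in> L2" "g \<in> L2"
  shows "(L2_norm (\<lambda>x. f x + g x))\<^sup>2 = (L2_norm f)\<^sup>2 + (L2_norm g)\<^sup>2 + 2 * Re (L2_inner f g)"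
proof -
  have "complex_of_real ((L2_norm (\<lambda>x. f x + g x))\<^sup>2) = L2_inner f f + L2_inner g g + (L2_inner f g + cnj (L2_inner f g))"
    using assms by (simp add: L2_inner_self[symmetric] L2_inner_add_left L2_inner_add_right L2_add
        L2_inner_commute[of g f] del: of_real_power)
  then have "complex_of_real ((L2_norm (\<lambda>x. f x + g x))\<^sup>2)
      = complex_of_real ((L2_norm f)\<^sup>2 + (L2_norm g)\<^sup>2 + 2 * Re (L2_inner f g))"
    by (simp add: L2_inner_self complex_add_cnj)
  then show ?thesis by (simp only: of_real_eq_iff)
qed

lemma L2_Cauchy_Schwarz:
  assumes "f \<in> L2" "g \<in> L2"
  shows "cmod (L2_inner f g) \<le> L2_norm f * L2_norm g"
proof (cases "L2_norm g = 0")
  case True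
  then have "ae_eq g (\<lambda>x. 0)" using L2_norm_eq_0_iff assms by blast
  then have "L2_inner g f = 0"
    using L2_inner_ae_cong[of g "\<lambda>x. 0" f] assms by simp
  then have "L2_inner f g = 0" using L2_inner_commute[of f g] by simp
  then show ?thesis using True by simp
next
  case False
  define c where "c = L2_inner f g"
  define N where "N = (L2_norm g)\<^sup>2"
  have N: "N > 0" using False by (simp add: N_def)
  \<comment> \<open>With this \<open>d\<close>, the function f + d g is the component of f
    orthogonal to g, and its squared norm is |f|^2 - |c|^2 / N.\<close>
  define d where "d = - c / of_real N"
  have "0 \<le> (L2_norm (\<lambda>x. f x + d * g x))\<^sup>2" by simp
  also have "\<dots> = (L2_norm f)\<^sup>2 + (cmod d)\<^sup>2 * N + 2 * Re (cnj d * c)"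
    using assms by (simp add: L2_norm_add_square L2_scale L2_inner_scale_right L2_norm_scale
        power_mult_distrib c_def N_def)
  also have "Re (cnj d * c) = - (cmod c)\<^sup>2 / N"
  proof -
    have "cnj d * c = - (c * cnj c) / of_real N" by (simp add: d_def)
    also have "\<dots> = of_real (- (cmod c)\<^sup>2 / N)" by (simp add: complex_norm_square[symmetric])
    finally show ?thesis by simp
  qed
  also have "(cmod d)\<^sup>2 * N = (cmod c)\<^sup>2 / N"
    using N by (simp add: d_def norm_divide power_divide power2_eq_square)
  finally have "(cmod c)\<^sup>2 / N \<le> (L2_norm f)\<^sup>2" by simp
  then have "(cmod c)\<^sup>2 \<le> (L2_norm f * L2_norm g)\<^sup>2"
    using N by (simp add: field_simps N_def)
  then show ?thesis unfolding c_def by (rule power2_le_imp_le) simp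
qed

lemma L2_norm_triangle:
  assumes "f \<in> L2" "g \<in> L2"
  shows "L2_norm (\<lambda>x. f x + g x) \<le> L2_norm f + L2_norm g"
proof (rule power2_le_imp_le)
  have "Re (L2_inner f g) \<le> L2_norm f * L2_norm g"
    using L2_Cauchy_Schwarz[OF assms] complex_Re_le_cmod order_trans by blast
  then show "(L2_norm (\<lambda>x. f x + g x))\<^sup>2 \<le> (L2_norm f + L2_norm g)\<^sup>2"
    unfolding L2_norm_add_square[OF assms] by (simp add: power2_sum)
qed simp

lemma L2_norm_diff_triangle:
  assumes "f \<in> L2" "g \<in> L2" "h \<in> L2"
  shows "L2_norm (\<lambda>x. f x - h x) \<le> L2_norm (\<lambda>x. f x - g x) + L2_norm (\<lambda>x. g x - h x)"
  using L2_norm_triangle[of "\<lambda>x. f x - g x" "\<lambda>x. g x - h x"] assms by (simp add: L2_diff)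

lemma L2_norm_sum_le:
  "(\<And>i. i \<in> I \<Longrightarrow> f i \<in> L2) \<Longrightarrow> L2_norm (\<lambda>x. \<Sum>i\<in>I. f i x) \<le> (\<Sum>i\<in>I. L2_norm (f i))"
proof (induction I rule: infinite_finite_induct)
  case (insert i I)
  have "L2_norm (\<lambda>x. f i x + (\<Sum>i\<in>I. f i x)) \<le> L2_norm (f i) + L2_norm (\<lambda>x. \<Sum>i\<in>I. f i x)"
    using insert by (intro L2_norm_triangle L2_sum) auto
  then show ?case using insert by auto
qed simp_all

subsection \<open>Completeness\<close>

text \<open>The Borel--Cantelli argument behind completeness: \<open>\<Sum> 2\<^sup>k \<bar>F (k + 1) - F k\<bar>\<^sup>2\<close> is integrable,
  so the increments are absolutely summable almost everywhere.\<close>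

lemma L2_fast_Cauchy_AE_convergent:
  assumes F: "\<And>n. F n \<in> L2"
    and fast: "\<And>n. (L2_norm (\<lambda>x. F (Suc n) x - F n x))\<^sup>2 \<le> (1/4) ^ n"
  shows "AE x in lborel. convergent (\<lambda>n. F n x)"
proof -
  define d where "d n x = F (Suc n) x - F n x" for n x
  have d: "d n \<in> L2" for n unfolding d_def using F by (intro L2_diff)
  define w where "w n x = 2 ^ n * (cmod (d n x))\<^sup>2" for n x
  have w_int: "integrable lborel (w n)" for n
    unfolding w_def using L2_square_integrable[OF d] by simp
  have "(\<integral>x. w n x \<partial>lborel) = 2 ^ n * (L2_norm (d n))\<^sup>2" for n
    by (simp add: w_def L2_norm_square)
  also have "\<And>n. 2 ^ n * (L2_norm (d n))\<^sup>2 \<le> 2 ^ n * (1/4) ^ n"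
    using fast unfolding d_def by (intro mult_left_mono) auto
  also have "\<And>n. 2 ^ n * (1/4) ^ n = (1/2 :: real) ^ n"
    by (simp add: power_mult_distrib[symmetric])
  finally have w_le: "(\<integral>x. w n x \<partial>lborel) \<le> (1/2) ^ n" for n .
  have w_nn: "0 \<le> w n x" for n x by (simp add: w_def)
  have "(\<integral>\<^sup>+x. (\<Sum>n. ennreal (w n x)) \<partial>lborel) = (\<Sum>n. \<integral>\<^sup>+x. ennreal (w n x) \<partial>lborel)"
    using w_int by (intro nn_integral_suminf) auto
  also have "\<dots> = (\<Sum>n. ennreal (\<integral>x. w n x \<partial>lborel))"
    using w_int w_nn by (simp add: nn_integral_eq_integral)
  also have "\<dots> \<le> (\<Sum>n. ennreal ((1/2) ^ n))"
    using w_le by (intro suminf_le ennreal_leI) auto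
  also have "\<dots> = ennreal (\<Sum>n. (1/2) ^ n)"
    by (rule suminf_ennreal2) (auto intro: summable_geometric)
  also have "\<dots> < \<infinity>" by (rule ennreal_less_top[unfolded infinity_ennreal_def[symmetric]])
  finally have "AE x in lborel. (\<Sum>n. ennreal (w n x)) \<noteq> \<infinity>"
    using w_int by (intro nn_integral_noteq_infinite) auto
  then show ?thesis
  proof eventually_elim
    case (elim x)
    then have w_summable: "summable (\<lambda>n. w n x)"
      using w_nn by (intro summable_suminf_not_top) auto
    have "summable (\<lambda>n. cmod (d n x))"
    proof (rule summable_comparison_test')
      show "summable (\<lambda>n. w n x + (1/2) ^ n)"
        using w_summable by (intro summable_add) (auto simp: summable_geometric)
      fix n
      \<comment> \<open>Splitting the increment as (2^(n/2) |d_n|) * 2^(-n/2) bounds it by the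
        summable w_n plus a geometric term.\<close>
      have "cmod (d n x) = sqrt (2 ^ n) * cmod (d n x) * sqrt ((1/2) ^ n)"
        by (simp add: real_sqrt_mult[symmetric] power_mult_distrib[symmetric] real_sqrt_power)
      also have "\<dots> \<le> (sqrt (2 ^ n) * cmod (d n x))\<^sup>2 + (sqrt ((1/2) ^ n))\<^sup>2"
        using cmod_mult_le[of "of_real (sqrt (2 ^ n) * cmod (d n x))" "of_real (sqrt ((1/2) ^ n))"]
        by (simp add: norm_mult)
      also have "\<dots> = w n x + (1/2) ^ n" by (simp add: w_def power_mult_distrib)
      finally show "norm (cmod (d n x)) \<le> w n x + (1/2) ^ n" by simp
    qed
    then have "summable (\<lambda>n. d n x)" by (rule summable_norm_cancel)
    then have "convergent (\<lambda>n. \<Sum>i<n. d i x)"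
      by (simp add: summable_iff_convergent)
    moreover have "(\<Sum>i<n. d i x) = F n x - F 0 x" for n
      unfolding d_def by (rule sum_lessThan_telescope)
    ultimately have "convergent (\<lambda>n. (F n x - F 0 x) + F 0 x)"
      by (intro convergent_add) (auto simp: convergent_const)
    then show ?case by simp
  qed
qed

text \<open>Fatou's lemma gives membership and the norm bound at once. The bound is assumed only
  eventually because for a Cauchy sequence it holds only for large indices.\<close>

lemma L2_Fatou:
  assumes F: "\<And>n. F n \<in> L2" and g: "g \<in> borel_measurable lborel"
    and lim: "AE x in lborel. (\<lambda>n. F n x) \<longlonglongrightarrow> g x"
    and bound: "eventually (\<lambda>n. L2_norm (F n) \<le> B) sequentially"
  shows "g \<in> L2" "L2_norm g \<le> B"
proof -
  obtain n where "L2_norm (F n) \<le> B"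
    using eventually_happens[OF bound] by auto
  then have B: "0 \<le> B" using L2_norm_nonneg[of "F n"] by linarith
  have "(\<integral>\<^sup>+x. ennreal ((cmod (g x))\<^sup>2) \<partial>lborel)
      = (\<integral>\<^sup>+x. liminf (\<lambda>n. ennreal ((cmod (F n x))\<^sup>2)) \<partial>lborel)"
  proof (rule nn_integral_cong_AE)
    show "AE x in lborel. ennreal ((cmod (g x))\<^sup>2) = liminf (\<lambda>n. ennreal ((cmod (F n x))\<^sup>2))"
      using lim
    proof eventually_elim
      case (elim x)
      have "(\<lambda>n. ennreal ((cmod (F n x))\<^sup>2)) \<longlonglongrightarrow> ennreal ((cmod (g x))\<^sup>2)"
        by (intro tendsto_ennrealI tendsto_intros elim)
      then show ?case by (rule lim_imp_Liminf[OF trivial_limit_sequentially, symmetric])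
    qed
  qed
  also have "\<dots> \<le> liminf (\<lambda>n. \<integral>\<^sup>+x. ennreal ((cmod (F n x))\<^sup>2) \<partial>lborel)"
    by (rule nn_integral_liminf) (use F in measurable)
  also have "\<dots> = liminf (\<lambda>n. ennreal ((L2_norm (F n))\<^sup>2))"
    using L2_square_integrable[OF F] by (simp add: nn_integral_eq_integral L2_norm_square)
  also have "\<dots> \<le> liminf (\<lambda>n. ennreal (B\<^sup>2))"
    by (rule Liminf_mono) (use bound in \<open>auto elim!: eventually_mono intro!: ennreal_leI power_mono\<close>)
  also have "\<dots> = ennreal (B\<^sup>2)" by (simp add: Liminf_const)
  finally have le: "(\<integral>\<^sup>+x. ennreal ((cmod (g x))\<^sup>2) \<partial>lborel) \<le> ennreal (B\<^sup>2)" .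
  have "integrable lborel (\<lambda>x. (cmod (g x))\<^sup>2)"
    by (rule integrableI_nonneg) (use g le in \<open>auto intro: le_less_trans\<close>)
  then show "g \<in> L2" using g by (simp add: L2_def)
  then have "ennreal ((L2_norm g)\<^sup>2) \<le> ennreal (B\<^sup>2)"
    using le by (simp add: L2_norm_square nn_integral_eq_integral L2_square_integrable)
  then have "(L2_norm g)\<^sup>2 \<le> B\<^sup>2" by (subst (asm) ennreal_le_iff) auto
  then show "L2_norm g \<le> B" using B by (rule power2_le_imp_le)
qed

theorem L2_complete:
  assumes F: "\<And>n. F n \<in> L2"
    and cauchy: "\<And>e. e > 0 \<Longrightarrow> \<exists>N. \<forall>m\<ge>N. \<forall>n\<ge>N. L2_norm (\<lambda>x. F m x - F n x) < e"
  shows "\<exists>g\<in>L2. (\<lambda>n. L2_norm (\<lambda>x. F n x - g x)) \<longlonglongrightarrow> 0"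
proof -
  obtain N where N: "\<And>e m n. e > 0 \<Longrightarrow> m \<ge> N e \<Longrightarrow> n \<ge> N e \<Longrightarrow> L2_norm (\<lambda>x. F m x - F n x) < e"
    using cauchy by metis
  \<comment> \<open>Indices of a subsequence: strictly increasing, with increments below 2^(-n) in
    norm, hence below 4^(-n) after squaring.\<close>
  define r where "r = rec_nat (N 1) (\<lambda>n p. max (Suc p) (N ((1/2) ^ Suc n)))"
  have r_Suc: "r (Suc n) = max (Suc (r n)) (N ((1/2) ^ Suc n))" for n by (simp add: r_def)
  have r_ge: "r n \<ge> N ((1/2) ^ n)" for n
    by (cases n) (simp add: r_def, simp add: r_Suc)
  have r_mono: "strict_mono r" by (rule strict_monoI_Suc) (simp add: r_Suc)
  have "AE x in lborel. convergent (\<lambda>n. F (r n) x)"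
  proof (rule L2_fast_Cauchy_AE_convergent[OF F])
    fix n
    have "L2_norm (\<lambda>x. F (r (Suc n)) x - F (r n) x) < (1/2) ^ n"
      using r_ge[of n] r_Suc[of n] by (intro N) auto
    then have "(L2_norm (\<lambda>x. F (r (Suc n)) x - F (r n) x))\<^sup>2 \<le> ((1/2) ^ n)\<^sup>2"
      by (intro power_mono) auto
    also have "\<dots> = (1/4) ^ n" by (simp add: power2_eq_square power_mult_distrib[symmetric])
    finally show "(L2_norm (\<lambda>x. F (r (Suc n)) x - F (r n) x))\<^sup>2 \<le> (1/4) ^ n" .
  qed
  moreover define g where "g x = lim (\<lambda>n. F (r n) x)" for x
  ultimately have lim: "AE x in lborel. (\<lambda>n. F (r n) x) \<longlonglongrightarrow> g x"
    by (simp add: convergent_LIMSEQ_iff)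
  have g_meas: "g \<in> borel_measurable lborel"
    unfolding g_def by (rule borel_measurable_lim_metric) (use F in \<open>simp add: L2_def\<close>)
  \<comment> \<open>Fatou's lemma with \<open>n\<close> fixed and the subsequence index going to
    infinity: F n is close to the pointwise limit, not only to later members of the
    sequence.\<close>
  have close: "(\<lambda>x. F n x - g x) \<in> L2 \<and> L2_norm (\<lambda>x. F n x - g x) \<le> e"
    if e: "e > 0" and n: "n \<ge> N e" for e n
  proof -
    have 1: "(\<lambda>x. F n x - F (r m) x) \<in> L2" for m using F by (intro L2_diff)
    have 2: "(\<lambda>x. F n x - g x) \<in> borel_measurable lborel" using g_meas F by measurable
    have 3: "AE x in lborel. (\<lambda>m. F n x - F (r m) x) \<longlonglongrightarrow> F n x - g x"
      using lim by eventually_elim (intro tendsto_intros)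
    have 4: "eventually (\<lambda>m. L2_norm (\<lambda>x. F n x - F (r m) x) \<le> e) sequentially"
      using eventually_ge_at_top[of "N e"]
    proof eventually_elim
      case (elim m)
      then have "r m \<ge> N e" using seq_suble[OF r_mono, of m] by linarith
      then show ?case using N[OF e n] by (intro less_imp_le) auto
    qed
    show ?thesis using L2_Fatou[OF 1 2 3 4] by blast
  qed
  have "(\<lambda>x. F (N 1) x - g x) \<in> L2" using close[of 1 "N 1"] by simp
  then have "(\<lambda>x. F (N 1) x - (F (N 1) x - g x)) \<in> L2" by (rule L2_diff[OF F])
  moreover have "(\<lambda>x. F (N 1) x - (F (N 1) x - g x)) = g" by (rule ext) (rule diff_diff_eq2[THEN trans], simp)
  ultimately have "g \<in> L2" by (simp only:)
  moreover have "(\<lambda>n. L2_norm (\<lambda>x. F n x - g x)) \<longlonglongrightarrow> 0"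
  proof (rule LIMSEQ_I)
    fix e :: real assume e: "e > 0"
    show "\<exists>no. \<forall>n\<ge>no. norm (L2_norm (\<lambda>x. F n x - g x) - 0) < e"
      using close[of "e/2"] e by (intro exI[of _ "N (e/2)"]) force
  qed
  ultimately show ?thesis by blast
qed

subsection \<open>Orthonormal sequences\<close>

definition orthonormal :: "(nat \<Rightarrow> real \<Rightarrow> complex) \<Rightarrow> bool" where
  "orthonormal e \<longleftrightarrow> (\<forall>k. e k \<in> L2) \<and> (\<forall>j k. L2_inner (e j) (e k) = (if j = k then 1 else 0))"

lemma orthonormal_L2: "orthonormal e \<Longrightarrow> e k \<in> L2"
  and orthonormal_inner: "orthonormal e \<Longrightarrow> L2_inner (e j) (e k) = (if j = k then 1 else 0)"
  by (simp_all add: orthonormal_def)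

lemma orthonormal_norm: "orthonormal e \<Longrightarrow> L2_norm (e k) = 1"
  using L2_inner_self[of "e k"] orthonormal_inner[of e k k]
  by (simp add: power2_eq_1_iff del: of_real_power) (use L2_norm_nonneg[of "e k"] in linarith)

lemma orthonormal_combination_L2: "orthonormal e \<Longrightarrow> (\<lambda>x. \<Sum>k\<in>I. c k * e k x) \<in> L2"
  by (intro L2_sum L2_scale orthonormal_L2)

lemma orthonormal_combination_inner:
  assumes e: "orthonormal e" and I: "finite I"
  shows "L2_inner (\<lambda>x. \<Sum>k\<in>I. c k * e k x) (e j) = (if j \<in> I then c j else 0)"
proof -
  have "L2_inner (\<lambda>x. \<Sum>k\<in>I. c k * e k x) (e j) = (\<Sum>k\<in>I. c k * (if k = j then 1 else 0))"
    using e by (subst L2_inner_sum_left)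
      (auto simp: L2_inner_scale_left orthonormal_inner intro!: L2_scale orthonormal_L2[OF e])
  also have "\<dots> = (\<Sum>k\<in>I. if k = j then c k else 0)" by (intro sum.cong) auto
  also have "\<dots> = (if j \<in> I then c j else 0)" using I by (simp add: sum.delta)
  finally show ?thesis .
qed

lemma orthonormal_combination_norm:
  assumes e: "orthonormal e" and I: "finite I"
  shows "(L2_norm (\<lambda>x. \<Sum>k\<in>I. c k * e k x))\<^sup>2 = (\<Sum>k\<in>I. (cmod (c k))\<^sup>2)"
  using I
proof (induction I)
  case (insert i I)
  have 1: "(\<lambda>x. c i * e i x) \<in> L2" using e by (intro L2_scale orthonormal_L2)
  have "L2_inner (\<lambda>x. \<Sum>k\<in>I. c k * e k x) (\<lambda>x. c i * e i x) = 0"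
    using insert by (simp add: L2_inner_scale_right orthonormal_combination_inner e)
  then have 2: "L2_inner (\<lambda>x. c i * e i x) (\<lambda>x. \<Sum>k\<in>I. c k * e k x) = 0"
    using L2_inner_commute[of "\<lambda>x. c i * e i x"] by simp
  have "(L2_norm (\<lambda>x. c i * e i x + (\<Sum>k\<in>I. c k * e k x)))\<^sup>2
      = (cmod (c i))\<^sup>2 + (\<Sum>k\<in>I. (cmod (c k))\<^sup>2)"
    using insert by (subst L2_norm_add_square[OF 1 orthonormal_combination_L2[OF e]])
      (simp add: 2 L2_norm_scale orthonormal_norm[OF e])
  then show ?case using insert by simp
qed simp

text \<open>Pythagoras for f = s + r, where s is the orthogonal projection of f to the span of the
  \<open>e k\<close> with \<open>k\<close> in \<open>I\<close>.\<close>

lemma Bessel_finite: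
  assumes e: "orthonormal e" and f: "f \<in> L2" and I: "finite I"
  shows "(\<Sum>k\<in>I. (cmod (L2_inner f (e k)))\<^sup>2) \<le> (L2_norm f)\<^sup>2"
proof -
  define s where "s x = (\<Sum>k\<in>I. L2_inner f (e k) * e k x)" for x
  define r where "r x = f x - s x" for x
  have s: "s \<in> L2" unfolding s_def using e by (rule orthonormal_combination_L2)
  have r: "r \<in> L2" unfolding r_def using f s by (rule L2_diff)
  have "L2_inner s (e k) = L2_inner f (e k)" if "k \<in> I" for k
    using that unfolding s_def[abs_def] by (simp add: orthonormal_combination_inner[OF e I])
  then have orth: "L2_inner r (e k) = 0" if "k \<in> I" for k
    using that unfolding r_def[abs_def] by (simp add: L2_inner_diff_left[OF f s orthonormal_L2[OF e]])
  have "L2_inner s r = (\<Sum>k\<in>I. L2_inner f (e k) * L2_inner (e k) r)"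
    unfolding s_def[abs_def] using e r
    by (subst L2_inner_sum_left) (auto intro: L2_scale orthonormal_L2 simp: L2_inner_scale_left)
  also have "\<dots> = 0"
    using orth L2_inner_commute[of _ r] by (intro sum.neutral) (metis complex_cnj_zero mult_zero_right)
  finally have sr: "L2_inner s r = 0" .
  have "(L2_norm f)\<^sup>2 = (L2_norm (\<lambda>x. s x + r x))\<^sup>2" by (simp add: r_def)
  also have "\<dots> = (L2_norm s)\<^sup>2 + (L2_norm r)\<^sup>2" using s r sr by (simp add: L2_norm_add_square)
  also have "(L2_norm s)\<^sup>2 = (\<Sum>k\<in>I. (cmod (L2_inner f (e k)))\<^sup>2)"
    unfolding s_def[abs_def] by (rule orthonormal_combination_norm[OF e I])
  finally show ?thesis by simp
qed

lemma Bessel: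
  assumes e: "orthonormal e" and f: "f \<in> L2"
  shows "summable (\<lambda>k. (cmod (L2_inner f (e k)))\<^sup>2)"
    and "(\<Sum>k. (cmod (L2_inner f (e k)))\<^sup>2) \<le> (L2_norm f)\<^sup>2"
proof -
  show s: "summable (\<lambda>k. (cmod (L2_inner f (e k)))\<^sup>2)"
    by (rule summableI_nonneg_bounded[where x="(L2_norm f)\<^sup>2"])
       (auto intro: Bessel_finite[OF e f])
  show "(\<Sum>k. (cmod (L2_inner f (e k)))\<^sup>2) \<le> (L2_norm f)\<^sup>2"
    by (rule suminf_le_const[OF s]) (auto intro: Bessel_finite[OF e f])
qed

text \<open>By orthonormality the squared norm of a block of the series is the corresponding block
  of the sum of |c_k|^2, so the partial sums inherit the Cauchy property and completeness
  applies.\<close>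

theorem Riesz_Fischer:
  assumes e: "orthonormal e" and c: "summable (\<lambda>k. (cmod (c k))\<^sup>2)"
  shows "\<exists>f\<in>L2. (\<lambda>n. L2_norm (\<lambda>x. (\<Sum>k<n. c k * e k x) - f x)) \<longlonglongrightarrow> 0"
proof (rule L2_complete)
  fix d :: real assume d: "d > 0"
  define S where "S n x = (\<Sum>k<n. c k * e k x)" for n x
  from c d obtain N where N: "\<And>m n. m \<ge> N \<Longrightarrow> norm (\<Sum>k=m..<n. (cmod (c k))\<^sup>2) < d\<^sup>2"
    unfolding summable_Cauchy by (meson zero_less_power)
  have less: "L2_norm (\<lambda>x. S n x - S m x) < d" if mn: "N \<le> m" "m \<le> n" for m n
  proof -
    have "(\<lambda>x. S n x - S m x) = (\<lambda>x. \<Sum>k=m..<n. c k * e k x)"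
      unfolding S_def using mn(2)
      by (auto simp: fun_eq_iff lessThan_atLeast0 intro!: sum_diff_nat_ivl)
    then have "(L2_norm (\<lambda>x. S n x - S m x))\<^sup>2 = (\<Sum>k=m..<n. (cmod (c k))\<^sup>2)"
      by (simp add: orthonormal_combination_norm[OF e])
    also have "\<dots> < d\<^sup>2" using N[OF mn(1), of n] by simp
    finally show ?thesis using d power_less_imp_less_base[of _ 2 d] by simp
  qed
  show "\<exists>N. \<forall>m\<ge>N. \<forall>n\<ge>N. L2_norm (\<lambda>x. (\<Sum>k<m. c k * e k x) - (\<Sum>k<n. c k * e k x)) < d"
  proof (intro exI allI impI)
    fix m n assume "N \<le> m" "N \<le> n"
    then have "L2_norm (\<lambda>x. S m x - S n x) < d"
      using less[of n m] less[of m n] L2_norm_minus_commute[of "S n" "S m"] by (cases "m \<le> n") auto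
    then show "L2_norm (\<lambda>x. (\<Sum>k<m. c k * e k x) - (\<Sum>k<n. c k * e k x)) < d"
      by (simp add: S_def)
  qed
qed (rule orthonormal_combination_L2[OF e])

lemma L2_inner_tendsto:
  assumes F: "\<And>n. F n \<in> L2" and f: "f \<in> L2" and g: "g \<in> L2"
    and lim: "((\<lambda>n. L2_norm (\<lambda>x. F n x - f x)) \<longlongrightarrow> 0) G"
  shows "((\<lambda>n. L2_inner (F n) g) \<longlongrightarrow> L2_inner f g) G"
proof (rule LIM_zero_cancel, rule Lim_null_comparison)
  show "((\<lambda>n. L2_norm (\<lambda>x. F n x - f x) * L2_norm g) \<longlongrightarrow> 0) G"
    using tendsto_mult_left_zero[OF lim] .
  show "\<forall>\<^sub>F n in G. norm (L2_inner (F n) g - L2_inner f g) \<le> L2_norm (\<lambda>x. F n x - f x) * L2_norm g"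
    using L2_Cauchy_Schwarz[OF L2_diff[OF F f] g] F f g
    by (intro always_eventually) (simp add: L2_inner_diff_left)
qed

text \<open>The j-th coefficient of the partial sums is constant from n = j + 1 on, and it passes to
  the limit.\<close>

lemma Riesz_Fischer_inner:
  assumes e: "orthonormal e" and f: "f \<in> L2"
    and lim: "(\<lambda>n. L2_norm (\<lambda>x. (\<Sum>k<n. c k * e k x) - f x)) \<longlonglongrightarrow> 0"
  shows "L2_inner f (e j) = c j"
proof -
  have "(\<lambda>n. L2_inner (\<lambda>x. \<Sum>k<n. c k * e k x) (e j)) \<longlonglongrightarrow> L2_inner f (e j)"
    by (rule L2_inner_tendsto[OF orthonormal_combination_L2[OF e] f orthonormal_L2[OF e] lim])
  moreover have "\<forall>\<^sub>F n in sequentially. L2_inner (\<lambda>x. \<Sum>k<n. c k * e k x) (e j) = c j"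
    using eventually_gt_at_top[of j]
    by eventually_elim (simp add: orthonormal_combination_inner[OF e])
  ultimately have "(\<lambda>n. c j) \<longlonglongrightarrow> L2_inner f (e j)" by (rule Lim_transform_eventually)
  then show ?thesis by (simp add: LIMSEQ_const_iff)
qed

text \<open>Completeness as triviality of the orthogonal complement, the form in which it is
  verified for the Hermite functions; expansion and Parseval are derived from it.\<close>

definition complete_orthonormal :: "(nat \<Rightarrow> real \<Rightarrow> complex) \<Rightarrow> bool" where
  "complete_orthonormal e \<longleftrightarrow> orthonormal e \<and>
     (\<forall>f\<in>L2. (\<forall>k. L2_inner f (e k) = 0) \<longrightarrow> ae_eq f (\<lambda>x. 0))"

lemma complete_orthonormal_ae_eq:
  assumes e: "complete_orthonormal e" and f: "f \<in> L2" and g: "g \<in> L2"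
    and eq: "\<And>k. L2_inner f (e k) = L2_inner g (e k)"
  shows "ae_eq f g"
proof -
  have "L2_inner (\<lambda>x. f x - g x) (e k) = 0" for k
    using e f g eq[of k] by (simp add: L2_inner_diff_left complete_orthonormal_def orthonormal_L2)
  then have "ae_eq (\<lambda>x. f x - g x) (\<lambda>x. 0)"
    using e L2_diff[OF f g] unfolding complete_orthonormal_def by blast
  then show ?thesis by (simp add: ae_eq_def)
qed

text \<open>The series converges to some g by Bessel and Riesz-Fischer; g has the coefficients of f,
  so the two agree almost everywhere.\<close>

lemma complete_orthonormal_expansion:
  assumes e: "complete_orthonormal e" and f: "f \<in> L2"
  shows "(\<lambda>n. L2_norm (\<lambda>x. (\<Sum>k<n. L2_inner f (e k) * e k x) - f x)) \<longlonglongrightarrow> 0"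
proof -
  have o: "orthonormal e" using e by (simp add: complete_orthonormal_def)
  obtain g where g: "g \<in> L2"
    and lim: "(\<lambda>n. L2_norm (\<lambda>x. (\<Sum>k<n. L2_inner f (e k) * e k x) - g x)) \<longlonglongrightarrow> 0"
    using Riesz_Fischer[OF o Bessel(1)[OF o f]] by blast
  have "ae_eq g f"
    using complete_orthonormal_ae_eq[OF e g f] Riesz_Fischer_inner[OF o g lim] by blast
  then have "L2_norm (\<lambda>x. (\<Sum>k<n. L2_inner f (e k) * e k x) - g x)
      = L2_norm (\<lambda>x. (\<Sum>k<n. L2_inner f (e k) * e k x) - f x)" for n
    using f g orthonormal_combination_L2[OF o, where I="{..<n}" and c="\<lambda>k. L2_inner f (e k)"]
    by (intro L2_norm_ae_cong L2_diff) (auto simp: ae_eq_def elim: eventually_mono)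
  then show ?thesis using lim by simp
qed

theorem Parseval_inner:
  assumes e: "complete_orthonormal e" and f: "f \<in> L2" and g: "g \<in> L2"
  shows "(\<lambda>k. L2_inner f (e k) * cnj (L2_inner g (e k))) sums L2_inner f g"
proof -
  have o: "orthonormal e" using e by (simp add: complete_orthonormal_def)
  have "(\<lambda>n. L2_inner (\<lambda>x. \<Sum>k<n. L2_inner f (e k) * e k x) g) \<longlonglongrightarrow> L2_inner f g"
    using complete_orthonormal_expansion[OF e f] f g o
    by (intro L2_inner_tendsto orthonormal_combination_L2)
  moreover have "L2_inner (\<lambda>x. \<Sum>k<n. L2_inner f (e k) * e k x) g
      = (\<Sum>k<n. L2_inner f (e k) * cnj (L2_inner g (e k)))" for n
    using o g L2_inner_commute[of _ g]
    by (subst L2_inner_sum_left) (auto intro: L2_scale orthonormal_L2 simp: L2_inner_scale_left)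
  ultimately show ?thesis by (simp add: sums_def)
qed

theorem Parseval:
  assumes e: "complete_orthonormal e" and f: "f \<in> L2"
  shows "(\<lambda>k. (cmod (L2_inner f (e k)))\<^sup>2) sums (L2_norm f)\<^sup>2"
proof -
  have "(\<lambda>k. complex_of_real ((cmod (L2_inner f (e k)))\<^sup>2)) sums complex_of_real ((L2_norm f)\<^sup>2)"
    using Parseval_inner[OF e f f] by (simp add: L2_inner_self complex_norm_square del: of_real_power)
  then show ?thesis by (simp only: sums_of_real_iff)
qed

section \<open>Hermite functions\<close>

lemma LBINT_derivative:
  fixes f F :: "real \<Rightarrow> 'a::euclidean_space"
  assumes F: "\<And>x. (F has_vector_derivative f x) (at x)"
    and f: "\<And>x. isCont f x" "integrable lborel f"
    and A: "(F \<longlongrightarrow> A) at_bot" and B: "(F \<longlongrightarrow> B) at_top"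
  shows "(LINT x|lborel. f x) = B - A"
proof -
  have "(LBINT x=-\<infinity>..\<infinity>. f x) = B - A"
    by (rule interval_integral_FTC_integrable[where F=F])
       (use assms in \<open>auto simp: ereal_tendsto_simps set_integrable_def\<close>)
  then show ?thesis
    by (simp add: interval_lebesgue_integral_def set_lebesgue_integral_def)
qed

text \<open>The surviving boundary term at \<open>a\<close> is where point values of Hermite
  functions, and with them the weights of \<open>Hha\<close>, come from.\<close>

lemma LBINT_derivative_atLeast:
  fixes f F :: "real \<Rightarrow> 'a::euclidean_space"
  assumes F: "\<And>x. (F has_vector_derivative f x) (at x)"
    and f: "\<And>x. isCont f x" "integrable lborel f"
    and B: "(F \<longlongrightarrow> B) at_top"
  shows "(LINT x|lborel. indicator {a..} x *\<^sub>R f x) = B - F a"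
proof -
  have "(F \<longlongrightarrow> F a) (at_right a)"
    using F[of a] has_vector_derivative_continuous[of F "f a" a]
    by (auto simp: continuous_within intro: tendsto_within_subset)
  then have "(LBINT x=ereal a..\<infinity>. f x) = B - F a"
    by (intro interval_integral_FTC_integrable[where F=F])
       (use assms in \<open>auto simp: ereal_tendsto_simps set_integrable_def intro!: integrable_mult_indicator\<close>)
  also have "(LBINT x=ereal a..\<infinity>. f x) = (LINT x|lborel. indicator {a<..} x *\<^sub>R f x)"
    by (simp add: interval_integral_to_infinity_eq set_lebesgue_integral_def)
  \<comment> \<open>The interval integral leaves out the endpoint \<open>a\<close>, a null
    set.\<close>
  also have "\<dots> = (LINT x|lborel. indicator {a..} x *\<^sub>R f x)"
  proof (rule integral_cong_AE)
    show "AE x in lborel. indicator {a<..} x *\<^sub>R f x = indicator {a..} x *\<^sub>R f x"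
      using AE_lborel_singleton[of a] by eventually_elim (auto simp: indicator_def)
  qed (use f in auto)
  finally show ?thesis .
qed

section \<open>Hermite polynomials and the ladder relations\<close>

fun hermite_poly :: "nat \<Rightarrow> real poly" where
  "hermite_poly 0 = 1"
| "hermite_poly (Suc k) = [:0, 2:] * hermite_poly k - pderiv (hermite_poly k)"

text \<open>Rodrigues' formula: the recursion of \<open>hermite_poly\<close> is what one
  differentiation of polynomial times Gaussian produces, so these are the physicists' Hermite
  polynomials.\<close>

lemma iterated_deriv_gaussian:
  "(deriv ^^ k) (\<lambda>y. exp (- y\<^sup>2)) = (\<lambda>x. (- 1) ^ k * poly (hermite_poly k) x * exp (- x\<^sup>2) :: real)"
proof (induction k)
  case (Suc k)
  have "((\<lambda>x. (- 1) ^ k * poly (hermite_poly k) x * exp (- x\<^sup>2)) has_real_derivative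
      (- 1) ^ Suc k * poly (hermite_poly (Suc k)) x * exp (- x\<^sup>2)) (at x)" for x :: real
    by (auto intro!: derivative_eq_intros poly_DERIV simp: algebra_simps)
  then show ?case by (auto simp: Suc.IH intro: DERIV_imp_deriv)
qed simp

text \<open>Differentiating the recursion and inserting the induction hypothesis reproduces the
  recursion one level lower, multiplied by 2(k + 1); the product rule adds the missing 2.\<close>

lemma pderiv_hermite_poly:
  "pderiv (hermite_poly (Suc k)) = smult (2 * real (Suc k)) (hermite_poly k)"
proof (induction k)
  case 0
  have "pderiv [:0, 2::real:] = [:2:]" by (simp add: pderiv_pCons)
  then show ?case by (simp add: pderiv_diff pderiv_mult pderiv_1 one_pCons)
next
  case (Suc k)
  have "pderiv (hermite_poly (Suc (Suc k)))
     = [:2:] * hermite_poly (Suc k) + [:0, 2:] * pderiv (hermite_poly (Suc k)) - pderiv (pderiv (hermite_poly (Suc k)))"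
    by (simp only: hermite_poly.simps(2)[of "Suc k"] pderiv_diff pderiv_mult) (simp add: pderiv_pCons mult.commute)
  also have "\<dots> = smult 2 (hermite_poly (Suc k))
      + smult (2 * real (Suc k)) ([:0, 2:] * hermite_poly k - pderiv (hermite_poly k))"
    by (simp only: Suc.IH) (simp add: pderiv_smult smult_diff_right)
  also have "\<dots> = smult (2 * real (Suc (Suc k))) (hermite_poly (Suc k))"
    by (simp only: hermite_poly.simps(2)[symmetric] smult_add_left[symmetric]) simp
  finally show ?case .
qed

definition hermite_const :: "nat \<Rightarrow> real" where
  "hermite_const k = (sqrt pi * 2 ^ k * fact k) powr (- 1 / 2)"

text \<open>The matrix entries of the ladder operators: (x - d/dx) phi_k =
  \<open>ladder (Suc k)\<close> phi_(k+1) and (x + d/dx) phi_k = \<open>ladder k\<close> phi_(k-1).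
  Since \<open>ladder 0 = 0\<close>, the truncated index \<open>k - 1\<close> is harmless at k =
  0.\<close>

definition ladder :: "nat \<Rightarrow> real" where
  "ladder k = sqrt (2 * real k)"

lemma ladder_0[simp]: "ladder 0 = 0"
  and ladder_pos: "ladder (Suc k) > 0"
  and ladder_square: "ladder k * ladder k = 2 * real k"
  by (simp_all add: ladder_def)

lemma hermite_const_pos: "hermite_const k > 0"
  by (simp add: hermite_const_def)

lemma hermite_const_eq: "hermite_const k = 1 / sqrt (sqrt pi * 2 ^ k * fact k)"
  by (simp add: hermite_const_def powr_minus_divide powr_half_sqrt)

lemma hermite_const_ladder: "hermite_const k = ladder (Suc k) * hermite_const (Suc k)"
proof -
  have "sqrt (sqrt pi * 2 ^ Suc k * fact (Suc k)) = ladder (Suc k) * sqrt (sqrt pi * 2 ^ k * fact k)"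
    by (simp add: ladder_def real_sqrt_mult[symmetric] algebra_simps)
  moreover have "ladder (Suc k) \<noteq> 0" using ladder_pos[of k] by simp
  ultimately show ?thesis by (simp only: hermite_const_eq) simp
qed

lemma hermite_fun_poly: "hermite_fun k x = hermite_const k * poly (hermite_poly k) x * exp (- x\<^sup>2 / 2)"
proof -
  have "exp (x\<^sup>2 / 2) * exp (- x\<^sup>2) = exp (- x\<^sup>2 / 2)" by (simp add: exp_add[symmetric])
  moreover have "(- 1) ^ k * (- 1) ^ k = (1::real)" by (simp add: power_mult_distrib[symmetric])
  ultimately have "(- 1) ^ k * (- 1) ^ k * (exp (x\<^sup>2 / 2) * exp (- x\<^sup>2)) = exp (- x\<^sup>2 / 2)" by simp
  then show ?thesis
    unfolding hermite_fun_def iterated_deriv_gaussian hermite_const_def[symmetric]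
    by (metis (no_types, lifting) mult.assoc mult.left_commute)
qed

lemma hermite_fun_0: "hermite_fun 0 x = hermite_const 0 * exp (- x\<^sup>2 / 2)"
  by (simp add: hermite_fun_poly)

lemma hermite_fun_0_pos: "hermite_fun 0 x > 0"
  by (simp add: hermite_fun_0 hermite_const_pos)

text \<open>The recursion of \<open>hermite_poly\<close>, with the quotient of consecutive
  normalizing constants giving the factor \<open>ladder (Suc k)\<close>.\<close>

lemma DERIV_hermite_fun_raise:
  "(hermite_fun k has_real_derivative x * hermite_fun k x - ladder (Suc k) * hermite_fun (Suc k) x) (at x)"
proof -
  have "((\<lambda>x. hermite_const k * poly (hermite_poly k) x * exp (- x\<^sup>2 / 2)) has_real_derivative
    x * (hermite_const k * poly (hermite_poly k) x * exp (- x\<^sup>2 / 2))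
      - hermite_const k * poly (hermite_poly (Suc k)) x * exp (- x\<^sup>2 / 2)) (at x)"
    by (auto intro!: derivative_eq_intros poly_DERIV simp: algebra_simps)
  moreover have "hermite_const k * poly (hermite_poly (Suc k)) x * exp (- x\<^sup>2 / 2)
      = ladder (Suc k) * hermite_fun (Suc k) x"
    unfolding hermite_const_ladder[of k] hermite_fun_poly by (simp only: mult.assoc)
  moreover have "(\<lambda>x. hermite_const k * poly (hermite_poly k) x * exp (- x\<^sup>2 / 2)) = hermite_fun k"
    by (simp add: hermite_fun_poly fun_eq_iff)
  ultimately show ?thesis by (simp only: hermite_fun_poly[of k x])
qed

text \<open>The recursion combined with H_k' = 2k H_(k-1). It links the raising and the lowering
  form of the derivative and later turns multiplication by x into a finite combination of Hermite
  functions.\<close>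

lemma hermite_fun_recurrence:
  "2 * x * hermite_fun k x = ladder (Suc k) * hermite_fun (Suc k) x + ladder k * hermite_fun (k - 1) x"
proof (cases k)
  case 0
  have "ladder (Suc 0) * hermite_fun (Suc 0) x
      = (ladder (Suc 0) * hermite_const (Suc 0)) * (2 * x * exp (- x\<^sup>2 / 2))"
    by (simp add: hermite_fun_poly pderiv_1)
  also have "\<dots> = 2 * x * hermite_fun 0 x"
    unfolding hermite_const_ladder[symmetric] by (simp add: hermite_fun_poly)
  finally show ?thesis using 0 by simp
next
  case (Suc j)
  define E where "E = exp (- x\<^sup>2 / 2)"
  have "ladder (Suc k) * hermite_fun (Suc k) x
      = (ladder (Suc k) * hermite_const (Suc k)) * (2 * x * poly (hermite_poly k) x - poly (pderiv (hermite_poly k)) x) * E"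
    by (simp add: hermite_fun_poly E_def)
  also have "poly (pderiv (hermite_poly k)) x = ladder k * ladder k * poly (hermite_poly j) x"
    unfolding Suc pderiv_hermite_poly ladder_square by simp
  also have "ladder (Suc k) * hermite_const (Suc k) = hermite_const k"
    by (simp add: hermite_const_ladder[of k])
  also have "hermite_const k * (2 * x * poly (hermite_poly k) x - ladder k * ladder k * poly (hermite_poly j) x) * E
    = 2 * x * hermite_fun k x - ladder k * (ladder k * hermite_const k) * poly (hermite_poly j) x * E"
    by (simp add: hermite_fun_poly E_def algebra_simps)
  also have "ladder k * hermite_const k = hermite_const j"
    using hermite_const_ladder[of j] Suc by simp
  also have "ladder k * hermite_const j * poly (hermite_poly j) x * E = ladder k * hermite_fun j x"
    by (simp add: hermite_fun_poly E_def)
  finally show ?thesis using Suc by simp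
qed

lemma DERIV_hermite_fun_lower:
  "(hermite_fun k has_real_derivative ladder k * hermite_fun (k - 1) x - x * hermite_fun k x) (at x)"
proof -
  have "x * hermite_fun k x - ladder (Suc k) * hermite_fun (Suc k) x
      = ladder k * hermite_fun (k - 1) x - x * hermite_fun k x"
    using hermite_fun_recurrence[of x k] by simp
  then show ?thesis using DERIV_hermite_fun_raise[of k x] by (simp only:)
qed

lemma isCont_hermite_fun: "isCont (hermite_fun k) x"
  using DERIV_hermite_fun_raise by (rule DERIV_isCont)

lemma continuous_on_hermite_fun[continuous_intros]: "continuous_on A (hermite_fun k)"
  by (simp add: continuous_at_imp_continuous_on isCont_hermite_fun)

lemma hermite_fun_measurable[measurable]: "hermite_fun k \<in> borel_measurable borel"
  by (intro borel_measurable_continuous_onI continuous_on_hermite_fun)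

subsection \<open>Decay\<close>

text \<open>One term of the exponential series gives |x|^m <= m! exp |x|, and (|x|/2 - 1)^2 >= 0
  gives -x^2/4 <= 1 - |x|; this is the origin of the factor \<open>exp 1\<close>.\<close>

lemma power_gaussian_le: "\<bar>x\<bar> ^ m * exp (- x\<^sup>2 / 4) \<le> exp 1 * (fact m :: real)"
proof -
  have "\<bar>x\<bar> ^ m / fact m \<le> exp \<bar>x\<bar>"
  proof -
    have "(\<lambda>n. \<bar>x\<bar> ^ n /\<^sub>R fact n) sums exp \<bar>x\<bar>" by (rule exp_converges)
    then have "(\<Sum>n\<in>{m}. \<bar>x\<bar> ^ n /\<^sub>R fact n) \<le> exp \<bar>x\<bar>"
      unfolding sums_iff by (metis (no_types, lifting) sum_le_suminf finite.emptyI finite.insertI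
          abs_ge_zero fact_ge_zero positive_imp_inverse_positive scaleR_nonneg_nonneg zero_le_power
          inverse_nonnegative_iff_nonnegative)
    then show ?thesis by (simp add: divide_inverse mult.commute)
  qed
  moreover have "exp (- x\<^sup>2 / 4) \<le> exp (1 - \<bar>x\<bar>)"
    using zero_le_power2[of "\<bar>x\<bar> / 2 - 1"] by (simp add: power2_eq_square field_simps)
  ultimately have "(\<bar>x\<bar> ^ m / fact m) * exp (- x\<^sup>2 / 4) \<le> exp \<bar>x\<bar> * exp (1 - \<bar>x\<bar>)"
    by (intro mult_mono) auto
  also have "\<dots> = exp 1" by (simp add: exp_add[symmetric])
  finally show ?thesis by (simp add: field_simps)
qed

text \<open>The free power \<open>m\<close> makes the induction over the coefficients close, each
  step consuming one factor |x|; it is also the power in the Schwartz seminorms.\<close>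

lemma poly_gaussian_le:
  fixes p :: "real poly"
  shows "\<exists>C. \<forall>x. \<bar>x\<bar> ^ m * \<bar>poly p x\<bar> * exp (- x\<^sup>2 / 4) \<le> C"
proof (induction p arbitrary: m)
  case (pCons a p)
  obtain C where C: "\<And>x. \<bar>x\<bar> ^ Suc m * \<bar>poly p x\<bar> * exp (- x\<^sup>2 / 4) \<le> C"
    using pCons.IH by blast
  show ?case
  proof (intro exI allI)
    fix x :: real
    have "\<bar>x\<bar> ^ m * \<bar>poly (pCons a p) x\<bar> * exp (- x\<^sup>2 / 4)
        \<le> \<bar>x\<bar> ^ m * (\<bar>a\<bar> + \<bar>x\<bar> * \<bar>poly p x\<bar>) * exp (- x\<^sup>2 / 4)"
      by (intro mult_mono) (auto simp: abs_mult[symmetric] intro: abs_triangle_ineq)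
    also have "\<dots> = \<bar>a\<bar> * (\<bar>x\<bar> ^ m * exp (- x\<^sup>2 / 4)) + \<bar>x\<bar> ^ Suc m * \<bar>poly p x\<bar> * exp (- x\<^sup>2 / 4)"
      by (simp add: algebra_simps)
    also have "\<dots> \<le> \<bar>a\<bar> * (exp 1 * fact m) + C"
      by (intro add_mono mult_left_mono power_gaussian_le C) auto
    finally show "\<bar>x\<bar> ^ m * \<bar>poly (pCons a p) x\<bar> * exp (- x\<^sup>2 / 4) \<le> \<bar>a\<bar> * (exp 1 * fact m) + C" .
  qed
qed (auto intro: exI[of _ 0])

text \<open>Half of the Gaussian exponent absorbs the polynomial and the other half remains as
  decay.\<close>

lemma poly_gaussian_bound:
  fixes p :: "real poly"
  obtains C where "C \<ge> 0" "\<And>x. \<bar>poly p x * exp (- x\<^sup>2 / 2)\<bar> \<le> C * exp (- x\<^sup>2 / 4)"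
proof -
  obtain C where C: "\<And>x. \<bar>x\<bar> ^ 0 * \<bar>poly p x\<bar> * exp (- x\<^sup>2 / 4) \<le> C"
    using poly_gaussian_le by blast
  have "\<bar>poly p x * exp (- x\<^sup>2 / 2)\<bar> \<le> C * exp (- x\<^sup>2 / 4)" for x
  proof -
    have "exp (- x\<^sup>2 / 2) = exp (- x\<^sup>2 / 4) * exp (- x\<^sup>2 / 4)" by (simp add: exp_add[symmetric])
    then have "\<bar>poly p x * exp (- x\<^sup>2 / 2)\<bar> = (\<bar>poly p x\<bar> * exp (- x\<^sup>2 / 4)) * exp (- x\<^sup>2 / 4)"
      by (simp add: abs_mult)
    also have "\<dots> \<le> C * exp (- x\<^sup>2 / 4)" using C[of x] by (intro mult_right_mono) auto
    finally show ?thesis .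
  qed
  moreover have "C \<ge> 0" using C[of 0] abs_ge_zero[of "poly p 0"] by simp
  ultimately show thesis using that by blast
qed

lemma integrable_gaussian:
  assumes "c > 0" shows "integrable lborel (\<lambda>x::real. exp (- c * x\<^sup>2))"
proof -
  \<comment> \<open>Standard deviation of the normal density proportional to exp(-c x^2), whose
    moment of order 0 is integrable.\<close>
  define s where "s = 1 / sqrt (2 * c)"
  have s: "s > 0" and s2: "s\<^sup>2 = 1 / (2 * c)" using assms by (auto simp: s_def power_divide)
  have "integrable lborel (\<lambda>x. sqrt (2 * pi * s\<^sup>2) * normal_density 0 s x)"
    using integrable_normal_moment[OF s, of 0 0] by simp
  also have "(\<lambda>x. sqrt (2 * pi * s\<^sup>2) * normal_density 0 s x) = (\<lambda>x. exp (- c * x\<^sup>2))"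
    using s s2 assms by (auto simp: normal_density_def fun_eq_iff)
  finally show ?thesis .
qed

lemma tendsto_gaussian_0:
  "((\<lambda>x::real. C * exp (- x\<^sup>2 / 4)) \<longlongrightarrow> 0) at_top" "((\<lambda>x::real. C * exp (- x\<^sup>2 / 4)) \<longlongrightarrow> 0) at_bot"
  by real_asymp+

lemma poly_gaussian_tendsto:
  fixes p :: "real poly"
  shows "((\<lambda>x. poly p x * exp (- x\<^sup>2 / 2)) \<longlongrightarrow> 0) at_top"
    and "((\<lambda>x. poly p x * exp (- x\<^sup>2 / 2)) \<longlongrightarrow> 0) at_bot"
proof -
  obtain C where C: "\<And>x. \<bar>poly p x * exp (- x\<^sup>2 / 2)\<bar> \<le> C * exp (- x\<^sup>2 / 4)"
    using poly_gaussian_bound by blast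
  show "((\<lambda>x. poly p x * exp (- x\<^sup>2 / 2)) \<longlongrightarrow> 0) at_top"
    by (rule Lim_null_comparison[OF always_eventually tendsto_gaussian_0(1)[of C]]) (use C in simp)
  show "((\<lambda>x. poly p x * exp (- x\<^sup>2 / 2)) \<longlongrightarrow> 0) at_bot"
    by (rule Lim_null_comparison[OF always_eventually tendsto_gaussian_0(2)[of C]]) (use C in simp)
qed

lemma hermite_fun_eq_poly:
  "hermite_fun k = (\<lambda>x. poly (smult (hermite_const k) (hermite_poly k)) x * exp (- x\<^sup>2 / 2))"
  by (simp add: fun_eq_iff hermite_fun_poly)

lemma hermite_fun_bound:
  obtains C where "C \<ge> 0" "\<And>x. \<bar>hermite_fun k x\<bar> \<le> C * exp (- x\<^sup>2 / 4)"
  unfolding hermite_fun_eq_poly[of k] using poly_gaussian_bound by blast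

lemma hermite_fun_tendsto: "(hermite_fun k \<longlongrightarrow> 0) at_top" "(hermite_fun k \<longlongrightarrow> 0) at_bot"
  unfolding hermite_fun_eq_poly[of k] using poly_gaussian_tendsto by blast+

lemma phi_measurable[measurable]: "phi k \<in> borel_measurable borel"
  unfolding phi_def by measurable

lemma phi_L2: "phi k \<in> L2"
proof -
  obtain C where C: "C \<ge> 0" "\<And>x. \<bar>hermite_fun k x\<bar> \<le> C * exp (- x\<^sup>2 / 4)"
    using hermite_fun_bound by blast
  have "integrable lborel (\<lambda>x. (cmod (phi k x))\<^sup>2)"
  proof (rule Bochner_Integration.integrable_bound)
    show "integrable lborel (\<lambda>x. C\<^sup>2 * exp (- (1/2) * x\<^sup>2))"
      using integrable_gaussian[of "1/2"] by simp
    have "(cmod (phi k x))\<^sup>2 \<le> C\<^sup>2 * exp (- (1/2) * x\<^sup>2)" for x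
    proof -
      have "(hermite_fun k x)\<^sup>2 \<le> (C * exp (- x\<^sup>2 / 4))\<^sup>2"
        using power_mono[OF C(2)[of x] abs_ge_zero, of 2] by simp
      also have "\<dots> = C\<^sup>2 * exp (- (1/2) * x\<^sup>2)"
        by (simp add: power_mult_distrib exp_double[symmetric])
      finally show ?thesis by (simp add: phi_def)
    qed
    then show "AE x in lborel. norm ((cmod (phi k x))\<^sup>2) \<le> norm (C\<^sup>2 * exp (- (1/2) * x\<^sup>2))"
      by (auto intro!: always_eventually)
  qed simp
  then show ?thesis by (simp add: L2_def)
qed

section \<open>Integrals of products of Hermite functions\<close>

lemma hermite_fun_mult_integrable: "integrable lborel (\<lambda>x. hermite_fun j x * hermite_fun k x)"
proof -
  have "integrable lborel (\<lambda>x. phi j x * phi k x)" using phi_L2 phi_L2 by (rule L2_mult_integrable)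
  then have "integrable lborel (\<lambda>x. complex_of_real (hermite_fun j x * hermite_fun k x))"
    by (simp add: phi_def)
  then show ?thesis by (simp only: complex_of_real_integrable_eq)
qed

text \<open>The first factor is differentiated in raising form and the second in lowering form, so
  that the two terms with the factor x cancel.\<close>

lemma hermite_fun_mult_has_derivative:
  "((\<lambda>x. hermite_fun j x * hermite_fun k x) has_vector_derivative
     ladder k * (hermite_fun j x * hermite_fun (k - 1) x) - ladder (Suc j) * (hermite_fun (Suc j) x * hermite_fun k x)) (at x)"
  unfolding has_real_derivative_iff_has_vector_derivative[symmetric]
  by (rule derivative_eq_intros DERIV_hermite_fun_raise DERIV_hermite_fun_lower)+ (simp add: algebra_simps)

lemma hermite_fun_mult_derivative_integrable:
  "integrable lborel (\<lambda>x. ladder k * (hermite_fun j x * hermite_fun (k - 1) x) - ladder (Suc j) * (hermite_fun (Suc j) x * hermite_fun k x))"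
  by (intro Bochner_Integration.integrable_diff integrable_mult_right hermite_fun_mult_integrable)

lemma hermite_fun_mult_tendsto:
  "((\<lambda>x. hermite_fun j x * hermite_fun k x) \<longlongrightarrow> 0) at_top" "((\<lambda>x. hermite_fun j x * hermite_fun k x) \<longlongrightarrow> 0) at_bot"
  using tendsto_mult[OF hermite_fun_tendsto(1) hermite_fun_tendsto(1)]
    tendsto_mult[OF hermite_fun_tendsto(2) hermite_fun_tendsto(2)] by simp_all

text \<open>The raising and lowering operators are adjoint to each other: the product is a primitive
  that vanishes at both ends.\<close>

lemma hermite_fun_inner_ladder:
  "ladder (Suc j) * (LINT x|lborel. hermite_fun (Suc j) x * hermite_fun k x)
    = ladder k * (LINT x|lborel. hermite_fun j x * hermite_fun (k - 1) x)"
proof -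
  have "(LINT x|lborel. ladder k * (hermite_fun j x * hermite_fun (k - 1) x) - ladder (Suc j) * (hermite_fun (Suc j) x * hermite_fun k x)) = 0 - 0"
    by (rule LBINT_derivative[OF hermite_fun_mult_has_derivative _ hermite_fun_mult_derivative_integrable
          hermite_fun_mult_tendsto(2) hermite_fun_mult_tendsto(1)])
       (intro continuous_intros isCont_hermite_fun)
  then show ?thesis by (simp add: Bochner_Integration.integral_diff hermite_fun_mult_integrable)
qed

text \<open>With the ground state as second factor the lowering term has the factor
  \<open>ladder 0 = 0\<close>; only the raised product and the boundary term at \<open>a\<close>
  remain.\<close>

lemma hermite_fun_half_line:
  "ladder (Suc j) * (LINT x|lborel. indicator {a..} x * (hermite_fun (Suc j) x * hermite_fun 0 x))
    = hermite_fun j a * hermite_fun 0 a"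
proof -
  have "(LINT x|lborel. indicator {a..} x *\<^sub>R (ladder 0 * (hermite_fun j x * hermite_fun (0 - 1) x)
      - ladder (Suc j) * (hermite_fun (Suc j) x * hermite_fun 0 x))) = 0 - hermite_fun j a * hermite_fun 0 a"
    by (rule LBINT_derivative_atLeast[OF hermite_fun_mult_has_derivative _ hermite_fun_mult_derivative_integrable
          hermite_fun_mult_tendsto(1)])
       (intro continuous_intros isCont_hermite_fun)
  also have "(\<lambda>x. indicator {a..} x *\<^sub>R (ladder 0 * (hermite_fun j x * hermite_fun (0 - 1) x)
      - ladder (Suc j) * (hermite_fun (Suc j) x * hermite_fun 0 x)))
      = (\<lambda>x. (- ladder (Suc j)) * (indicator {a..} x * (hermite_fun (Suc j) x * hermite_fun 0 x)))"
    by (simp add: fun_eq_iff)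
  finally show ?thesis by (subst (asm) integral_mult_right_zero) simp
qed

lemma hermite_fun_0_norm: "(LINT x|lborel. hermite_fun 0 x * hermite_fun 0 x) = 1"
proof -
  have "has_bochner_integral lborel (\<lambda>x::real. exp (- x\<^sup>2)) (2 *\<^sub>R (sqrt pi / 2))"
    by (rule has_bochner_integral_even_function[OF gaussian_moment_0]) simp
  then have "(LINT x|lborel. exp (- x\<^sup>2)) = sqrt pi"
    by (simp add: has_bochner_integral_iff)
  moreover have "hermite_fun 0 x * hermite_fun 0 x = (1 / sqrt pi) * exp (- x\<^sup>2)" for x
  proof -
    have "hermite_fun 0 x * hermite_fun 0 x = (hermite_const 0 * hermite_const 0) * exp (- x\<^sup>2)"
      by (simp add: hermite_fun_0 exp_add[symmetric])
    then show ?thesis by (simp add: hermite_const_eq)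
  qed
  ultimately show ?thesis by simp
qed

text \<open>The ladder identity lowers both indices at once, so induction over \<open>j\<close> with
  \<open>k\<close> arbitrary reaches index 0, where the lowering term vanishes or the Gaussian
  integral remains.\<close>

lemma hermite_fun_orthonormal:
  "(LINT x|lborel. hermite_fun j x * hermite_fun k x) = (if j = k then 1 else 0)"
proof (induction j arbitrary: k)
  case 0
  show ?case
  proof (cases k)
    case (Suc i)
    have "ladder (Suc i) * (LINT x|lborel. hermite_fun (Suc i) x * hermite_fun 0 x) = 0"
      using hermite_fun_inner_ladder[of i 0] by simp
    then have "(LINT x|lborel. hermite_fun (Suc i) x * hermite_fun 0 x) = 0"
      using ladder_pos[of i] by simp
    then show ?thesis using Suc by (simp add: mult.commute)
  qed (simp add: hermite_fun_0_norm)
next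
  case (Suc j)
  have "ladder (Suc j) * (LINT x|lborel. hermite_fun (Suc j) x * hermite_fun k x)
      = ladder (Suc j) * (if Suc j = k then 1 else 0)"
    using hermite_fun_inner_ladder[of j k] Suc.IH[of "k - 1"] by (cases k) auto
  then show ?case using ladder_pos[of j] by (subst (asm) mult_cancel_left) auto
qed

lemma orthonormal_phi: "orthonormal phi"
proof -
  have "L2_inner (phi j) (phi k) = complex_of_real (LINT x|lborel. hermite_fun j x * hermite_fun k x)" for j k
    unfolding L2_inner_def phi_def
    by (subst integral_complex_of_real[symmetric]) simp
  then show ?thesis by (simp add: orthonormal_def phi_L2 hermite_fun_orthonormal)
qed

subsection \<open>Hermite functions as Schwartz functions\<close>

lemma dx_poly_gaussian:
  fixes p :: "real poly"
  defines "q \<equiv> pderiv p - [:0, 1:] * p"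
  shows "((\<lambda>x. complex_of_real (poly p x * exp (- x\<^sup>2 / 2))) has_vector_derivative
      complex_of_real (poly q x * exp (- x\<^sup>2 / 2))) (at x)"
proof -
  have "((\<lambda>x. poly p x * exp (- x\<^sup>2 / 2)) has_real_derivative poly q x * exp (- x\<^sup>2 / 2)) (at x)"
    unfolding q_def by (auto intro!: derivative_eq_intros poly_DERIV simp: algebra_simps)
  then show ?thesis by (rule has_vector_derivative_of_real[unfolded has_real_derivative_iff_has_vector_derivative[symmetric]])
qed

text \<open>Polynomial times Gaussian is a class closed under \<open>dx\<close>, with p replaced by
  p' - x p, so one decay estimate serves all derivatives.\<close>

lemma poly_gaussian_schwartz:
  fixes p :: "real poly"
  shows "(\<lambda>x. complex_of_real (poly p x * exp (- x\<^sup>2 / 2))) \<in> schwartz"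
proof -
  let ?G = "\<lambda>p x. complex_of_real (poly p x * exp (- x\<^sup>2 / 2))"
  have iter: "\<exists>q. (dx ^^ n) (?G p)
      = (?G q)" for n
  proof (induction n)
    case (Suc n)
    then obtain q where q: "(dx ^^ n) (?G p)
      = (?G q)" by blast
    show ?case
      unfolding funpow.simps comp_def q
      by (subst dx_def) (auto simp only: vector_derivative_at[OF dx_poly_gaussian])
  qed auto
  show ?thesis unfolding schwartz_def
  proof (intro CollectI allI conjI)
    fix n
    obtain q where q: "(dx ^^ n) (?G p)
      = (?G q)" using iter by blast
    show "(dx ^^ n) (?G p) differentiable (at x)" for x
      unfolding q using dx_poly_gaussian has_vector_derivative_def differentiable_def by blast
    fix m
    obtain C where C: "\<And>x. \<bar>x\<bar> ^ m * \<bar>poly q x\<bar> * exp (- x\<^sup>2 / 4) \<le> C"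
      using poly_gaussian_le by blast
    have "\<bar>x\<bar> ^ m * cmod (complex_of_real (poly q x * exp (- x\<^sup>2 / 2))) \<le> C" for x
    proof -
      have "\<bar>x\<bar> ^ m * cmod (complex_of_real (poly q x * exp (- x\<^sup>2 / 2)))
          = \<bar>x\<bar> ^ m * \<bar>poly q x\<bar> * exp (- x\<^sup>2 / 2)" by (simp add: norm_mult)
      also have "\<dots> \<le> \<bar>x\<bar> ^ m * \<bar>poly q x\<bar> * exp (- x\<^sup>2 / 4)" by (intro mult_left_mono) auto
      also have "\<dots> \<le> C" by (rule C)
      finally show ?thesis .
    qed
    then show "\<exists>C. \<forall>x. \<bar>x\<bar> ^ m * cmod ((dx ^^ n) (?G p) x) \<le> C"
      unfolding q by blast
  qed
qed

lemma phi_schwartz: "phi k \<in> schwartz"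
  unfolding phi_def hermite_fun_eq_poly by (rule poly_gaussian_schwartz)

lemma dx_phi: "(phi k has_vector_derivative
    complex_of_real (x * hermite_fun k x - ladder (Suc k) * hermite_fun (Suc k) x)) (at x)"
  unfolding phi_def using DERIV_hermite_fun_raise
  by (rule has_vector_derivative_of_real[unfolded has_real_derivative_iff_has_vector_derivative[symmetric]])

text \<open>The eigenvalue equation, by raising once and lowering once:
  \<open>ladder (Suc k)\<close> squared is 2k + 2, and the derivative of the factor x takes off
  1.\<close>

lemma dx_dx_phi: "(dx (phi k) has_vector_derivative complex_of_real (x\<^sup>2 - eigval k) * phi k x) (at x)"
proof -
  have "dx (phi k) = (\<lambda>x. complex_of_real (x * hermite_fun k x - ladder (Suc k) * hermite_fun (Suc k) x))"
    unfolding dx_def by (rule ext) (rule vector_derivative_at[OF dx_phi])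
  moreover have "((\<lambda>x. x * hermite_fun k x - ladder (Suc k) * hermite_fun (Suc k) x) has_real_derivative
      (x\<^sup>2 - eigval k) * hermite_fun k x) (at x)"
  proof -
    have "hermite_fun k x + x * (x * hermite_fun k x - ladder (Suc k) * hermite_fun (Suc k) x)
        - ladder (Suc k) * (ladder (Suc k) * hermite_fun k x - x * hermite_fun (Suc k) x)
      = hermite_fun k x + x\<^sup>2 * hermite_fun k x - (ladder (Suc k) * ladder (Suc k)) * hermite_fun k x"
      by (simp add: algebra_simps power2_eq_square)
    also have "\<dots> = (x\<^sup>2 - eigval k) * hermite_fun k x"
      unfolding ladder_square eigval_def by (simp add: algebra_simps)
    finally show ?thesis
      using DERIV_hermite_fun_lower[of "Suc k" x]
      by (auto intro!: derivative_eq_intros DERIV_hermite_fun_raise[of k x] simp: algebra_simps)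
  qed
  ultimately show ?thesis
    using has_vector_derivative_of_real[unfolded has_real_derivative_iff_has_vector_derivative[symmetric]]
    by (simp add: phi_def) fastforce
qed

section \<open>Completeness of the Hermite functions\<close>

text \<open>Up to the mass \<open>m\<close>, the Fourier transform of a nonnegative integrable
  function is a characteristic function, which brings it within reach of Levy's uniqueness
  theorem.\<close>

lemma char_normalized_density:
  assumes p: "integrable lborel p" and nn: "\<And>x. 0 \<le> p x" and m: "m > 0"
    and mass: "(LINT x|lborel. p x) = m"
  shows "real_distribution (density lborel (\<lambda>x. ennreal (p x / m)))"
    and "char (density lborel (\<lambda>x. ennreal (p x / m))) t = (LINT x|lborel. p x *\<^sub>R iexp (t * x)) / of_real m"
proof -
  let ?M = "density lborel (\<lambda>x. ennreal (p x / m))"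
  have meas[measurable]: "p \<in> borel_measurable borel" using p by auto
  interpret prob_space ?M
  proof
    have "emeasure ?M (space ?M)
        = (\<integral>\<^sup>+x. ennreal (p x / m) \<partial>lborel)"
      by (subst emeasure_density) auto
    also have "\<dots> = ennreal (LINT x|lborel. p x / m)"
      using p nn m by (intro nn_integral_eq_integral) auto
    finally show "emeasure ?M (space ?M) = 1"
      using m mass by simp
  qed
  show "real_distribution ?M"
    by unfold_locales (simp_all add: sets_density)
  have "char ?M t = (LINT x|lborel. (p x / m) *\<^sub>R iexp (t * x))"
    unfolding char_def using nn m by (subst integral_density) auto
  also have "\<dots> = (LINT x|lborel. (p x *\<^sub>R iexp (t * x)) / of_real m)"
    by (simp add: scaleR_conv_of_real)
  finally show "char ?M t = (LINT x|lborel. p x *\<^sub>R iexp (t * x)) / of_real m"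
    by simp
qed

lemma integrable_iexp:
  fixes g :: "real \<Rightarrow> real"
  assumes "integrable lborel g"
  shows "integrable lborel (\<lambda>x. g x *\<^sub>R iexp (t * x))"
proof (rule Bochner_Integration.integrable_bound[OF assms])
  show "(\<lambda>x. g x *\<^sub>R iexp (t * x)) \<in> borel_measurable lborel"
    using assms by measurable
qed simp

text \<open>The positive and negative parts of \<open>g\<close> have equal Fourier transforms, hence, after
  normalization, they are densities of the same probability distribution.\<close>

theorem Fourier_transform_zero_AE:
  fixes g :: "real \<Rightarrow> real"
  assumes g: "integrable lborel g" and zero: "\<And>t. (LINT x|lborel. g x *\<^sub>R iexp (t * x)) = 0"
  shows "AE x in lborel. g x = 0"
proof -
  define p where "p x = max 0 (g x)" for x
  define q where "q x = max 0 (- g x)" for x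
  have p: "integrable lborel p" and q: "integrable lborel q"
    unfolding p_def q_def using g by auto
  have [measurable]: "p \<in> borel_measurable borel" "q \<in> borel_measurable borel" using p q by auto
  have nn: "0 \<le> p x" "0 \<le> q x" for x by (simp_all add: p_def q_def)
  have gpq: "g x = p x - q x" for x by (simp add: p_def q_def)
  have same: "(LINT x|lborel. p x *\<^sub>R iexp (t * x)) = (LINT x|lborel. q x *\<^sub>R iexp (t * x))" for t
    using zero[of t] integrable_iexp[OF p, of t] integrable_iexp[OF q, of t]
    by (simp only: gpq scaleR_diff_left) (simp add: Bochner_Integration.integral_diff)
  \<comment> \<open>At frequency 0 the transforms are the masses, so both parts are normalized by
    the same constant.\<close>
  have "complex_of_real (LINT x|lborel. p x) = complex_of_real (LINT x|lborel. q x)"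
    using same[of 0] by (simp add: scaleR_conv_of_real)
  then have mass: "(LINT x|lborel. p x) = (LINT x|lborel. q x)" by (simp only: of_real_eq_iff)
  have m_nn: "0 \<le> (LINT x|lborel. p x)" using nn by (intro Bochner_Integration.integral_nonneg) auto
  \<comment> \<open>Normalization divides by the mass, so mass 0 is a case of its own: there both
    parts vanish almost everywhere.\<close>
  show ?thesis
  proof (cases "(LINT x|lborel. p x) = 0")
    case True
    then have "AE x in lborel. p x = 0" "AE x in lborel. q x = 0"
      using integral_nonneg_eq_0_iff_AE[OF p] integral_nonneg_eq_0_iff_AE[OF q] mass nn by simp_all
    then show ?thesis by eventually_elim (simp add: gpq)
  next
    case False
    define m where "m = (LINT x|lborel. p x)"
    have m: "m > 0" using False m_nn by (simp add: m_def)
    have mq: "(LINT x|lborel. q x) = m" using mass by (simp add: m_def)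
    have "density lborel (\<lambda>x. ennreal (p x / m)) = density lborel (\<lambda>x. ennreal (q x / m))"
      using char_normalized_density[OF p nn(1) m m_def[symmetric]]
        char_normalized_density[OF q nn(2) m mq] same
      by (intro Levy_uniqueness) auto
    then have "AE x in lborel. ennreal (p x / m) = ennreal (q x / m)"
      by (subst (asm) sigma_finite_measure.density_unique_iff[OF sigma_finite_lborel]) auto
    then show ?thesis
      by eventually_elim (use nn m gpq in auto)
  qed
qed

text \<open>Provides the majorant for the partial sums of exp(i t x). The constant comes from (2|t|
  - |x|)^2 >= 0, that is, 2|tx| - x^2 <= 2t^2 - x^2/2.\<close>

lemma exp_abs_hermite_fun_L2: "(\<lambda>x. complex_of_real (exp \<bar>t * x\<bar> * hermite_fun 0 x)) \<in> L2"
proof -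
  define C where "C = (hermite_const 0)\<^sup>2 * exp (2 * t\<^sup>2)"
  have "integrable lborel (\<lambda>x. (cmod (complex_of_real (exp \<bar>t * x\<bar> * hermite_fun 0 x)))\<^sup>2)"
  proof (rule Bochner_Integration.integrable_bound)
    show "integrable lborel (\<lambda>x. C * exp (- (1/2) * x\<^sup>2))"
      using integrable_gaussian[of "1/2"] by simp
    have "(cmod (complex_of_real (exp \<bar>t * x\<bar> * hermite_fun 0 x)))\<^sup>2 \<le> C * exp (- (1/2) * x\<^sup>2)" for x
    proof -
      have "(cmod (complex_of_real (exp \<bar>t * x\<bar> * hermite_fun 0 x)))\<^sup>2
          = (hermite_const 0)\<^sup>2 * ((exp \<bar>t * x\<bar>)\<^sup>2 * (exp (- x\<^sup>2 / 2))\<^sup>2)"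
        by (simp add: norm_mult power_mult_distrib hermite_fun_0)
      also have "(exp \<bar>t * x\<bar>)\<^sup>2 * (exp (- x\<^sup>2 / 2))\<^sup>2 = exp (2 * \<bar>t * x\<bar> - x\<^sup>2)"
        by (simp add: exp_double[symmetric] exp_add[symmetric])
      also have "\<dots> \<le> exp (2 * t\<^sup>2 + - (1/2) * x\<^sup>2)"
        using zero_le_power2[of "2 * \<bar>t\<bar> - \<bar>x\<bar>"] by (simp add: power2_diff abs_mult power_mult_distrib)
      finally have "(cmod (complex_of_real (exp \<bar>t * x\<bar> * hermite_fun 0 x)))\<^sup>2
          \<le> (hermite_const 0)\<^sup>2 * exp (2 * t\<^sup>2 + - (1/2) * x\<^sup>2)" by (simp add: mult_left_mono)
      then show ?thesis by (simp only: C_def exp_add mult.assoc)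
    qed
    then show "AE x in lborel. norm ((cmod (complex_of_real (exp \<bar>t * x\<bar> * hermite_fun 0 x)))\<^sup>2)
        \<le> norm (C * exp (- (1/2) * x\<^sup>2))"
      by (auto intro!: always_eventually simp: C_def)
  qed measurable
  then show ?thesis by (simp add: L2_def)
qed

lemma power_hermite_fun_recurrence:
  "complex_of_real (x ^ Suc n * hermite_fun k x)
    = complex_of_real (ladder (Suc k) / 2) * complex_of_real (x ^ n * hermite_fun (Suc k) x)
      + complex_of_real (ladder k / 2) * complex_of_real (x ^ n * hermite_fun (k - 1) x)"
proof -
  have "x ^ Suc n * hermite_fun k x = x ^ n * (2 * x * hermite_fun k x) / 2" by simp
  also have "\<dots> = ladder (Suc k) / 2 * (x ^ n * hermite_fun (Suc k) x)
      + ladder k / 2 * (x ^ n * hermite_fun (k - 1) x)"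
    unfolding hermite_fun_recurrence by (simp add: algebra_simps add_divide_distrib)
  finally show ?thesis by (simp only: of_real_add of_real_mult)
qed

lemma power_hermite_fun_L2: "(\<lambda>x. complex_of_real (x ^ n * hermite_fun k x)) \<in> L2"
proof (induction n arbitrary: k)
  case 0
  then show ?case using phi_L2[of k] by (simp add: phi_def)
next
  case (Suc n)
  show ?case unfolding power_hermite_fun_recurrence by (intro L2_add L2_scale Suc.IH)
qed

text \<open>By the recurrence, x^n phi_k is a finite combination of Hermite functions; the induction
  moves one power of x at a time into the index, hence the arbitrary \<open>k\<close>.\<close>

lemma orthogonal_power_hermite_fun:
  assumes f: "f \<in> L2" and orth: "\<And>k. L2_inner f (phi k) = 0"
  shows "(LINT x|lborel. f x * complex_of_real (x ^ n * hermite_fun k x)) = 0"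
proof (induction n arbitrary: k)
  case 0
  then show ?case using orth[of k] by (simp add: L2_inner_def phi_def)
next
  case (Suc n)
  have "integrable lborel (\<lambda>x. f x * complex_of_real (x ^ n * hermite_fun k x))" for k
    using f power_hermite_fun_L2 by (rule L2_mult_integrable)
  then show ?case
    unfolding power_hermite_fun_recurrence distrib_left mult.left_commute[of "f _"]
    by (simp only: Bochner_Integration.integral_add integrable_mult_right integral_mult_right_zero Suc.IH) simp
qed

text \<open>Every partial sum of the exponential series is a polynomial in x and integrates to 0
  against f phi_0; dominated convergence carries this to the limit.\<close>

lemma orthogonal_iexp_hermite_fun:
  assumes f: "f \<in> L2" and orth: "\<And>k. L2_inner f (phi k) = 0"
  shows "(LINT x|lborel. f x * complex_of_real (hermite_fun 0 x) * iexp (t * x)) = 0"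
proof -
  define a where "a n x = (\<i> * complex_of_real t) ^ n / fact n * (f x * complex_of_real (x ^ n * hermite_fun 0 x))" for n x
  have a_eq: "a n x = f x * complex_of_real (hermite_fun 0 x) * ((\<i> * complex_of_real (t * x)) ^ n /\<^sub>R fact n)" for n x
    by (simp add: a_def power_mult_distrib scaleR_conv_of_real field_simps)
  have fm[measurable]: "f \<in> borel_measurable borel" using f by (rule L2_measurable_borel)
  have "(\<lambda>N. LINT x|lborel. (\<Sum>n<N. a n x)) \<longlonglongrightarrow> (LINT x|lborel. f x * complex_of_real (hermite_fun 0 x) * iexp (t * x))"
  proof (rule integral_dominated_convergence)
    show "integrable lborel (\<lambda>x. cmod (f x * complex_of_real (exp \<bar>t * x\<bar> * hermite_fun 0 x)))"
      by (intro integrable_norm L2_mult_integrable f exp_abs_hermite_fun_L2)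
    show "AE x in lborel. (\<lambda>N. \<Sum>n<N. a n x) \<longlonglongrightarrow> f x * complex_of_real (hermite_fun 0 x) * iexp (t * x)"
    proof (rule always_eventually, rule allI)
      fix x
      have "(\<lambda>n. (\<i> * complex_of_real (t * x)) ^ n /\<^sub>R fact n) sums iexp (t * x)"
        by (rule exp_converges)
      then have "(\<lambda>n. a n x) sums (f x * complex_of_real (hermite_fun 0 x) * iexp (t * x))"
        unfolding a_eq by (rule sums_mult)
      then show "(\<lambda>N. \<Sum>n<N. a n x) \<longlonglongrightarrow> f x * complex_of_real (hermite_fun 0 x) * iexp (t * x)"
        by (simp add: sums_def)
    qed
    fix N
    show "AE x in lborel. norm (\<Sum>n<N. a n x) \<le> cmod (f x * complex_of_real (exp \<bar>t * x\<bar> * hermite_fun 0 x))"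
    proof (rule always_eventually, rule allI)
      fix x
      have "(\<Sum>n<N. a n x) = f x * complex_of_real (hermite_fun 0 x) * (\<Sum>n<N. (\<i> * complex_of_real (t * x)) ^ n /\<^sub>R fact n)"
        by (simp add: a_eq sum_distrib_left)
      moreover have "cmod (\<Sum>n<N. (\<i> * complex_of_real (t * x)) ^ n /\<^sub>R fact n) \<le> exp \<bar>t * x\<bar>"
      proof -
        have "cmod (\<Sum>n<N. (\<i> * complex_of_real (t * x)) ^ n /\<^sub>R fact n) \<le> (\<Sum>n<N. \<bar>t * x\<bar> ^ n /\<^sub>R fact n)"
          by (rule order_trans[OF norm_sum]) (simp add: norm_power norm_mult power_abs abs_mult)
        also have "\<dots> \<le> exp \<bar>t * x\<bar>"
          using exp_converges[of "\<bar>t * x\<bar>"] by (intro sum_le_suminf[THEN order_trans]) (auto simp: sums_iff)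
        finally show ?thesis .
      qed
      ultimately show "norm (\<Sum>n<N. a n x) \<le> cmod (f x * complex_of_real (exp \<bar>t * x\<bar> * hermite_fun 0 x))"
        by (simp only: norm_mult norm_of_real of_real_mult mult.assoc)
          (simp add: mult_left_mono mult.commute)
    qed
  qed (auto simp: a_def)
  moreover have "(LINT x|lborel. (\<Sum>n<N. a n x)) = 0" for N
  proof -
    have "integrable lborel (a n)" for n
      unfolding a_def[abs_def] using L2_mult_integrable[OF f power_hermite_fun_L2] by simp
    then have "(LINT x|lborel. (\<Sum>n<N. a n x)) = (\<Sum>n<N. LINT x|lborel. a n x)"
      by (intro Bochner_Integration.integral_sum)
    also have "\<dots> = 0"
      unfolding a_def integral_mult_right_zero orthogonal_power_hermite_fun[OF f orth] by simp
    finally show ?thesis .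
  qed
  ultimately show ?thesis by (simp add: LIMSEQ_const_iff)
qed

text \<open>Restricted to real \<open>r\<close> because the Fourier argument splits into positive
  and negative parts. The factor phi_0 can be divided out since it is positive everywhere.\<close>

lemma orthogonal_real_AE_zero:
  fixes r :: "real \<Rightarrow> real"
  assumes r: "(\<lambda>x. complex_of_real (r x)) \<in> L2" and orth: "\<And>k. L2_inner (\<lambda>x. complex_of_real (r x)) (phi k) = 0"
  shows "AE x in lborel. r x = 0"
proof -
  have "integrable lborel (\<lambda>x. complex_of_real (r x) * phi 0 x)"
    using r phi_L2 by (rule L2_mult_integrable)
  then have "integrable lborel (\<lambda>x. complex_of_real (r x * hermite_fun 0 x))"
    by (simp add: phi_def)
  then have int: "integrable lborel (\<lambda>x. r x * hermite_fun 0 x)"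
    by (simp only: complex_of_real_integrable_eq)
  have "AE x in lborel. r x * hermite_fun 0 x = 0"
    using orthogonal_iexp_hermite_fun[OF r orth]
    by (intro Fourier_transform_zero_AE[OF int]) (simp add: scaleR_conv_of_real)
  then show ?thesis
  proof eventually_elim
    case (elim x)
    then show ?case using hermite_fun_0_pos[of x] by auto
  qed
qed

text \<open>The Hermite functions are real, so the conjugate of f is orthogonal to them as well, and
  the real and the imaginary part can be treated separately.\<close>

theorem complete_orthonormal_phi: "complete_orthonormal phi"
  unfolding complete_orthonormal_def
proof (intro conjI ballI impI orthonormal_phi)
  fix f assume f: "f \<in> L2" and "\<forall>k. L2_inner f (phi k) = 0"
  then have orth: "L2_inner f (phi k) = 0" for k by blast
  have orth': "L2_inner (\<lambda>x. cnj (f x)) (phi k) = 0" for k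
  proof -
    have "L2_inner (\<lambda>x. cnj (f x)) (phi k) = cnj (L2_inner f (phi k))"
      unfolding L2_inner_def
      by (subst Bochner_Integration.integral_cnj[symmetric]) (simp add: phi_def)
    then show ?thesis using orth by simp
  qed
  have Re_eq: "(\<lambda>x. complex_of_real (Re (f x))) = (\<lambda>x. inverse 2 * (f x + cnj (f x)))"
    by (simp add: fun_eq_iff complex_eq_iff)
  have Im_eq: "(\<lambda>x. complex_of_real (Im (f x))) = (\<lambda>x. (- \<i>/2) * (f x - cnj (f x)))"
    by (simp add: fun_eq_iff complex_eq_iff)
  have "AE x in lborel. Re (f x) = 0"
    by (rule orthogonal_real_AE_zero; unfold Re_eq)
       (use f L2_cnj[OF f] phi_L2 orth orth' in \<open>simp_all only: L2_scale L2_add L2_inner_scale_left L2_inner_add_left, simp\<close>)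
  moreover have "AE x in lborel. Im (f x) = 0"
    by (rule orthogonal_real_AE_zero; unfold Im_eq)
       (use f L2_cnj[OF f] phi_L2 orth orth' in \<open>simp_all only: L2_scale L2_diff L2_inner_scale_left L2_inner_diff_left, simp\<close>)
  ultimately show "ae_eq f (\<lambda>x. 0)"
    unfolding ae_eq_def by eventually_elim (simp add: complex_eq_iff)
qed

section \<open>Coefficients with respect to the Hermite functions\<close>

abbreviation coef :: "(real \<Rightarrow> complex) \<Rightarrow> nat \<Rightarrow> complex" where
  "coef f k \<equiv> L2_inner f (phi k)"

lemmas coef_Bessel = Bessel[OF orthonormal_phi]
lemmas coef_Parseval = Parseval[OF complete_orthonormal_phi]
lemmas coef_ae_eq = complete_orthonormal_ae_eq[OF complete_orthonormal_phi]

lemma coef_phi: "coef (phi j) k = (if j = k then 1 else 0)"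
  using orthonormal_inner[OF orthonormal_phi] .

lemma coef_LINT: "coef f k = (LINT x|lborel. f x * phi k x)"
  by (simp add: L2_inner_def phi_def)

lemma coef_add: "f \<in> L2 \<Longrightarrow> g \<in> L2 \<Longrightarrow> coef (\<lambda>x. f x + g x) k = coef f k + coef g k"
  by (rule L2_inner_add_left) (auto simp: phi_L2)

lemma coef_diff: "f \<in> L2 \<Longrightarrow> g \<in> L2 \<Longrightarrow> coef (\<lambda>x. f x - g x) k = coef f k - coef g k"
  by (rule L2_inner_diff_left) (auto simp: phi_L2)

lemma coef_le_norm: "f \<in> L2 \<Longrightarrow> cmod (coef f k) \<le> L2_norm f"
  using L2_Cauchy_Schwarz[OF _ phi_L2, of f k] orthonormal_norm[OF orthonormal_phi, of k] by simp

lemma L2_norm_square_coef: "f \<in> L2 \<Longrightarrow> (L2_norm f)\<^sup>2 = (\<Sum>k. (cmod (coef f k))\<^sup>2)"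
  using coef_Parseval by (simp add: sums_iff)

lemma L2_norm_coef_cong:
  "f \<in> L2 \<Longrightarrow> g \<in> L2 \<Longrightarrow> (\<And>k. cmod (coef f k) = cmod (coef g k)) \<Longrightarrow> L2_norm f = L2_norm g"
  by (rule power2_eq_imp_eq) (simp_all only: L2_norm_square_coef L2_norm_nonneg)

text \<open>A representative with prescribed coefficients; the choice is meaningful for
  square-summable \<open>c\<close>, and completeness makes it unique almost everywhere.\<close>

definition synth :: "(nat \<Rightarrow> complex) \<Rightarrow> real \<Rightarrow> complex" where
  "synth c = (SOME f. f \<in> L2 \<and> (\<forall>k. coef f k = c k))"

lemma synth:
  assumes "summable (\<lambda>k. (cmod (c k))\<^sup>2)"
  shows "synth c \<in> L2" and "coef (synth c) k = c k"
proof -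
  obtain f where "f \<in> L2" "(\<lambda>n. L2_norm (\<lambda>x. (\<Sum>k<n. c k * phi k x) - f x)) \<longlonglongrightarrow> 0"
    using Riesz_Fischer[OF orthonormal_phi assms] by blast
  then have "f \<in> L2 \<and> (\<forall>k. coef f k = c k)"
    using Riesz_Fischer_inner[OF orthonormal_phi] by blast
  then have "synth c \<in> L2 \<and> (\<forall>k. coef (synth c) k = c k)"
    unfolding synth_def by (rule someI[where P="\<lambda>f. f \<in> L2 \<and> (\<forall>k. coef f k = c k)"])
  then show "synth c \<in> L2" and "coef (synth c) k = c k" by auto
qed

text \<open>Dominated convergence for series along an arbitrary filter, by Tannery's theorem; on the
  trivial filter every limit holds.\<close>

lemma suminf_tendsto_0:
  fixes a :: "nat \<Rightarrow> 'b \<Rightarrow> real"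
  assumes "\<And>k. (a k \<longlongrightarrow> 0) F" "\<And>k n. \<bar>a k n\<bar> \<le> M k" "summable M"
  shows "((\<lambda>n. \<Sum>k. a k n) \<longlongrightarrow> 0) F"
proof (cases "F = bot")
  case False
  have "((\<lambda>n. \<Sum>k. a k n) \<longlongrightarrow> (\<Sum>k. 0)) F"
    using tannerys_theorem[of a "\<lambda>_. 0" F M] assms False by (auto intro: always_eventually)
  then show ?thesis by simp
qed simp

text \<open>By Parseval the squared norm is a series in k, so termwise convergence with a summable
  majorant is enough.\<close>

lemma L2_norm_tendsto_0_coef:
  assumes F: "\<And>s. F s \<in> L2" and lim: "\<And>k. ((\<lambda>s. coef (F s) k) \<longlongrightarrow> 0) G"
    and M: "\<And>k s. (cmod (coef (F s) k))\<^sup>2 \<le> M k" "summable M"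
  shows "((\<lambda>s. L2_norm (F s)) \<longlongrightarrow> 0) G"
proof -
  have "((\<lambda>s. (cmod (coef (F s) k))\<^sup>2) \<longlongrightarrow> 0) G" for k
    using tendsto_power[OF tendsto_norm_zero[OF lim[of k]], of 2] by simp
  then have "((\<lambda>s. \<Sum>k. (cmod (coef (F s) k))\<^sup>2) \<longlongrightarrow> 0) G"
    using M by (intro suminf_tendsto_0) auto
  then have "((\<lambda>s. sqrt ((L2_norm (F s))\<^sup>2)) \<longlongrightarrow> sqrt 0) G"
    by (intro tendsto_real_sqrt) (simp add: L2_norm_square_coef F)
  then show ?thesis by simp
qed

section \<open>The harmonic oscillator\<close>

lemma schwartz_dx: "\<theta> \<in> schwartz \<Longrightarrow> dx \<theta> \<in> schwartz"
  unfolding schwartz_def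
proof (intro CollectI allI)
  fix n
  assume "\<theta> \<in> {\<theta>. \<forall>n. (\<forall>x. (dx ^^ n) \<theta> differentiable at x) \<and>
      (\<forall>m. \<exists>C. \<forall>x. \<bar>x\<bar> ^ m * cmod ((dx ^^ n) \<theta> x) \<le> C)}"
  then show "(\<forall>x. (dx ^^ n) (dx \<theta>) differentiable at x) \<and>
      (\<forall>m. \<exists>C. \<forall>x. \<bar>x\<bar> ^ m * cmod ((dx ^^ n) (dx \<theta>) x) \<le> C)"
    by (auto simp: funpow_swap1 dest: spec[of _ "Suc n"])
qed

lemma schwartz_has_derivative:
  assumes "\<theta> \<in> schwartz" shows "(\<theta> has_vector_derivative dx \<theta> x) (at x)"
proof -
  have "(dx ^^ 0) \<theta> differentiable (at x)" using assms unfolding schwartz_def by blast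
  then show ?thesis by (simp add: dx_def vector_derivative_works)
qed

lemma schwartz_isCont: "\<theta> \<in> schwartz \<Longrightarrow> isCont \<theta> x"
  using schwartz_has_derivative has_vector_derivative_continuous by blast

lemma schwartz_measurable: "\<theta> \<in> schwartz \<Longrightarrow> \<theta> \<in> borel_measurable borel"
  by (intro borel_measurable_continuous_onI continuous_at_imp_continuous_on) (simp add: schwartz_isCont)

lemma schwartz_decay:
  assumes "\<theta> \<in> schwartz" obtains C where "\<And>x. \<bar>x\<bar> ^ m * cmod (\<theta> x) \<le> C"
proof -
  have "\<exists>C. \<forall>x. \<bar>x\<bar> ^ m * cmod ((dx ^^ 0) \<theta> x) \<le> C" using assms unfolding schwartz_def by blast
  then show thesis using that by auto
qed

text \<open>With w = |x|^m |theta|, the seminorms of order m and m + 2 bound w and x^2 w, so w^2 (1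
  + x^2) is bounded and w^2 is dominated by a multiple of 1/(1 + x^2).\<close>

lemma schwartz_power_L2:
  assumes \<theta>: "\<theta> \<in> schwartz" shows "(\<lambda>x. complex_of_real (x ^ m) * \<theta> x) \<in> L2"
proof -
  obtain A where A: "\<And>x. \<bar>x\<bar> ^ m * cmod (\<theta> x) \<le> A" using schwartz_decay[OF \<theta>] by blast
  obtain B where B: "\<And>x. \<bar>x\<bar> ^ (m + 2) * cmod (\<theta> x) \<le> B" using schwartz_decay[OF \<theta>] by blast
  define w where "w x = \<bar>x\<bar> ^ m * cmod (\<theta> x)" for x
  have w_nn: "0 \<le> w x" for x by (simp add: w_def)
  have wA: "w x \<le> A" for x using A by (simp add: w_def)
  have wB: "x\<^sup>2 * w x \<le> B" for x
    using B[of x] by (simp add: w_def power_add power2_eq_square mult.assoc mult.left_commute)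
  have A0: "0 \<le> A" using w_nn wA order_trans by blast
  have bound: "(w x)\<^sup>2 \<le> A * (A + B) * inverse (1 + x\<^sup>2)" for x
  proof -
    have "(w x)\<^sup>2 * (1 + x\<^sup>2) = w x * (w x + x\<^sup>2 * w x)" by (simp add: power2_eq_square algebra_simps)
    also have "\<dots> \<le> A * (A + B)"
      using w_nn[of x] wA[of x] wB[of x] A0 by (intro mult_mono add_mono) auto
    finally have "(w x)\<^sup>2 * (1 + x\<^sup>2) \<le> A * (A + B)" .
    moreover have "1 + x\<^sup>2 > 0" using zero_le_power2[of x] by linarith
    ultimately show ?thesis by (simp add: field_simps)
  qed
  have [measurable]: "\<theta> \<in> borel_measurable borel" using \<theta> by (rule schwartz_measurable)
  have "integrable lborel (\<lambda>x. (cmod (complex_of_real (x ^ m) * \<theta> x))\<^sup>2)"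
  proof (rule Bochner_Integration.integrable_bound)
    show "integrable lborel (\<lambda>x. A * (A + B) * inverse (1 + x\<^sup>2))"
      using integrable_inverse_1_plus_square by (simp add: set_integrable_def)
    have "norm ((cmod (complex_of_real (x ^ m) * \<theta> x))\<^sup>2) \<le> norm (A * (A + B) * inverse (1 + x\<^sup>2))" for x
      using bound[of x] order_trans[OF bound[of x] abs_ge_self] by (simp add: norm_mult norm_power w_def)
    then show "AE x in lborel. norm ((cmod (complex_of_real (x ^ m) * \<theta> x))\<^sup>2)
        \<le> norm (A * (A + B) * inverse (1 + x\<^sup>2))" by (intro always_eventually) auto
  qed measurable
  then show ?thesis by (simp add: L2_def)
qed

lemma schwartz_L2: "\<theta> \<in> schwartz \<Longrightarrow> \<theta> \<in> L2"
  using schwartz_power_L2[of \<theta> 0] by simp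

lemma schwartz_tendsto:
  assumes \<theta>: "\<theta> \<in> schwartz" shows "(\<theta> \<longlongrightarrow> 0) at_top" "(\<theta> \<longlongrightarrow> 0) at_bot"
proof -
  obtain C where C: "\<And>x. \<bar>x\<bar> ^ 1 * cmod (\<theta> x) \<le> C" using schwartz_decay[OF \<theta>] by blast
  have le: "cmod (\<theta> x) \<le> C / \<bar>x\<bar>" if "x \<noteq> 0" for x
    using C[of x] that by (simp add: field_simps)
  show "(\<theta> \<longlongrightarrow> 0) at_top"
  proof (rule Lim_null_comparison)
    show "\<forall>\<^sub>F x in at_top. norm (\<theta> x) \<le> C / \<bar>x\<bar>"
      using eventually_gt_at_top[of "0::real"] by eventually_elim (intro le, simp)
    show "((\<lambda>x. C / \<bar>x\<bar>) \<longlongrightarrow> 0) at_top" by real_asymp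
  qed
  show "(\<theta> \<longlongrightarrow> 0) at_bot"
  proof (rule Lim_null_comparison)
    show "\<forall>\<^sub>F x in at_bot. norm (\<theta> x) \<le> C / \<bar>x\<bar>"
      using eventually_gt_at_bot[of "0::real"] by eventually_elim (intro le, simp)
    show "((\<lambda>x. C / \<bar>x\<bar>) \<longlongrightarrow> 0) at_bot" by real_asymp
  qed
qed

definition osc :: "(real \<Rightarrow> complex) \<Rightarrow> real \<Rightarrow> complex" where
  "osc \<theta> = (\<lambda>x. - dx (dx \<theta>) x + complex_of_real (x\<^sup>2) * \<theta> x)"

lemma osc_L2: "\<theta> \<in> schwartz \<Longrightarrow> osc \<theta> \<in> L2"
  unfolding osc_def
  using L2_add[OF L2_scale[of "dx (dx \<theta>)" "- 1"] schwartz_power_L2[of \<theta> 2]]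
  by (simp add: schwartz_L2 schwartz_dx)

lemma osc_phi: "osc (phi k) = (\<lambda>x. complex_of_real (eigval k) * phi k x)"
proof -
  have "dx (dx (phi k)) x = complex_of_real (x\<^sup>2 - eigval k) * phi k x" for x
    unfolding dx_def[of "dx (phi k)"] by (rule vector_derivative_at[OF dx_dx_phi])
  then show ?thesis unfolding osc_def by (auto simp: algebra_simps)
qed

text \<open>Green's identity: the Wronskian F = theta phi_k' - theta' phi_k has the difference of
  the two integrands as derivative and vanishes at both ends.\<close>

lemma osc_symmetric:
  assumes \<theta>: "\<theta> \<in> schwartz"
  shows "(LINT x|lborel. osc \<theta> x * phi k x) = complex_of_real (eigval k) * (LINT x|lborel. \<theta> x * phi k x)"
proof -
  define F where "F x = \<theta> x * dx (phi k) x - dx \<theta> x * phi k x" for x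
  define f where "f x = osc \<theta> x * phi k x - complex_of_real (eigval k) * (\<theta> x * phi k x)" for x
  note \<phi> = phi_schwartz[of k]
  have int1: "integrable lborel (\<lambda>x. osc \<theta> x * phi k x)"
    by (intro L2_mult_integrable osc_L2 \<theta> phi_L2)
  have int2: "integrable lborel (\<lambda>x. complex_of_real (eigval k) * (\<theta> x * phi k x))"
    by (intro integrable_mult_right L2_mult_integrable schwartz_L2 \<theta> phi_L2)
  have "(LINT x|lborel. f x) = 0 - 0"
  proof (rule LBINT_derivative)
    fix x
    have "(F has_vector_derivative \<theta> x * (complex_of_real (x\<^sup>2 - eigval k) * phi k x) + dx \<theta> x * dx (phi k) x
        - (dx \<theta> x * dx (phi k) x + dx (dx \<theta>) x * phi k x)) (at x)"
      unfolding F_def[abs_def]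
      by (intro has_vector_derivative_diff has_vector_derivative_mult schwartz_has_derivative \<theta> \<phi>
          schwartz_dx dx_dx_phi)
    then show "(F has_vector_derivative f x) (at x)"
      by (rule has_vector_derivative_eq_rhs) (simp add: f_def osc_def algebra_simps)
    show "isCont f x"
      unfolding f_def osc_def
      by (intro continuous_intros schwartz_isCont schwartz_dx \<theta> \<phi>)
  next
    show "integrable lborel f" unfolding f_def by (intro Bochner_Integration.integrable_diff int1 int2)
    have "(F \<longlongrightarrow> 0 * 0 - 0 * 0) at_bot" "(F \<longlongrightarrow> 0 * 0 - 0 * 0) at_top"
      unfolding F_def[abs_def] by (intro tendsto_intros schwartz_tendsto schwartz_dx \<theta> \<phi>)+
    then show "(F \<longlongrightarrow> 0) at_bot" "(F \<longlongrightarrow> 0) at_top" by simp_all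
  qed
  then show ?thesis
    unfolding f_def by (subst (asm) Bochner_Integration.integral_diff[OF int1 int2]) simp
qed

text \<open>Parseval for the bilinear pairing, applied to the conjugate of g; the coefficients come
  out unconjugated because the Hermite functions are real.\<close>

lemma LINT_mult_sums:
  assumes "f \<in> L2" "g \<in> L2"
  shows "(\<lambda>k. coef f k * (LINT x|lborel. g x * phi k x)) sums (LINT x|lborel. f x * g x)"
proof -
  have "cnj (coef (\<lambda>x. cnj (g x)) k) = (LINT x|lborel. g x * phi k x)" for k
    unfolding L2_inner_def
    by (subst Bochner_Integration.integral_cnj[symmetric]) (simp add: phi_def)
  then show ?thesis
    using Parseval_inner[OF complete_orthonormal_phi assms(1) L2_cnj[OF assms(2)]]
    by (simp add: L2_inner_def[of f "\<lambda>x. cnj (g x)"])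
qed

text \<open>Testing with \<open>phi k\<close> gives the necessary condition. Conversely, both
  pairings with a test function expand into series that agree term by term, since the symmetry of H
  moves the eigenvalue from one factor to the other.\<close>

theorem harmonic_oscillator_iff_coef:
  "harmonic_oscillator \<psi> g \<longleftrightarrow> \<psi> \<in> L2 \<and> g \<in> L2 \<and> (\<forall>k. coef g k = complex_of_real (eigval k) * coef \<psi> k)"
proof (intro iffI conjI allI; (elim conjE)?)
  assume h: "harmonic_oscillator \<psi> g"
  then show "\<psi> \<in> L2" "g \<in> L2" by (auto simp: harmonic_oscillator_def)
  fix k
  have "(LINT x|lborel. \<psi> x * osc (phi k) x) = (LINT x|lborel. g x * phi k x)"
    using h phi_schwartz[of k] by (simp add: harmonic_oscillator_def osc_def)
  then show "coef g k = complex_of_real (eigval k) * coef \<psi> k"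
    by (simp add: osc_phi coef_LINT mult.left_commute[of "\<psi> _"])
next
  assume \<psi>: "\<psi> \<in> L2" and g: "g \<in> L2" and eq: "\<forall>k. coef g k = complex_of_real (eigval k) * coef \<psi> k"
  have "(LINT x|lborel. \<psi> x * osc \<theta> x) = (LINT x|lborel. g x * \<theta> x)" if \<theta>: "\<theta> \<in> schwartz" for \<theta>
    using LINT_mult_sums[OF \<psi> osc_L2[OF \<theta>]] LINT_mult_sums[OF g schwartz_L2[OF \<theta>]] eq osc_symmetric[OF \<theta>]
    by (auto simp: mult_ac intro: sums_unique2)
  then show "harmonic_oscillator \<psi> g" using \<psi> g by (simp add: harmonic_oscillator_def osc_def)
qed

section \<open>The propagator\<close>

text \<open>The explicit group that serves as witness for the choice in \<open>propagator\<close>;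
  unimodular factors preserve square summability.\<close>

definition diag_group :: "real \<Rightarrow> (real \<Rightarrow> complex) \<Rightarrow> real \<Rightarrow> complex" where
  "diag_group t \<psi> = synth (\<lambda>k. iexp (- (eigval k * t)) * coef \<psi> k)"

lemma diag_group:
  assumes "\<psi> \<in> L2"
  shows "diag_group t \<psi> \<in> L2" and "coef (diag_group t \<psi>) k = iexp (- (eigval k * t)) * coef \<psi> k"
proof -
  have "summable (\<lambda>k. (cmod (iexp (- (eigval k * t)) * coef \<psi> k))\<^sup>2)"
    using coef_Bessel(1)[OF assms] by (simp only: norm_mult norm_exp_i_times mult_1)
  from synth[OF this] show "diag_group t \<psi> \<in> L2"
    and "coef (diag_group t \<psi>) k = iexp (- (eigval k * t)) * coef \<psi> k"
    unfolding diag_group_def by auto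
qed

lemma iexp_minus_1_le: "cmod (iexp x - 1) \<le> \<bar>x\<bar>"
  using iexp_approx1[of x 0] by simp

lemma iexp_minus_1_le_2: "cmod (iexp x - 1) \<le> 2"
  using norm_triangle_ineq4[of "iexp x" 1] by simp

text \<open>The generator is described by difference quotients with complex division; this passes
  between them and real differentiability of complex functions.\<close>

lemma has_vector_derivative_iff_quotient:
  fixes y :: "real \<Rightarrow> complex"
  shows "(y has_vector_derivative c) (at t) \<longleftrightarrow> ((\<lambda>h. (y (t + h) - y t) / complex_of_real h) \<longlongrightarrow> c) (at 0)"
proof -
  have eq: "norm (a - h *\<^sub>R c) / norm h = norm (a / complex_of_real h - c)" if "h \<noteq> 0" for a :: complex and h :: real
  proof -
    have "a / complex_of_real h - c = (a - h *\<^sub>R c) / complex_of_real h"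
      using that by (simp add: diff_divide_distrib scaleR_conv_of_real)
    then show ?thesis by (simp add: norm_divide)
  qed
  have "(y has_vector_derivative c) (at t)
      \<longleftrightarrow> ((\<lambda>h. norm (y (t + h) - y t - h *\<^sub>R c) / norm h) \<longlongrightarrow> 0) (at 0)"
    unfolding has_vector_derivative_def has_derivative_at by (simp add: bounded_linear_scaleR_left)
  also have "\<dots> \<longleftrightarrow> ((\<lambda>h. norm ((y (t + h) - y t) / complex_of_real h - c)) \<longlongrightarrow> 0) (at 0)"
    by (rule tendsto_cong) (use eq in \<open>auto simp: eventually_at_filter intro!: always_eventually\<close>)
  also have "\<dots> \<longleftrightarrow> ((\<lambda>h. (y (t + h) - y t) / complex_of_real h) \<longlongrightarrow> c) (at 0)"
    unfolding tendsto_norm_zero_iff by (rule LIM_zero_iff)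
  finally show ?thesis .
qed

lemma has_vector_derivative_iexp:
  "((\<lambda>t. iexp (l * t)) has_vector_derivative \<i> * complex_of_real l * iexp (l * t)) (at t)"
proof -
  have "((\<lambda>z. exp (\<i> * (complex_of_real l * z))) has_field_derivative
      \<i> * complex_of_real l * exp (\<i> * (complex_of_real l * complex_of_real t))) (at (complex_of_real t))"
    by (auto intro!: derivative_eq_intros)
  from has_vector_derivative_real_field[OF this] show ?thesis by simp
qed

lemma iexp_difference_quotient:
  "((\<lambda>t. (iexp (- (l * t)) - 1) / complex_of_real t) \<longlongrightarrow> - \<i> * complex_of_real l) (at 0)"
proof -
  have "((\<lambda>t. iexp (- l * t)) has_vector_derivative \<i> * complex_of_real (- l) * iexp (- l * 0)) (at 0)"
    by (rule has_vector_derivative_iexp)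
  then show ?thesis unfolding has_vector_derivative_iff_quotient by simp
qed

text \<open>A bound uniform in t, for the dominated convergence below. Division by 0 yields 0, so it
  also holds at t = 0, where the majorant is required too.\<close>

lemma iexp_difference_quotient_le:
  "cmod ((iexp (- (l * t)) - 1) / complex_of_real t + \<i> * complex_of_real l) \<le> 2 * \<bar>l\<bar>"
proof -
  have "cmod ((iexp (- (l * t)) - 1) / complex_of_real t) \<le> \<bar>l\<bar>"
    using iexp_minus_1_le[of "- (l * t)"] by (cases "t = 0") (auto simp: norm_divide abs_mult field_simps)
  then show ?thesis
    using norm_triangle_ineq[of "(iexp (- (l * t)) - 1) / complex_of_real t" "\<i> * complex_of_real l"]
    by (simp add: norm_mult)
qed

lemma quotient_L2:
  assumes "f \<in> L2" "\<psi> \<in> L2" "g \<in> L2"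
  shows "(\<lambda>x. (f x - \<psi> x) / complex_of_real t - (- \<i> * g x)) \<in> L2"
    and "coef (\<lambda>x. (f x - \<psi> x) / complex_of_real t - (- \<i> * g x)) k = (coef f k - coef \<psi> k) / complex_of_real t + \<i> * coef g k"
proof -
  have eq: "(\<lambda>x. (f x - \<psi> x) / complex_of_real t - (- \<i> * g x)) = (\<lambda>x. inverse (complex_of_real t) * (f x - \<psi> x) + \<i> * g x)"
    by (simp add: fun_eq_iff divide_inverse mult.commute)
  show "(\<lambda>x. (f x - \<psi> x) / complex_of_real t - (- \<i> * g x)) \<in> L2"
    unfolding eq using assms by (intro L2_add L2_scale L2_diff)
  show "coef (\<lambda>x. (f x - \<psi> x) / complex_of_real t - (- \<i> * g x)) k = (coef f k - coef \<psi> k) / complex_of_real t + \<i> * coef g k"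
    unfolding eq using assms
    by (simp only: coef_add L2_scale L2_diff L2_inner_scale_left coef_diff) (simp add: divide_inverse mult.commute)
qed

text \<open>Each clause is checked on coefficients. On the domain of H the difference quotients have
  the majorant 4 |lambda_k coef psi|^2 = 4 |coef g|^2, which is summable because g is in L2. In the
  other direction norm convergence forces convergence of each coefficient, and uniqueness of limits
  gives g = H psi.\<close>

theorem diag_group_generated: "generates_unitary_group harmonic_oscillator diag_group"
  unfolding generates_unitary_group_def
proof (intro conjI allI ballI)
  fix \<psi> assume \<psi>: "\<psi> \<in> L2"
  note D = diag_group[OF \<psi>]
  show "diag_group t \<psi> \<in> L2" for t by (rule D)
  show "L2_norm (diag_group t \<psi>) = L2_norm \<psi>" for t
    by (rule L2_norm_coef_cong[OF D(1) \<psi>]) (simp only: D(2) norm_mult norm_exp_i_times mult_1)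
  show "ae_eq (diag_group t (\<lambda>x. c * \<psi> x + \<eta> x)) (\<lambda>x. c * diag_group t \<psi> x + diag_group t \<eta> x)"
    if \<eta>: "\<eta> \<in> L2" for t c \<eta>
  proof (rule coef_ae_eq)
    have c: "(\<lambda>x. c * \<psi> x + \<eta> x) \<in> L2" by (intro L2_add L2_scale \<psi> \<eta>)
    note E = diag_group[OF \<eta>] and C = diag_group[OF c]
    show "diag_group t (\<lambda>x. c * \<psi> x + \<eta> x) \<in> L2" by (rule C)
    show "(\<lambda>x. c * diag_group t \<psi> x + diag_group t \<eta> x) \<in> L2" by (intro L2_add L2_scale D E)
    show "coef (diag_group t (\<lambda>x. c * \<psi> x + \<eta> x)) k = coef (\<lambda>x. c * diag_group t \<psi> x + diag_group t \<eta> x) k" for k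
      by (simp only: C D E coef_add L2_scale \<psi> \<eta> L2_inner_scale_left distrib_left mult.left_commute)
  qed
  show "ae_eq (diag_group 0 \<psi>) \<psi>"
    by (rule coef_ae_eq[OF D(1) \<psi>]) (simp add: D(2))
  show "ae_eq (diag_group (s + t) \<psi>) (diag_group s (diag_group t \<psi>))" for s t
  proof (rule coef_ae_eq[OF D(1) diag_group(1)[OF D(1)]])
    show "coef (diag_group (s + t) \<psi>) k = coef (diag_group s (diag_group t \<psi>)) k" for k
      unfolding D(2) diag_group(2)[OF D(1)] mult.assoc[symmetric] exp_add[symmetric]
      by (simp add: algebra_simps)
  qed
  show "((\<lambda>t. L2_norm (\<lambda>x. diag_group t \<psi> x - \<psi> x)) \<longlongrightarrow> 0) (at 0)"
  proof (rule L2_norm_tendsto_0_coef)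
    show "(\<lambda>x. diag_group t \<psi> x - \<psi> x) \<in> L2" for t by (intro L2_diff D \<psi>)
    have coef_eq: "coef (\<lambda>x. diag_group t \<psi> x - \<psi> x) k = (iexp (- (eigval k * t)) - 1) * coef \<psi> k" for t k
      by (simp only: coef_diff D \<psi> left_diff_distrib mult_1)
    have "((\<lambda>t. (iexp (- (eigval k * t)) - 1) * coef \<psi> k) \<longlongrightarrow> (iexp (- (eigval k * 0)) - 1) * coef \<psi> k) (at 0)" for k
      by (intro tendsto_intros)
    then show "((\<lambda>t. coef (\<lambda>x. diag_group t \<psi> x - \<psi> x) k) \<longlongrightarrow> 0) (at 0)" for k
      unfolding coef_eq by simp
    show "(cmod (coef (\<lambda>x. diag_group t \<psi> x - \<psi> x) k))\<^sup>2 \<le> 4 * (cmod (coef \<psi> k))\<^sup>2" for k t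
    proof -
      have "(cmod (iexp (- (eigval k * t)) - 1))\<^sup>2 \<le> 2\<^sup>2"
        by (intro power_mono iexp_minus_1_le_2 norm_ge_zero)
      then show ?thesis
        unfolding coef_eq norm_mult power_mult_distrib by (intro mult_right_mono) auto
    qed
    show "summable (\<lambda>k. 4 * (cmod (coef \<psi> k))\<^sup>2)"
      by (intro summable_mult coef_Bessel \<psi>)
  qed
  fix g assume g: "g \<in> L2"
  let ?q = "\<lambda>t x. (diag_group t \<psi> x - \<psi> x) / complex_of_real t - (- \<i> * g x)"
  note Q = quotient_L2[OF D(1) \<psi> g]
  have coef_eq: "coef (?q t) k
      = (iexp (- (eigval k * t)) - 1) / complex_of_real t * coef \<psi> k + \<i> * coef g k" for t k
    unfolding Q(2) D(2) by (simp add: left_diff_distrib)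
  have lim: "((\<lambda>t. coef (?q t) k)
      \<longlongrightarrow> - \<i> * complex_of_real (eigval k) * coef \<psi> k + \<i> * coef g k) (at 0)" for k
    unfolding coef_eq by (intro tendsto_intros iexp_difference_quotient)
  show "harmonic_oscillator \<psi> g \<longleftrightarrow>
      ((\<lambda>t. L2_norm (?q t)) \<longlongrightarrow> 0) (at 0)"
  proof
    assume "harmonic_oscillator \<psi> g"
    then have eq: "coef g k = complex_of_real (eigval k) * coef \<psi> k" for k
      by (simp add: harmonic_oscillator_iff_coef)
    show "((\<lambda>t. L2_norm (?q t)) \<longlongrightarrow> 0) (at 0)"
    proof (rule L2_norm_tendsto_0_coef[OF Q(1)])
      show "((\<lambda>t. coef (?q t) k) \<longlongrightarrow> 0) (at 0)" for k
        using lim[of k] by (simp add: eq)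
      show "(cmod (coef (?q t) k))\<^sup>2
          \<le> 4 * (cmod (coef g k))\<^sup>2" for k t
      proof -
        have "coef (?q t) k
          = ((iexp (- (eigval k * t)) - 1) / complex_of_real t + \<i> * complex_of_real (eigval k)) * coef \<psi> k"
          unfolding coef_eq by (simp only: eq distrib_right mult.assoc)
        also have "cmod \<dots> \<le> 2 * \<bar>eigval k\<bar> * cmod (coef \<psi> k)"
          unfolding norm_mult by (intro mult_right_mono iexp_difference_quotient_le) auto
        also have "\<dots> = 2 * cmod (coef g k)" by (simp add: eq norm_mult)
        finally show ?thesis
          using power_mono[of _ "2 * cmod (coef g k)" 2] by (force simp: power_mult_distrib)
      qed
      show "summable (\<lambda>k. 4 * (cmod (coef g k))\<^sup>2)" by (intro summable_mult coef_Bessel g)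
    qed
  next
    assume norm_lim: "((\<lambda>t. L2_norm (?q t)) \<longlongrightarrow> 0) (at 0)"
    have "coef g k = complex_of_real (eigval k) * coef \<psi> k" for k
    proof -
      have "((\<lambda>t. coef (?q t) k) \<longlongrightarrow> 0) (at 0)"
        by (rule Lim_null_comparison[OF always_eventually norm_lim]) (intro allI coef_le_norm Q)
      then have "- \<i> * complex_of_real (eigval k) * coef \<psi> k + \<i> * coef g k = 0"
        using lim[of k] by (rule LIM_unique[symmetric])
      then have "\<i> * coef g k = \<i> * (complex_of_real (eigval k) * coef \<psi> k)"
        by (simp add: mult.assoc)
      then show ?thesis by (simp only: mult_cancel_left) simp
    qed
    then show "harmonic_oscillator \<psi> g" using \<psi> g by (simp add: harmonic_oscillator_iff_coef)
  qed
qed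

lemma propagator_generated: "generates_unitary_group harmonic_oscillator propagator"
  unfolding propagator_def by (rule someI[of _ diag_group]) (rule diag_group_generated)

lemma propagator_L2: "\<psi> \<in> L2 \<Longrightarrow> propagator t \<psi> \<in> L2"
  and propagator_norm: "\<psi> \<in> L2 \<Longrightarrow> L2_norm (propagator t \<psi>) = L2_norm \<psi>"
  and propagator_linear: "\<psi> \<in> L2 \<Longrightarrow> \<eta> \<in> L2 \<Longrightarrow>
     ae_eq (propagator t (\<lambda>x. c * \<psi> x + \<eta> x)) (\<lambda>x. c * propagator t \<psi> x + propagator t \<eta> x)"
  and propagator_0: "\<psi> \<in> L2 \<Longrightarrow> ae_eq (propagator 0 \<psi>) \<psi>"
  and propagator_add: "\<psi> \<in> L2 \<Longrightarrow> ae_eq (propagator (s + t) \<psi>) (propagator s (propagator t \<psi>))"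
  and propagator_generator: "\<psi> \<in> L2 \<Longrightarrow> g \<in> L2 \<Longrightarrow> harmonic_oscillator \<psi> g \<longleftrightarrow>
     ((\<lambda>t. L2_norm (\<lambda>x. (propagator t \<psi> x - \<psi> x) / complex_of_real t - (- \<i> * g x))) \<longlongrightarrow> 0) (at 0)"
  using propagator_generated unfolding generates_unitary_group_def by blast+

lemma L2_inner_propagator_linear:
  assumes "\<psi> \<in> L2" "\<eta> \<in> L2" "h \<in> L2"
  shows "L2_inner (propagator t (\<lambda>x. c * \<psi> x + \<eta> x)) h
    = c * L2_inner (propagator t \<psi>) h + L2_inner (propagator t \<eta>) h"
proof -
  have "L2_inner (propagator t (\<lambda>x. c * \<psi> x + \<eta> x)) h = L2_inner (\<lambda>x. c * propagator t \<psi> x + propagator t \<eta> x) h"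
    using assms by (intro L2_inner_ae_cong propagator_linear propagator_L2 L2_add L2_scale)
  also have "\<dots> = c * L2_inner (propagator t \<psi>) h + L2_inner (propagator t \<eta>) h"
    using assms by (simp add: L2_inner_add_left L2_inner_scale_left propagator_L2 L2_scale)
  finally show ?thesis .
qed

lemma propagator_Re_inner:
  assumes f: "f \<in> L2" and g: "g \<in> L2"
  shows "Re (L2_inner (propagator t f) (propagator t g)) = Re (L2_inner f g)"
proof -
  have "L2_norm (\<lambda>x. propagator t f x + propagator t g x) = L2_norm (propagator t (\<lambda>x. f x + g x))"
    using propagator_linear[OF f g, of t 1] f g
    by (intro L2_norm_ae_cong[symmetric]) (auto intro: propagator_L2 L2_add)
  also have "\<dots> = L2_norm (\<lambda>x. f x + g x)" using f g by (intro propagator_norm L2_add)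
  finally show ?thesis
    using L2_norm_add_square[OF f g] L2_norm_add_square[OF propagator_L2[OF f] propagator_L2[OF g], of t t]
      propagator_norm[OF f, of t] propagator_norm[OF g, of t] by simp
qed

text \<open>Polarization: isometry and linearity preserve the real part of the inner product, and
  replacing f by i f yields the imaginary part.\<close>

lemma propagator_inner:
  assumes f: "f \<in> L2" and g: "g \<in> L2"
  shows "L2_inner (propagator t f) (propagator t g) = L2_inner f g"
proof (rule complex_eqI)
  show "Re (L2_inner (propagator t f) (propagator t g)) = Re (L2_inner f g)"
    by (rule propagator_Re_inner[OF f g])
  have zero: "L2_inner (propagator t (\<lambda>x. 0)) h = 0" if "h \<in> L2" for h
    using L2_inner_propagator_linear[of "\<lambda>x. 0" "\<lambda>x. 0" h t 1] that by simp
  have "L2_inner (propagator t (\<lambda>x. \<i> * f x)) (propagator t g) = \<i> * L2_inner (propagator t f) (propagator t g)"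
    using L2_inner_propagator_linear[of f "\<lambda>x. 0" "propagator t g" t \<i>] zero f g by (simp add: propagator_L2)
  moreover have "Re (L2_inner (propagator t (\<lambda>x. \<i> * f x)) (propagator t g)) = Re (L2_inner (\<lambda>x. \<i> * f x) g)"
    by (rule propagator_Re_inner[OF L2_scale[OF f] g])
  ultimately show "Im (L2_inner (propagator t f) (propagator t g)) = Im (L2_inner f g)"
    by (simp add: L2_inner_scale_left)
qed

text \<open>Applying the isometry \<open>propagator t\<close> to the difference quotient of \<open>phi k\<close> at \<open>0\<close> shows that
  the coefficients of \<open>propagator t (phi k)\<close> solve \<open>y' = - \<i> \<lambda>\<^sub>k y\<close>.\<close>

lemma propagator_phi_derivative:
  "((\<lambda>t. coef (propagator t (phi k)) j) has_vector_derivative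
      - \<i> * complex_of_real (eigval k) * coef (propagator t (phi k)) j) (at t)"
proof -
  define y where "y t = coef (propagator t (phi k)) j" for t
  define g where "g x = complex_of_real (eigval k) * phi k x" for x
  have g: "g \<in> L2" unfolding g_def by (intro L2_scale phi_L2)
  define q where "q h x = (propagator h (phi k) x - phi k x) / complex_of_real h - (- \<i> * g x)" for h x
  have q: "q h \<in> L2" for h
    unfolding q_def by (intro quotient_L2(1) propagator_L2 phi_L2 g)
  have "harmonic_oscillator (phi k) g"
    by (simp add: harmonic_oscillator_iff_coef phi_L2 g_def[abs_def] L2_inner_scale_left L2_scale coef_phi)
  then have lim: "((\<lambda>h. L2_norm (q h)) \<longlongrightarrow> 0) (at 0)"
    unfolding q_def using propagator_generator[OF phi_L2 g] by blast
  have qeq: "coef (propagator t (q h)) j = (y (t + h) - y t) / complex_of_real h + \<i> * complex_of_real (eigval k) * y t" for h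
  proof -
    define c where "c = inverse (complex_of_real h)"
    have "q h = (\<lambda>x. c * propagator h (phi k) x + ((\<i> * complex_of_real (eigval k) - c) * phi k x + 0))"
      unfolding q_def g_def c_def by (simp add: fun_eq_iff divide_inverse algebra_simps)
    then have "coef (propagator t (q h)) j = c * coef (propagator t (propagator h (phi k))) j
        + ((\<i> * complex_of_real (eigval k) - c) * coef (propagator t (phi k)) j + coef (propagator t (\<lambda>x. 0)) j)"
      using L2_inner_propagator_linear[OF propagator_L2[OF phi_L2] L2_scale[OF phi_L2] phi_L2]
        L2_inner_propagator_linear[OF phi_L2 L2_zero phi_L2] by simp
    also have "coef (propagator t (\<lambda>x. 0)) j = 0"
      using L2_inner_propagator_linear[of "\<lambda>x. 0" "\<lambda>x. 0" "phi j" t 1] phi_L2 by simp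
    also have "coef (propagator t (propagator h (phi k))) j = y (t + h)"
      unfolding y_def by (rule L2_inner_ae_cong[OF ae_eq_sym[OF propagator_add]]) (auto intro: propagator_L2 phi_L2)
    finally show ?thesis by (simp add: c_def y_def divide_inverse algebra_simps)
  qed
  have "((\<lambda>h. (y (t + h) - y t) / complex_of_real h + \<i> * complex_of_real (eigval k) * y t) \<longlongrightarrow> 0) (at 0)"
  proof (rule Lim_null_comparison[OF always_eventually lim], rule allI)
    show "cmod ((y (t + h) - y t) / complex_of_real h + \<i> * complex_of_real (eigval k) * y t) \<le> L2_norm (q h)" for h
      unfolding qeq[symmetric] using coef_le_norm[OF propagator_L2[OF q]] propagator_norm[OF q] by metis
  qed
  then have "((\<lambda>h. ((y (t + h) - y t) / complex_of_real h + \<i> * complex_of_real (eigval k) * y t) - \<i> * complex_of_real (eigval k) * y t)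
      \<longlongrightarrow> 0 - \<i> * complex_of_real (eigval k) * y t) (at 0)"
    by (intro tendsto_intros)
  then have "((\<lambda>h. (y (t + h) - y t) / complex_of_real h) \<longlongrightarrow> - \<i> * complex_of_real (eigval k) * y t) (at 0)"
    by simp
  then have "(y has_vector_derivative - \<i> * complex_of_real (eigval k) * y t) (at t)"
    unfolding has_vector_derivative_iff_quotient .
  then show ?thesis by (simp add: y_def[abs_def])
qed

text \<open>Multiplying by the integrating factor exp(i lambda_k t) gives a function with derivative
  0, hence constant and equal to its value at t = 0.\<close>

lemma coef_propagator_phi: "coef (propagator t (phi k)) j = iexp (- (eigval k * t)) * (if k = j then 1 else 0)"
proof -
  define y where "y t = coef (propagator t (phi k)) j" for t
  define z where "z t = iexp (eigval k * t) * y t" for t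
  have "(z has_vector_derivative iexp (eigval k * t) * (- \<i> * complex_of_real (eigval k) * y t)
      + \<i> * complex_of_real (eigval k) * iexp (eigval k * t) * y t) (at t)" for t
    unfolding z_def[abs_def] y_def[abs_def]
    by (intro has_vector_derivative_mult has_vector_derivative_iexp propagator_phi_derivative)
  then have "(z has_vector_derivative 0) (at t within UNIV)" for t
    by (rule has_vector_derivative_eq_rhs) (simp add: algebra_simps)
  then obtain c where "\<And>t. z t = c"
    using has_vector_derivative_zero_constant[of UNIV z] by auto
  then have "z t = z 0" by simp
  also have "z 0 = (if k = j then 1 else 0)"
    using L2_inner_ae_cong[OF propagator_0[OF phi_L2] propagator_L2[OF phi_L2] phi_L2 phi_L2, of k j]
    by (simp add: z_def y_def coef_phi)
  finally have "iexp (- (eigval k * t)) * z t = iexp (- (eigval k * t)) * (if k = j then 1 else 0)" by simp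
  moreover have "iexp (- (eigval k * t)) * z t = y t"
    by (simp add: z_def mult.assoc[symmetric] exp_add[symmetric])
  ultimately show ?thesis by (simp add: y_def)
qed

text \<open>Preservation of inner products turns the claim into a statement about
  \<open>propagator t (phi k)\<close>, which is \<open>phi k\<close> times a phase almost
  everywhere.\<close>

theorem propagator_coef:
  assumes \<psi>: "\<psi> \<in> L2" shows "coef (propagator t \<psi>) k = iexp (- (eigval k * t)) * coef \<psi> k"
proof -
  define e where "e = (\<lambda>x. iexp (eigval k * t) * propagator t (phi k) x)"
  have eL: "e \<in> L2" unfolding e_def by (intro L2_scale propagator_L2 phi_L2)
  have "ae_eq (phi k) e"
  proof (rule coef_ae_eq[OF phi_L2 eL])
    show "coef (phi k) j = coef e j" for j
      unfolding e_def L2_inner_scale_left coef_propagator_phi coef_phi mult.assoc[symmetric] exp_add[symmetric]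
      by simp
  qed
  then have "coef (propagator t \<psi>) k = L2_inner (propagator t \<psi>) e"
    by (intro L2_inner_ae_cong_right phi_L2 eL propagator_L2 \<psi>)
  also have "\<dots> = cnj (iexp (eigval k * t)) * coef \<psi> k"
    unfolding e_def by (simp only: L2_inner_scale_right propagator_inner[OF \<psi> phi_L2])
  also have "cnj (iexp (eigval k * t)) = iexp (- (eigval k * t))"
    by (simp add: exp_cnj)
  finally show ?thesis .
qed

section \<open>Integrals of \<open>L\<^sup>2\<close>-valued functions\<close>

abbreviation finite_sets_in :: "real set \<Rightarrow> real set set" where
  "finite_sets_in S \<equiv> {A \<in> sets lborel. A \<subseteq> S \<and> emeasure lborel A < \<infinity>}"

text \<open>The complex-valued counterpart of \<open>simple_val\<close>: the k-th coefficient of a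
  simple function is again simple, with the same sets.\<close>

definition scalar_val :: "(real set \<times> complex) list \<Rightarrow> real \<Rightarrow> complex" where
  "scalar_val q s = (\<Sum>(A, y)\<leftarrow>q. indicator A s * y)"

definition scalar_int :: "(real set \<times> complex) list \<Rightarrow> complex" where
  "scalar_int q = (\<Sum>(A, y)\<leftarrow>q. complex_of_real (measure lborel A) * y)"

lemma scalar_val_Nil[simp]: "scalar_val [] s = 0"
  and scalar_val_Cons[simp]: "scalar_val ((A, y) # q) s = indicator A s * y + scalar_val q s"
  and scalar_int_Nil[simp]: "scalar_int [] = 0"
  and scalar_int_Cons[simp]: "scalar_int ((A, y) # q) = complex_of_real (measure lborel A) * y + scalar_int q"
  by (simp_all add: scalar_val_def scalar_int_def)

lemma simple_val_Nil[simp]: "simple_val [] s = (\<lambda>x. 0)"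
  and simple_val_Cons[simp]: "simple_val ((A, g) # p) s = (\<lambda>x. indicator A s * g x + simple_val p s x)"
  and simple_int_Nil[simp]: "simple_int [] = (\<lambda>x. 0)"
  and simple_int_Cons[simp]: "simple_int ((A, g) # p) = (\<lambda>x. complex_of_real (measure lborel A) * g x + simple_int p x)"
  by (simp_all add: simple_val_def simple_int_def)

lemma has_bochner_integral_scalar_val:
  "fst ` set q \<subseteq> finite_sets_in S \<Longrightarrow> has_bochner_integral lborel (scalar_val q) (scalar_int q)"
proof (induction q)
  case (Cons a q)
  obtain A y where a: "a = (A, y)" by force
  have A: "A \<in> sets lborel" "emeasure lborel A < \<infinity>" using Cons.prems by (auto simp: a)
  have "has_bochner_integral lborel (\<lambda>s. indicator A s *\<^sub>R y) (measure lborel A *\<^sub>R y)"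
    using A by (rule has_bochner_integral_indicator)
  then have "has_bochner_integral lborel (\<lambda>s. indicator A s *\<^sub>R y + scalar_val q s) (measure lborel A *\<^sub>R y + scalar_int q)"
    using Cons by (intro has_bochner_integral_add) auto
  moreover have "(\<lambda>s. indicator A s *\<^sub>R y + scalar_val q s) = scalar_val (a # q)"
    by (auto simp: a fun_eq_iff split: split_indicator)
  ultimately have "has_bochner_integral lborel (scalar_val (a # q)) (measure lborel A *\<^sub>R y + scalar_int q)"
    by (simp only:)
  then show ?case by (simp only: a scalar_int_Cons scaleR_conv_of_real)
qed (simp add: has_bochner_integral_zero[of lborel] scalar_val_def[abs_def])

lemma scalar_val_outside: "fst ` set q \<subseteq> finite_sets_in S \<Longrightarrow> s \<notin> S \<Longrightarrow> scalar_val q s = 0"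
  by (induction q) (auto split: split_indicator)

lemma simple_val_L2: "snd ` set p \<subseteq> L2 \<Longrightarrow> simple_val p s \<in> L2"
  by (induction p) (auto intro!: L2_add L2_scale)

lemma simple_int_L2: "snd ` set p \<subseteq> L2 \<Longrightarrow> simple_int p \<in> L2"
  by (induction p) (auto intro!: L2_add L2_scale)

lemma coef_simple_val:
  "snd ` set p \<subseteq> L2 \<Longrightarrow> coef (simple_val p s) k = scalar_val (map (\<lambda>(A, g). (A, coef g k)) p) s"
  by (induction p) (auto simp: coef_add L2_scale simple_val_L2 L2_inner_scale_left)

lemma coef_simple_int:
  "snd ` set p \<subseteq> L2 \<Longrightarrow> coef (simple_int p) k = scalar_int (map (\<lambda>(A, g). (A, coef g k)) p)"
  by (induction p) (auto simp: coef_add L2_scale simple_int_L2 L2_inner_scale_left)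

text \<open>Taking a coefficient is linear and bounded by the norm, so the coefficients of the
  approximating simple functions converge in mean to those of F, while their integrals converge to
  the coefficient of I. In particular the coefficients of I do not depend on the approximating
  sequence.\<close>

theorem has_L2_integral_coef:
  assumes I: "has_L2_integral S F I" and int: "set_integrable lborel S (\<lambda>s. coef (F s) k)"
  shows "coef I k = (LINT s:S|lborel. coef (F s) k)"
proof -
  from I obtain p where F: "\<And>s. s \<in> S \<Longrightarrow> F s \<in> L2" and IL: "I \<in> L2"
    and p: "\<And>n. set (p n) \<subseteq> finite_sets_in S \<times> L2"
    and lim1: "(\<lambda>n. \<integral>\<^sup>+s\<in>S. ennreal (L2_norm (\<lambda>x. F s x - simple_val (p n) s x)) \<partial>lborel) \<longlonglongrightarrow> 0"
    and lim2: "(\<lambda>n. L2_norm (\<lambda>x. simple_int (p n) x - I x)) \<longlonglongrightarrow> 0"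
    unfolding has_L2_integral_def by blast
  define q where "q n = map (\<lambda>(A, g). (A, coef g k)) (p n)" for n
  have pL: "snd ` set (p n) \<subseteq> L2" for n using p[of n] by auto
  have q: "fst ` set (q n) \<subseteq> finite_sets_in S" for n using p[of n] by (fastforce simp: q_def)
  define f where "f s = indicator S s *\<^sub>R coef (F s) k" for s
  have f: "integrable lborel f" using int by (simp add: f_def[abs_def] set_integrable_def)
  have hq: "integrable lborel (scalar_val (q n))" "(LINT s|lborel. scalar_val (q n) s) = scalar_int (q n)" for n
    using has_bochner_integral_scalar_val[OF q[of n]] by (auto simp: has_bochner_integral_iff)
  have "(\<lambda>n. ennreal (norm (scalar_int (q n) - (LINT s|lborel. f s)))) \<longlonglongrightarrow> 0"
  proof (rule tendsto_sandwich[OF _ _ tendsto_const lim1])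
    show "\<forall>\<^sub>F n in sequentially. ennreal (norm (scalar_int (q n) - (LINT s|lborel. f s)))
      \<le> (\<integral>\<^sup>+s\<in>S. ennreal (L2_norm (\<lambda>x. F s x - simple_val (p n) s x)) \<partial>lborel)"
    proof (rule always_eventually, rule allI)
      fix n
      have "scalar_int (q n) - (LINT s|lborel. f s) = (LINT s|lborel. scalar_val (q n) s - f s)"
        using hq f by simp
      also have "ennreal (norm \<dots>) \<le> (\<integral>\<^sup>+s. norm (scalar_val (q n) s - f s) \<partial>lborel)"
        using hq f by (intro integral_norm_bound_ennreal) auto
      also have "\<dots> \<le> (\<integral>\<^sup>+s\<in>S. ennreal (L2_norm (\<lambda>x. F s x - simple_val (p n) s x)) \<partial>lborel)"
      proof (rule nn_integral_mono)
        fix s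
        show "ennreal (norm (scalar_val (q n) s - f s))
          \<le> ennreal (L2_norm (\<lambda>x. F s x - simple_val (p n) s x)) * indicator S s"
        proof (cases "s \<in> S")
          case True
          have "cmod (coef (\<lambda>x. F s x - simple_val (p n) s x) k) \<le> L2_norm (\<lambda>x. F s x - simple_val (p n) s x)"
            by (intro coef_le_norm L2_diff F simple_val_L2 pL True)
          then show ?thesis
            using True by (simp add: f_def coef_diff F simple_val_L2 pL coef_simple_val q_def norm_minus_commute ennreal_leI)
        qed (use scalar_val_outside[OF q[of n]] in \<open>simp add: f_def\<close>)
      qed
      finally show "ennreal (norm (scalar_int (q n) - (LINT s|lborel. f s)))
        \<le> (\<integral>\<^sup>+s\<in>S. ennreal (L2_norm (\<lambda>x. F s x - simple_val (p n) s x)) \<partial>lborel)" .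
    qed
  qed simp
  then have "(\<lambda>n. norm (scalar_int (q n) - (LINT s|lborel. f s))) \<longlonglongrightarrow> 0"
    by (subst (asm) ennreal_0[symmetric], subst (asm) tendsto_ennreal_iff) auto
  then have "(\<lambda>n. scalar_int (q n)) \<longlonglongrightarrow> (LINT s|lborel. f s)"
    by (rule LIM_zero_cancel[OF tendsto_norm_zero_cancel])
  moreover have "(\<lambda>n. coef (simple_int (p n)) k) \<longlonglongrightarrow> coef I k"
    by (intro L2_inner_tendsto simple_int_L2 pL IL phi_L2 lim2)
  ultimately have "coef I k = (LINT s|lborel. f s)"
    by (simp add: coef_simple_int pL q_def) (metis LIMSEQ_unique)
  then show ?thesis by (simp add: f_def set_lebesgue_integral_def)
qed

lemma integrable_scalar_approximation:
  fixes f :: "real \<Rightarrow> complex"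
  assumes f: "integrable lborel f" and S: "S \<in> sets lborel" and zero: "\<And>s. s \<notin> S \<Longrightarrow> f s = 0"
    and e: "e > 0"
  shows "\<exists>q. fst ` set q \<subseteq> finite_sets_in S \<and> (\<integral>\<^sup>+s. ennreal (norm (f s - scalar_val q s)) \<partial>lborel) < ennreal e"
proof -
  from f obtain y where "has_bochner_integral lborel f y" by (auto simp: integrable.simps)
  then obtain \<sigma> where \<sigma>: "\<And>i. Bochner_Integration.simple_bochner_integrable lborel (\<sigma> i)"
    and lim: "(\<lambda>i. \<integral>\<^sup>+s. ennreal (norm (f s - \<sigma> i s)) \<partial>lborel) \<longlonglongrightarrow> 0"
    by (auto simp: has_bochner_integral.simps)
  have "\<forall>\<^sub>F i in sequentially. (\<integral>\<^sup>+s. ennreal (norm (f s - \<sigma> i s)) \<partial>lborel) < ennreal e"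
    using e by (intro order_tendstoD(2)[OF lim]) simp
  then obtain i where i: "(\<integral>\<^sup>+s. ennreal (norm (f s - \<sigma> i s)) \<partial>lborel) < ennreal e"
    using eventually_happens by force
  define g where "g = \<sigma> i"
  have g: "simple_function lborel g" "emeasure lborel {s. g s \<noteq> 0} \<noteq> \<infinity>"
    using \<sigma>[of i] by (auto simp: g_def Bochner_Integration.simple_bochner_integrable.simps)
  have gm: "g -` {y} \<in> sets lborel" for y
    using simple_functionD(2)[OF g(1), of "{y}"] by simp
  \<comment> \<open>The value 0 is left out because its preimage may have infinite measure.\<close>
  obtain ys where ys: "set ys = range g - {0}" "distinct ys"
    using simple_functionD(1)[OF g(1)] finite_distinct_list[of "range g - {0}"] by auto
  \<comment> \<open>Intersecting with \<open>S\<close> only restricts the simple function to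
    \<open>S\<close>; f vanishes outside, so the error in mean does not grow.\<close>
  define q where "q = map (\<lambda>y. (g -` {y} \<inter> S, y)) ys"
  have fin: "emeasure lborel (g -` {y} \<inter> S) < \<infinity>" if "y \<noteq> 0" for y
  proof -
    have "{s. g s \<noteq> 0} = - (g -` {0})" by auto
    then have "{s. g s \<noteq> 0} \<in> sets lborel" using gm[of 0] by auto
    then have "emeasure lborel (g -` {y} \<inter> S) \<le> emeasure lborel {s. g s \<noteq> 0}"
      using that by (intro emeasure_mono) auto
    then show ?thesis using g(2) by (simp add: less_top[symmetric] top_unique)
       (metis top.not_eq_extremum order_le_less_trans)
  qed
  have q: "fst ` set q \<subseteq> finite_sets_in S"
    unfolding q_def using fin gm S ys(1) by auto
  have val: "scalar_val q s = indicator S s * g s" for s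
  proof -
    have "scalar_val q s = (\<Sum>y\<leftarrow>ys. indicator (g -` {y} \<inter> S) s * y)"
      by (simp add: scalar_val_def q_def comp_def)
    also have "\<dots> = (\<Sum>y\<in>range g - {0}. indicator (g -` {y} \<inter> S) s * y)"
      using ys by (simp add: sum_list_distinct_conv_sum_set)
    also have "\<dots> = (\<Sum>y\<in>range g - {0}. if y = g s then indicator S s * g s else 0)"
      by (intro sum.cong) (auto split: split_indicator)
    also have "\<dots> = indicator S s * g s"
      using simple_functionD(1)[OF g(1)] by (simp add: sum.delta')
    finally show ?thesis .
  qed
  have "(\<integral>\<^sup>+s. ennreal (norm (f s - scalar_val q s)) \<partial>lborel) \<le> (\<integral>\<^sup>+s. ennreal (norm (f s - g s)) \<partial>lborel)"
    by (intro nn_integral_mono ennreal_leI) (auto simp: val zero split: split_indicator)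
  also have "\<dots> < ennreal e" using i by (simp add: g_def)
  finally show ?thesis using q by blast
qed

text \<open>The simple functions approximating \<open>F\<close> are obtained by truncating the Hermite expansion of \<open>F\<close>
  and replacing each of the remaining scalar coefficients by a simple function.\<close>

theorem has_L2_integralI:
  assumes S: "S \<in> sets lborel" and F: "\<And>s. s \<in> S \<Longrightarrow> F s \<in> L2" and I: "I \<in> L2"
    and int: "\<And>k. set_integrable lborel S (\<lambda>s. coef (F s) k)"
    and coef_I: "\<And>k. coef I k = (LINT s:S|lborel. coef (F s) k)"
    and w: "set_integrable lborel S w" "\<And>s. s \<in> S \<Longrightarrow> 0 \<le> w s"
    and bound: "\<And>s k. s \<in> S \<Longrightarrow> cmod (coef (F s) k) \<le> w s * r k"
    and r: "summable (\<lambda>k. (r k)\<^sup>2)"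
  shows "has_L2_integral S F I"
proof -
  define f where "f k s = indicator S s *\<^sub>R coef (F s) k" for k s
  have f: "integrable lborel (f k)" for k using int[of k] by (simp add: f_def[abs_def] set_integrable_def)
  have LINT_f: "(LINT s|lborel. f k s) = coef I k" for k
    by (simp add: coef_I f_def set_lebesgue_integral_def)
  \<comment> \<open>Chosen so that the total error of n scalar approximations, n * e n, still tends
    to 0.\<close>
  define e where "e n = (1 / (real n + 1))\<^sup>2" for n
  have e_pos: "e n > 0" for n by (simp add: e_def)
  define close where "close n k q \<longleftrightarrow> fst ` set q \<subseteq> finite_sets_in S \<and>
      (\<integral>\<^sup>+s. ennreal (norm (f k s - scalar_val q s)) \<partial>lborel) < ennreal (e n)" for n k q
  define q where "q n k = (SOME q. close n k q)" for n k
  have "\<exists>q. close n k q" for n k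
    unfolding close_def by (rule integrable_scalar_approximation[OF f S _ e_pos]) (simp add: f_def)
  then have "close n k (q n k)" for n k
    unfolding q_def by (rule someI_ex)
  then have q: "\<And>n k. fst ` set (q n k) \<subseteq> finite_sets_in S"
    and q_close: "\<And>n k. (\<integral>\<^sup>+s. ennreal (norm (f k s - scalar_val (q n k) s)) \<partial>lborel) < ennreal (e n)"
    unfolding close_def by blast+
  have hq: "integrable lborel (scalar_val (q n k))" "(LINT s|lborel. scalar_val (q n k) s) = scalar_int (q n k)" for n k
    using has_bochner_integral_scalar_val[OF q[of n k]] by (auto simp: has_bochner_integral_iff)
  have [measurable]: "f k \<in> borel_measurable borel" "scalar_val (q n k) \<in> borel_measurable borel" for n k
    using f hq by auto
  define block where "block n k = map (\<lambda>(A, y). (A, \<lambda>x. y * phi k x)) (q n k)" for n k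
  define p where "p n = concat (map (block n) [0..<n])" for n
  have simple_val_append: "simple_val (a @ b) s x = simple_val a s x + simple_val b s x" for a b s x
    by (simp add: simple_val_def)
  have simple_int_append: "simple_int (a @ b) x = simple_int a x + simple_int b x" for a b x
    by (simp add: simple_int_def)
  have block_val: "simple_val (block n k) s x = scalar_val (q n k) s * phi k x" for n k s x
    unfolding block_def by (induction "q n k") (auto simp: simple_val_def scalar_val_def comp_def case_prod_unfold sum_list_mult_const[symmetric] mult.assoc)
  have block_int: "simple_int (block n k) x = scalar_int (q n k) * phi k x" for n k x
    unfolding block_def by (induction "q n k") (auto simp: simple_int_def scalar_int_def comp_def case_prod_unfold sum_list_mult_const[symmetric] mult.assoc)
  have val_concat: "simple_val (concat (map (block n) [0..<m])) s x = (\<Sum>k<m. scalar_val (q n k) s * phi k x)" for n m s x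
    by (induction m) (simp_all add: simple_val_append block_val)
  have int_concat: "simple_int (concat (map (block n) [0..<m])) x = (\<Sum>k<m. scalar_int (q n k) * phi k x)" for n m x
    by (induction m) (simp_all add: simple_int_append block_int)
  have val_p: "simple_val (p n) s = (\<lambda>x. \<Sum>k<n. scalar_val (q n k) s * phi k x)" for n s
    unfolding p_def val_concat ..
  have int_p: "simple_int (p n) = (\<lambda>x. \<Sum>k<n. scalar_int (q n k) * phi k x)" for n
    unfolding p_def int_concat ..
  note comb_L2 = orthonormal_combination_L2[OF orthonormal_phi]
  have comb_coef: "coef (\<lambda>x. \<Sum>k<n. c k * phi k x) j = (if j < n then c j else 0)" for c n j
    using orthonormal_combination_inner[OF orthonormal_phi, of "{..<n}" c j] by simp
  have comb_norm: "L2_norm (\<lambda>x. \<Sum>k<n. c k * phi k x) \<le> (\<Sum>k<n. cmod (c k))" for c n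
    using L2_norm_sum_le[of "{..<n}" "\<lambda>k x. c k * phi k x"]
    by (simp add: L2_scale phi_L2 L2_norm_scale orthonormal_norm[OF orthonormal_phi])

  \<comment> \<open>Tails of the series of r_k^2; the separated bound w(s) r_k makes the truncation
    error at most w(s) sqrt (R n), integrable in s and small as n grows.\<close>
  define R where "R n = (\<Sum>k. if k < n then 0 else (r k)\<^sup>2)" for n
  have R_summable: "summable (\<lambda>k. if k < n then 0 else (r k)\<^sup>2)" for n
    by (rule summable_comparison_test'[OF r]) auto
  have R_lim: "R \<longlonglongrightarrow> 0"
    unfolding R_def
  proof (rule suminf_tendsto_0[OF _ _ r])
    show "(\<lambda>n. if k < n then 0 else (r k)\<^sup>2) \<longlonglongrightarrow> 0" for k
      by (rule tendsto_eventually) (use eventually_gt_at_top[of k] in eventually_elim, simp)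
  qed auto
  have R_nn: "0 \<le> R n" for n unfolding R_def by (intro suminf_nonneg R_summable) auto

  have tail: "L2_norm (\<lambda>x. F s x - (\<Sum>k<n. coef (F s) k * phi k x)) \<le> w s * sqrt (R n)" if s: "s \<in> S" for s n
  proof -
    have G: "(\<lambda>x. F s x - (\<Sum>k<n. coef (F s) k * phi k x)) \<in> L2" by (intro L2_diff F s comb_L2)
    have "(L2_norm (\<lambda>x. F s x - (\<Sum>k<n. coef (F s) k * phi k x)))\<^sup>2
        = (\<Sum>k. (cmod (if k < n then 0 else coef (F s) k))\<^sup>2)"
      unfolding L2_norm_square_coef[OF G]
      by (simp add: coef_diff F s comb_L2 comb_coef) (intro suminf_cong, simp)
    also have "\<dots> \<le> (\<Sum>k. (w s)\<^sup>2 * (if k < n then 0 else (r k)\<^sup>2))"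
    proof (rule suminf_le)
      show "(cmod (if k < n then 0 else coef (F s) k))\<^sup>2 \<le> (w s)\<^sup>2 * (if k < n then 0 else (r k)\<^sup>2)" for k
        using power_mono[OF bound[OF s, of k], of 2] by (simp add: power_mult_distrib)
      show "summable (\<lambda>k. (cmod (if k < n then 0 else coef (F s) k))\<^sup>2)"
        by (rule summable_comparison_test'[OF coef_Bessel(1)[OF F[OF s]]]) auto
    qed (intro summable_mult R_summable)
    also have "\<dots> = (w s * sqrt (R n))\<^sup>2"
      unfolding suminf_mult[OF R_summable] by (simp add: R_def[symmetric] power_mult_distrib R_nn)
    finally show ?thesis by (rule power2_le_imp_le) (simp add: w(2)[OF s] R_nn)
  qed

  have 1: "set_borel_measurable lborel S (\<lambda>s. L2_norm (\<lambda>x. F s x - simple_val (p n) s x))" for n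
  proof -
    have [measurable]: "S \<in> sets borel" using S by simp
    \<comment> \<open>Measurability of the norm in s: Parseval writes it as the root of a series of
      measurable scalar functions.\<close>
    have eq: "indicator S s *\<^sub>R L2_norm (\<lambda>x. F s x - simple_val (p n) s x)
      = sqrt (\<Sum>k. (cmod (f k s - (if k < n then indicator S s *\<^sub>R scalar_val (q n k) s else 0)))\<^sup>2)" for s
    proof (cases "s \<in> S")
      case True
      have G: "(\<lambda>x. F s x - simple_val (p n) s x) \<in> L2" unfolding val_p by (intro L2_diff F True comb_L2)
      have "(L2_norm (\<lambda>x. F s x - simple_val (p n) s x))\<^sup>2
        = (\<Sum>k. (cmod (f k s - (if k < n then indicator S s *\<^sub>R scalar_val (q n k) s else 0)))\<^sup>2)"
        unfolding L2_norm_square_coef[OF G] using True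
        by (simp add: val_p coef_diff F comb_L2 comb_coef f_def cong: if_cong)
      then show ?thesis using True by (simp flip: \<open>(L2_norm (\<lambda>x. F s x - simple_val (p n) s x))\<^sup>2 = _\<close>)
    qed (simp add: f_def cong: if_cong)
    show ?thesis unfolding set_borel_measurable_def eq by measurable
  qed

  have 2: "(\<lambda>n. \<integral>\<^sup>+s\<in>S. ennreal (L2_norm (\<lambda>x. F s x - simple_val (p n) s x)) \<partial>lborel) \<longlonglongrightarrow> 0"
  proof -
    define W where "W = (LINT s|lborel. indicator S s *\<^sub>R w s)"
    have W: "(\<integral>\<^sup>+s. ennreal (indicator S s *\<^sub>R w s) \<partial>lborel) = ennreal W" and W_nn: "0 \<le> W"
      unfolding W_def using w
      by (auto simp: set_integrable_def intro!: nn_integral_eq_integral Bochner_Integration.integral_nonneg split: split_indicator)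
    have le: "(\<integral>\<^sup>+s\<in>S. ennreal (L2_norm (\<lambda>x. F s x - simple_val (p n) s x)) \<partial>lborel)
        \<le> ennreal (sqrt (R n) * W + real n * e n)" for n
    proof -
      have "(\<integral>\<^sup>+s\<in>S. ennreal (L2_norm (\<lambda>x. F s x - simple_val (p n) s x)) \<partial>lborel)
        \<le> (\<integral>\<^sup>+s. ennreal (sqrt (R n)) * ennreal (indicator S s *\<^sub>R w s) + (\<Sum>k<n. ennreal (norm (f k s - scalar_val (q n k) s))) \<partial>lborel)"
      proof (rule nn_integral_mono)
        fix s
        show "ennreal (L2_norm (\<lambda>x. F s x - simple_val (p n) s x)) * indicator S s
          \<le> ennreal (sqrt (R n)) * ennreal (indicator S s *\<^sub>R w s) + (\<Sum>k<n. ennreal (norm (f k s - scalar_val (q n k) s)))"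
        proof (cases "s \<in> S")
          case True
          have "L2_norm (\<lambda>x. F s x - simple_val (p n) s x)
            \<le> L2_norm (\<lambda>x. F s x - (\<Sum>k<n. coef (F s) k * phi k x))
              + L2_norm (\<lambda>x. (\<Sum>k<n. coef (F s) k * phi k x) - (\<Sum>k<n. scalar_val (q n k) s * phi k x))"
            unfolding val_p by (intro L2_norm_diff_triangle F True comb_L2)
          also have "(\<lambda>x. (\<Sum>k<n. coef (F s) k * phi k x) - (\<Sum>k<n. scalar_val (q n k) s * phi k x))
            = (\<lambda>x. \<Sum>k<n. (f k s - scalar_val (q n k) s) * phi k x)"
            using True by (simp add: f_def sum_subtractf left_diff_distrib)
          also have "L2_norm (\<lambda>x. F s x - (\<Sum>k<n. coef (F s) k * phi k x)) + L2_norm \<dots>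
            \<le> w s * sqrt (R n) + (\<Sum>k<n. norm (f k s - scalar_val (q n k) s))"
            by (intro add_mono tail True comb_norm)
          finally have "ennreal (L2_norm (\<lambda>x. F s x - simple_val (p n) s x))
            \<le> ennreal (sqrt (R n) * w s + (\<Sum>k<n. norm (f k s - scalar_val (q n k) s)))"
            by (intro ennreal_leI) (simp add: mult.commute)
          also have "\<dots> = ennreal (sqrt (R n)) * ennreal (w s) + (\<Sum>k<n. ennreal (norm (f k s - scalar_val (q n k) s)))"
            using w(2)[OF True] R_nn by (simp add: ennreal_plus ennreal_mult sum_nonneg sum_ennreal)
          finally show ?thesis using True by simp
        qed simp
      qed
      also have "\<dots> = ennreal (sqrt (R n)) * ennreal W + (\<Sum>k<n. \<integral>\<^sup>+s. ennreal (norm (f k s - scalar_val (q n k) s)) \<partial>lborel)"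
      proof -
        have [measurable]: "(\<lambda>s. indicator S s *\<^sub>R w s) \<in> borel_measurable lborel"
          using w(1) unfolding set_integrable_def by (rule borel_measurable_integrable)
        show ?thesis
          by (subst nn_integral_add, measurable, subst nn_integral_cmult, measurable,
              subst nn_integral_sum, measurable) (simp only: W)
      qed
      also have "\<dots> \<le> ennreal (sqrt (R n)) * ennreal W + (\<Sum>k<n. ennreal (e n))"
        by (intro add_left_mono sum_mono less_imp_le q_close)
      also have "\<dots> = ennreal (sqrt (R n) * W + real n * e n)"
        using W_nn R_nn e_pos[of n] by (simp add: ennreal_plus ennreal_mult ennreal_of_nat_eq_real_of_nat less_imp_le)
      finally show ?thesis .
    qed
    have "(\<lambda>n. real n * e n) \<longlonglongrightarrow> 0" unfolding e_def by real_asymp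
    then have lim: "(\<lambda>n. ennreal (sqrt (R n) * W + real n * e n)) \<longlonglongrightarrow> ennreal (sqrt 0 * W + 0)"
      by (intro tendsto_ennrealI tendsto_intros R_lim)
    show ?thesis
    proof (rule tendsto_sandwich[OF _ always_eventually tendsto_const])
      show "\<forall>n. (\<integral>\<^sup>+s\<in>S. ennreal (L2_norm (\<lambda>x. F s x - simple_val (p n) s x)) \<partial>lborel)
        \<le> ennreal (sqrt (R n) * W + real n * e n)" by (intro allI le)
      show "(\<lambda>n. ennreal (sqrt (R n) * W + real n * e n)) \<longlonglongrightarrow> 0" using lim by simp
    qed simp
  qed

  have 3: "(\<lambda>n. L2_norm (\<lambda>x. simple_int (p n) x - I x)) \<longlonglongrightarrow> 0"
  proof (rule Lim_null_comparison[OF always_eventually], rule allI)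
    fix n
    have J: "cmod (scalar_int (q n k) - coef I k) \<le> e n" for k
    proof -
      have "scalar_int (q n k) - coef I k = (LINT s|lborel. scalar_val (q n k) s - f k s)"
        using hq f LINT_f by simp
      also have "ennreal (cmod \<dots>) \<le> (\<integral>\<^sup>+s. norm (scalar_val (q n k) s - f k s) \<partial>lborel)"
        using hq f by (intro integral_norm_bound_ennreal) auto
      also have "\<dots> \<le> ennreal (e n)"
        using q_close[where n=n and k=k] by (simp add: norm_minus_commute less_imp_le)
      finally show ?thesis using e_pos[of n] by simp
    qed
    have "L2_norm (\<lambda>x. simple_int (p n) x - I x)
      \<le> L2_norm (\<lambda>x. (\<Sum>k<n. scalar_int (q n k) * phi k x) - (\<Sum>k<n. coef I k * phi k x))
        + L2_norm (\<lambda>x. (\<Sum>k<n. coef I k * phi k x) - I x)"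
      unfolding int_p by (intro L2_norm_diff_triangle I comb_L2)
    also have "(\<lambda>x. (\<Sum>k<n. scalar_int (q n k) * phi k x) - (\<Sum>k<n. coef I k * phi k x))
        = (\<lambda>x. \<Sum>k<n. (scalar_int (q n k) - coef I k) * phi k x)"
      by (simp add: sum_subtractf left_diff_distrib)
    also have "L2_norm \<dots> \<le> (\<Sum>k<n. e n)"
      by (rule order_trans[OF comb_norm]) (intro sum_mono J)
    finally show "norm (L2_norm (\<lambda>x. simple_int (p n) x - I x))
        \<le> real n * e n + L2_norm (\<lambda>x. (\<Sum>k<n. coef I k * phi k x) - I x)" by simp
  next
    have "(\<lambda>n. real n * e n) \<longlonglongrightarrow> 0" unfolding e_def by real_asymp
    then show "(\<lambda>n. real n * e n + L2_norm (\<lambda>x. (\<Sum>k<n. coef I k * phi k x) - I x)) \<longlonglongrightarrow> 0"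
      using complete_orthonormal_expansion[OF complete_orthonormal_phi I]
      by (rule tendsto_add_zero)
  qed

  have 4: "set (p n) \<subseteq> finite_sets_in S \<times> L2" for n
  proof -
    have "set (block n k) \<subseteq> finite_sets_in S \<times> L2" for k
      using q[of n k] by (fastforce simp: block_def intro: L2_scale phi_L2)
    then show ?thesis unfolding p_def by auto
  qed
  show ?thesis unfolding has_L2_integral_def using F I 1 2 3 4 by blast
qed

section \<open>Coefficients of the source\<close>

definition half_line_coef :: "real \<Rightarrow> nat \<Rightarrow> real" where
  "half_line_coef a k = (LINT x|lborel. indicator {a..} x * (hermite_fun k x * hermite_fun 0 x))"

lemma half_line_coef_Suc: "ladder (Suc j) * half_line_coef a (Suc j) = hermite_fun j a * hermite_fun 0 a"
  unfolding half_line_coef_def by (rule hermite_fun_half_line)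

lemma half_line_integrable: "integrable lborel (\<lambda>x. indicator {a..} x * (hermite_fun k x * hermite_fun 0 x))"
  using integrable_mult_indicator[OF _ hermite_fun_mult_integrable[of k 0], of "{a..}"] by simp

text \<open>The square of phi_0 is positive on [a, a + 1], which is not a null set. Thus mode 0 is
  always excited, in contrast to the other modes.\<close>

lemma half_line_coef_0_pos: "half_line_coef a 0 > 0"
proof -
  define f where "f x = indicator {a..} x * (hermite_fun 0 x * hermite_fun 0 x)" for x
  have f: "integrable lborel f" unfolding f_def by (rule half_line_integrable)
  have nn: "0 \<le> f x" for x by (simp add: f_def)
  have "(LINT x|lborel. f x) \<noteq> 0"
  proof
    assume "(LINT x|lborel. f x) = 0"
    then have "AE x in lborel. f x = 0"
      using integral_nonneg_eq_0_iff_AE[OF f] nn by simp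
    then have "AE x in lborel. x \<notin> {a..a+1}"
    proof eventually_elim
      case (elim x)
      then show ?case using hermite_fun_0_pos[of x] by (auto simp: f_def indicator_def)
    qed
    then have "{a..a+1} \<in> null_sets lborel"
      by (subst (asm) AE_iff_null_sets[symmetric]) auto
    then show False by (auto simp: null_sets_def)
  qed
  moreover have "0 \<le> (LINT x|lborel. f x)" using nn by (intro Bochner_Integration.integral_nonneg) auto
  ultimately have "(LINT x|lborel. f x) > 0" by linarith
  then show ?thesis by (simp only: half_line_coef_def f_def)
qed

lemma half_line_coef_eq_0_iff: "half_line_coef a (Suc j) = 0 \<longleftrightarrow> hermite_fun j a = 0"
  using half_line_coef_Suc[of j a] ladder_pos[of j] hermite_fun_0_pos[of a]
  by (metis less_irrefl mult_eq_0_iff)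

lemma half_line_coef_Suc_square:
  "(half_line_coef a (Suc j))\<^sup>2 = (hermite_fun j a)\<^sup>2 * (hermite_fun 0 a)\<^sup>2 / (2 * real (Suc j))"
proof -
  have "(ladder (Suc j) * half_line_coef a (Suc j))\<^sup>2 = (hermite_fun j a * hermite_fun 0 a)\<^sup>2"
    by (simp only: half_line_coef_Suc)
  moreover have "(ladder (Suc j))\<^sup>2 = 2 * real (Suc j)"
    using ladder_square[of "Suc j"] by (simp only: power2_eq_square)
  ultimately have "2 * real (Suc j) * (half_line_coef a (Suc j))\<^sup>2 = (hermite_fun j a)\<^sup>2 * (hermite_fun 0 a)\<^sup>2"
    by (simp only: power_mult_distrib)
  then show ?thesis by (simp add: field_simps)
qed

text \<open>mu phi_0, the spatial profile of the source; at each time the source is a scalar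
  multiple of it.\<close>

definition half_line_state :: "real \<Rightarrow> real \<Rightarrow> complex" where
  "half_line_state a x = indicator {a..} x * phi 0 x"

lemma half_line_state_L2: "half_line_state a \<in> L2"
  by (rule L2_bound[where f="phi 0" and C=1])
     (auto simp: half_line_state_def[abs_def] phi_L2 intro!: always_eventually split: split_indicator)

lemma coef_half_line_state: "coef (half_line_state a) k = complex_of_real (half_line_coef a k)"
proof -
  have "coef (half_line_state a) k = (LINT x|lborel. complex_of_real (indicator {a..} x * (hermite_fun k x * hermite_fun 0 x)))"
    unfolding coef_LINT by (intro Bochner_Integration.integral_cong)
      (auto simp: half_line_state_def phi_def split: split_indicator)
  then show ?thesis by (simp only: integral_complex_of_real half_line_coef_def)
qed

text \<open>Bessel's inequality for the truncated ground state.\<close>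

lemma half_line_coef_summable: "summable (\<lambda>k. (\<bar>half_line_coef a k\<bar>)\<^sup>2)"
  using coef_Bessel(1)[OF half_line_state_L2, of a] by (simp add: coef_half_line_state)

lemma half_line_coef_le_1: "\<bar>half_line_coef a k\<bar> \<le> 1"
proof -
  have "(L2_norm (half_line_state a))\<^sup>2 \<le> (L2_norm (phi 0))\<^sup>2"
    unfolding L2_norm_square
    by (intro integral_mono L2_square_integrable half_line_state_L2 phi_L2)
       (auto simp: half_line_state_def split: split_indicator)
  then have "L2_norm (half_line_state a) \<le> 1"
    using orthonormal_norm[OF orthonormal_phi, of 0] by (simp add: abs_square_le_1)
  then show ?thesis
    using coef_le_norm[OF half_line_state_L2, of a k] by (simp add: coef_half_line_state)
qed

lemma ground_state_eq: "ground_state s = (\<lambda>x. iexp (- s) * phi 0 x)"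
  by (simp add: ground_state_def eigval_def)

lemma source_eq: "source a u s = (\<lambda>x. (complex_of_real (u s) * iexp (- s)) * half_line_state a x)"
  by (simp add: source_def ground_state_eq half_line_state_def fun_eq_iff)

lemma source_L2: "source a u s \<in> L2"
  unfolding source_eq by (intro L2_scale half_line_state_L2)

text \<open>The phases combine through lambda_k (t - s) + s = lambda_k t - 2 k s: the dependence on
  t factors out, and the integral over s is a moment of the control.\<close>

lemma coef_propagator_source:
  "coef (propagator (t - s) (source a u s)) k
    = complex_of_real (half_line_coef a k) * iexp (- (eigval k * t)) * (complex_of_real (u s) * iexp (2 * real k * s))"
proof -
  have "iexp (- (eigval k * (t - s))) * iexp (- s) = iexp (- (eigval k * t)) * iexp (2 * real k * s)"
    unfolding exp_add[symmetric] by (simp add: eigval_def algebra_simps)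
  then show ?thesis
    unfolding propagator_coef[OF source_L2] unfolding source_eq L2_inner_scale_left coef_half_line_state
    by (simp add: mult_ac)
qed

section \<open>Trigonometric moments\<close>

text \<open>(0, N pi] contains a whole number of periods of exp(2 i n s), so the boundary terms of
  the primitive cancel for n different from 0.\<close>

lemma LINT_iexp_period:
  fixes n :: int
  shows "(LINT s|lborel. indicator {0<..real N * pi} s *\<^sub>R iexp (2 * real_of_int n * s)) = (if n = 0 then of_real (real N * pi) else 0)"
proof -
  have "(LINT s|lborel. indicator {0<..real N * pi} s *\<^sub>R iexp (2 * real_of_int n * s))
      = (LINT s|lborel. indicator {0..real N * pi} s *\<^sub>R iexp (2 * real_of_int n * s))"
  proof (rule integral_cong_AE)
    show "AE s in lborel. indicator {0<..real N * pi} s *\<^sub>R iexp (2 * real_of_int n * s)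
        = indicator {0..real N * pi} s *\<^sub>R iexp (2 * real_of_int n * s)"
      using AE_lborel_singleton[of 0] by eventually_elim (auto simp: indicator_def)
  qed measurable
  also have "\<dots> = (if n = 0 then of_real (real N * pi) else 0)"
  proof (cases "n = 0")
    case False
    define c where "c = \<i> * complex_of_real (2 * real_of_int n)"
    have c: "c \<noteq> 0" using False by (simp add: c_def)
    have "(LINT s|lborel. indicator {0..real N * pi} s *\<^sub>R iexp (2 * real_of_int n * s))
      = iexp (2 * real_of_int n * (real N * pi)) / c - iexp (2 * real_of_int n * 0) / c"
    proof (rule integral_FTC_atLeastAtMost)
      show "((\<lambda>s. iexp (2 * real_of_int n * s) / c) has_vector_derivative iexp (2 * real_of_int n * x)) (at x within {0..real N * pi})" for x
        using has_vector_derivative_divide[OF has_vector_derivative_iexp[of "2 * real_of_int n" x], of c] c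
        by (auto simp: c_def intro: has_vector_derivative_at_within)
      show "continuous_on {0..real N * pi} (\<lambda>s. iexp (2 * real_of_int n * s))"
        by (intro continuous_intros)
    qed simp
    also have "iexp (2 * real_of_int n * (real N * pi)) = 1"
    proof -
      have "iexp (2 * real_of_int n * (real N * pi)) = exp (2 * of_int (n * int N) * pi * \<i>)"
        by (simp add: mult_ac)
      also have "\<dots> = 1" by (rule exp_integer_2pi) simp
      finally show ?thesis .
    qed
    finally show ?thesis using False by simp
  qed (simp add: scaleR_conv_of_real)
  finally show ?thesis .
qed

text \<open>The frequencies are negative because \<open>L2_inner\<close> conjugates its second
  argument; inner products with \<open>trig N k\<close> are then moments with exp(2 i k s), up to
  the normalizing factor for N periods.\<close>

definition trig :: "nat \<Rightarrow> nat \<Rightarrow> real \<Rightarrow> complex" where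
  "trig N k s = indicator {0<..real N * pi} s * (iexp (- (2 * real k * s)) / of_real (sqrt (real N * pi)))"

lemma bounded_support_L2:
  assumes g: "g \<in> borel_measurable borel" and bound: "\<And>s. cmod (g s) \<le> indicator {a..b} s * C"
  shows "g \<in> L2"
proof -
  have "integrable lborel (\<lambda>x. (cmod (g x))\<^sup>2)"
  proof (rule Bochner_Integration.integrable_bound)
    show "integrable lborel (\<lambda>s. indicator {a..b} s *\<^sub>R C\<^sup>2)"
      by (rule integrable_indicator) (auto simp: emeasure_lborel_Icc_eq)
    have "(indicator {a..b} s)\<^sup>2 = (indicator {a..b} s :: real)" for s by (simp split: split_indicator)
    then have "(cmod (g s))\<^sup>2 \<le> indicator {a..b} s * C\<^sup>2" for s
      using power_mono[OF bound[of s], of 2] by (simp add: power_mult_distrib)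
    then show "AE s in lborel. norm ((cmod (g s))\<^sup>2) \<le> norm (indicator {a..b} s *\<^sub>R C\<^sup>2)"
      by (intro always_eventually) simp
  qed (use g in measurable)
  then show ?thesis using g by (simp add: L2_def)
qed

lemma trig_L2: "trig N k \<in> L2"
  by (rule bounded_support_L2[where a=0 and b="real N * pi" and C="1 / sqrt (real N * pi)"])
     (auto simp: trig_def[abs_def] norm_mult norm_divide split: split_indicator)

lemma LINT_iexp_period_normalized:
  assumes N: "N > 0"
  shows "(LINT s|lborel. indicator {0<..real N * pi} s *\<^sub>R iexp (2 * real_of_int n * s)) / of_real (real N * pi) = (if n = 0 then 1 else 0)"
  unfolding LINT_iexp_period using N by simp

lemma orthonormal_trig:
  assumes N: "N > 0"
  shows "orthonormal (trig N)"
proof -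
  have sq: "complex_of_real (sqrt (real N * pi)) * complex_of_real (sqrt (real N * pi)) = of_real (real N * pi)"
    by (simp flip: of_real_mult)
  have "L2_inner (trig N j) (trig N k) = (if j = k then 1 else 0)" for j k
  proof -
    have "trig N j s * cnj (trig N k s)
        = indicator {0<..real N * pi} s *\<^sub>R iexp (2 * real_of_int (int k - int j) * s) / of_real (real N * pi)" for s
    proof -
      have "iexp (- (2 * real j * s)) * iexp (2 * real k * s) = iexp (2 * real_of_int (int k - int j) * s)"
        unfolding exp_add[symmetric] by (simp add: algebra_simps)
      moreover have "cnj (iexp (- (2 * real k * s))) = iexp (2 * real k * s)" by (simp add: exp_cnj)
      ultimately show ?thesis
        by (simp add: trig_def sq times_divide_times_eq split: split_indicator)
    qed
    then have "L2_inner (trig N j) (trig N k)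
        = (LINT s|lborel. indicator {0<..real N * pi} s *\<^sub>R iexp (2 * real_of_int (int k - int j) * s)) / of_real (real N * pi)"
      unfolding L2_inner_def by (simp only: integral_divide_zero)
    then show ?thesis unfolding LINT_iexp_period_normalized[OF N] by auto
  qed
  then show ?thesis by (simp add: orthonormal_def trig_L2)
qed

text \<open>The product has frequency -2(j + k), which is 0 only for j = k = 0. This is why a
  conjugate added to make the control real changes only the moment of index 0.\<close>

lemma trig_inner_cnj:
  assumes N: "N > 0"
  shows "L2_inner (trig N j) (\<lambda>s. cnj (trig N k s)) = (if j = 0 \<and> k = 0 then 1 else 0)"
proof -
  have sq: "complex_of_real (sqrt (real N * pi)) * complex_of_real (sqrt (real N * pi)) = of_real (real N * pi)"
    by (simp flip: of_real_mult)
  have "trig N j s * cnj (cnj (trig N k s))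
      = indicator {0<..real N * pi} s *\<^sub>R iexp (2 * real_of_int (- int k - int j) * s) / of_real (real N * pi)" for s
  proof -
    have "iexp (- (2 * real j * s)) * iexp (- (2 * real k * s)) = iexp (2 * real_of_int (- int k - int j) * s)"
      unfolding exp_add[symmetric] by (rule arg_cong[where f=exp]) (simp add: algebra_simps)
    then show ?thesis
      by (simp add: trig_def sq times_divide_times_eq split: split_indicator)
  qed
  then have "L2_inner (trig N j) (\<lambda>s. cnj (trig N k s))
      = (LINT s|lborel. indicator {0<..real N * pi} s *\<^sub>R iexp (2 * real_of_int (- int k - int j) * s)) / of_real (real N * pi)"
    unfolding L2_inner_def by (simp only: integral_divide_zero)
  then show ?thesis unfolding LINT_iexp_period_normalized[OF N] by auto
qed

definition control_part :: "(real \<Rightarrow> real) \<Rightarrow> real \<Rightarrow> real \<Rightarrow> complex" where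
  "control_part u t s = complex_of_real (indicator {0<..<t} s * u s)"

definition moment :: "(real \<Rightarrow> real) \<Rightarrow> nat \<Rightarrow> real \<Rightarrow> complex" where
  "moment u k t = (LINT s:{0<..<t}|lborel. complex_of_real (u s) * iexp (2 * real k * s))"

text \<open>\<open>u\<close> is unrestricted outside (0, T), so the cutoff at T is the member of L2;
  the cutoff at an earlier t is a further truncation of it.\<close>

lemma control_part_L2:
  assumes u: "u \<in> L2_real_on 0 T" and t: "t \<le> T"
  shows "control_part u t \<in> L2"
proof -
  have CT: "control_part u T \<in> L2"
  proof -
    have "(\<lambda>s. indicator {0<..<T} s *\<^sub>R u s) \<in> borel_measurable lborel"
      using u unfolding L2_real_on_def set_borel_measurable_def by blast
    then have "control_part u T \<in> borel_measurable lborel"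
      unfolding control_part_def[abs_def] real_scaleR_def
      by (rule measurable_compose[OF _ borel_measurable_of_real])
    moreover have "integrable lborel (\<lambda>s. (cmod (control_part u T s))\<^sup>2)"
    proof -
      have "integrable lborel (\<lambda>s. indicator {0<..<T} s *\<^sub>R (u s)\<^sup>2)"
        using u by (simp add: L2_real_on_def set_integrable_def)
      moreover have "(\<lambda>s. indicator {0<..<T} s *\<^sub>R (u s)\<^sup>2) = (\<lambda>s. (cmod (control_part u T s))\<^sup>2)"
        by (auto simp: control_part_def fun_eq_iff split: split_indicator)
      ultimately show ?thesis by simp
    qed
    ultimately show ?thesis by (simp add: L2_def)
  qed
  have eq: "control_part u t = (\<lambda>s. indicator {..<t} s * control_part u T s)"
    using t by (auto simp: control_part_def fun_eq_iff split: split_indicator)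
  have [measurable]: "control_part u T \<in> borel_measurable borel" using CT by (rule L2_measurable_borel)
  show ?thesis
  proof (rule L2_bound[OF _ CT])
    show "control_part u t \<in> borel_measurable lborel" unfolding eq by measurable
    show "AE s in lborel. cmod (control_part u t s) \<le> 1 * cmod (control_part u T s)"
      unfolding eq by (intro always_eventually) (auto simp: norm_mult split: split_indicator)
  qed
qed

lemma control_iexp_integrable:
  assumes u: "u \<in> L2_real_on 0 T" and t: "t \<le> T"
  shows "set_integrable lborel {0<..<t} (\<lambda>s. complex_of_real (u s) * iexp (c * s))"
proof -
  have "(\<lambda>s. complex_of_real (indicator {0<..<t} s) * iexp (c * s)) \<in> L2"
    by (rule bounded_support_L2[where a=0 and b=t and C=1]) (auto simp: norm_mult split: split_indicator)
  then have "integrable lborel (\<lambda>s. control_part u t s * (complex_of_real (indicator {0<..<t} s) * iexp (c * s)))"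
    by (intro L2_mult_integrable control_part_L2[OF u t])
  also have "(\<lambda>s. control_part u t s * (complex_of_real (indicator {0<..<t} s) * iexp (c * s)))
      = (\<lambda>s. indicator {0<..<t} s *\<^sub>R (complex_of_real (u s) * iexp (c * s)))"
    by (auto simp: control_part_def fun_eq_iff split: split_indicator)
  finally show ?thesis by (simp add: set_integrable_def)
qed

lemma control_integrable:
  assumes u: "u \<in> L2_real_on 0 T" and t: "t \<le> T"
  shows "set_integrable lborel {0<..<t} (\<lambda>s. \<bar>u s\<bar>)"
proof -
  have "set_integrable lborel {0<..<t} (\<lambda>s. norm (complex_of_real (u s) * iexp (0 * s)))"
    by (intro set_integrable_norm control_iexp_integrable[OF u t])
  then show ?thesis by simp
qed

lemma moment_eq_inner:
  assumes t: "t \<le> real N * pi" and N: "N > 0"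
  shows "L2_inner (control_part u t) (trig N k) = moment u k t / of_real (sqrt (real N * pi))"
proof -
  have "control_part u t s * cnj (trig N k s)
      = indicator {0<..<t} s *\<^sub>R (complex_of_real (u s) * iexp (2 * real k * s)) / of_real (sqrt (real N * pi))" for s
  proof -
    have "cnj (iexp (- (2 * real k * s))) = iexp (2 * real k * s)" by (simp add: exp_cnj)
    then show ?thesis using t
      by (simp add: control_part_def trig_def split: split_indicator)
  qed
  then show ?thesis
    unfolding L2_inner_def moment_def set_lebesgue_integral_def by (simp only: integral_divide_zero)
qed

text \<open>Bessel's inequality for the difference of two cutoffs, both supported in (0, N pi); the
  factor N pi undoes the normalization of \<open>trig\<close>. It gives summability and continuity
  in time together.\<close>

lemma moment_diff_Bessel:
  assumes u: "u \<in> L2_real_on 0 T" and s: "s \<le> T" and t: "t \<le> T" and N: "N > 0" "T \<le> real N * pi"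
  shows "summable (\<lambda>k. (cmod (moment u k s - moment u k t))\<^sup>2)"
    and "(\<Sum>k. (cmod (moment u k s - moment u k t))\<^sup>2)
      \<le> real N * pi * (L2_norm (\<lambda>x. control_part u s x - control_part u t x))\<^sup>2"
proof -
  note P = control_part_L2[OF u s] control_part_L2[OF u t]
  define d where "d x = control_part u s x - control_part u t x" for x
  have d: "d \<in> L2" unfolding d_def using P by (rule L2_diff)
  have "L2_inner d (trig N k) = (moment u k s - moment u k t) / of_real (sqrt (real N * pi))" for k
    unfolding d_def using s t N
    by (simp add: L2_inner_diff_left P trig_L2 moment_eq_inner diff_divide_distrib)
  then have eq: "(cmod (moment u k s - moment u k t))\<^sup>2 = real N * pi * (cmod (L2_inner d (trig N k)))\<^sup>2" for k
    using N by (simp add: norm_divide power_divide)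
  note B = Bessel[OF orthonormal_trig[OF N(1)] d]
  show "summable (\<lambda>k. (cmod (moment u k s - moment u k t))\<^sup>2)"
    unfolding eq by (intro summable_mult B)
  show "(\<Sum>k. (cmod (moment u k s - moment u k t))\<^sup>2)
      \<le> real N * pi * (L2_norm (\<lambda>x. control_part u s x - control_part u t x))\<^sup>2"
    unfolding eq suminf_mult[OF B(1)] using B(2) by (intro mult_left_mono) (auto simp: d_def[abs_def])
qed

lemma moment_summable:
  assumes u: "u \<in> L2_real_on 0 T" and t: "0 \<le> t" "t \<le> T"
  shows "summable (\<lambda>k. (cmod (moment u k t))\<^sup>2)"
proof -
  obtain N where N: "max 1 (T / pi) < real N" using reals_Archimedean2 by blast
  \<comment> \<open>At time 0 the interval of integration is empty and all moments vanish.\<close>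
  have "summable (\<lambda>k. (cmod (moment u k t - moment u k 0))\<^sup>2)"
    using N t by (intro moment_diff_Bessel(1)[OF u, of t 0 N]) (auto simp: field_simps)
  then show ?thesis by (simp add: moment_def set_lebesgue_integral_def)
qed

text \<open>Dominated convergence along sequences: away from the null set {t} the two cutoffs
  eventually coincide at each point, and the cutoff at T dominates both.\<close>

lemma control_part_tendsto:
  assumes u: "u \<in> L2_real_on 0 T" and t: "t \<in> {0..T}"
  shows "((\<lambda>s. (L2_norm (\<lambda>x. control_part u s x - control_part u t x))\<^sup>2) \<longlongrightarrow> 0) (at t within {0..T})"
  unfolding tendsto_at_iff_sequentially comp_def
proof (intro allI impI)
  fix r assume r: "\<forall>i. r i \<in> {0..T} - {t}" and r_lim: "r \<longlonglongrightarrow> t"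
  have P: "control_part u s \<in> L2" if "s \<le> T" for s using control_part_L2[OF u that] .
  have d: "(\<lambda>x. control_part u (r i) x - control_part u t x) \<in> L2" for i
    using r t by (intro L2_diff P) auto
  have "(\<lambda>i. LINT x|lborel. (cmod (control_part u (r i) x - control_part u t x))\<^sup>2) \<longlonglongrightarrow> (LINT x|(lborel :: real measure). (0::real))"
  proof (rule integral_dominated_convergence)
    show "integrable lborel (\<lambda>x. (cmod (control_part u T x))\<^sup>2)" by (intro L2_square_integrable P) simp
    show "(\<lambda>x. (cmod (control_part u (r i) x - control_part u t x))\<^sup>2) \<in> borel_measurable lborel" for i
      using L2_square_integrable[OF d] by (rule borel_measurable_integrable)
    show "AE x in lborel. norm ((cmod (control_part u (r i) x - control_part u t x))\<^sup>2) \<le> (cmod (control_part u T x))\<^sup>2" for i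
    proof -
      have "r i \<le> T" using r by simp
      then show ?thesis
        using t by (intro always_eventually) (auto simp: control_part_def split: split_indicator)
    qed
    show "AE x in lborel. (\<lambda>i. (cmod (control_part u (r i) x - control_part u t x))\<^sup>2) \<longlonglongrightarrow> 0"
      using AE_lborel_singleton[of t]
    proof eventually_elim
      case (elim x)
      have "\<forall>\<^sub>F i in sequentially. indicator {0<..<r i} x = (indicator {0<..<t} x :: real)"
      proof (cases "x < t")
        case True
        then have "\<forall>\<^sub>F i in sequentially. x < r i" using r_lim by (intro order_tendstoD(1))
        then show ?thesis by eventually_elim (use True in \<open>auto simp: indicator_def\<close>)
      next
        case False
        then have "t < x" using elim by simp
        then have "\<forall>\<^sub>F i in sequentially. r i < x" using r_lim by (intro order_tendstoD(2))
        then show ?thesis by eventually_elim (use False in \<open>auto simp: indicator_def\<close>)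
      qed
      then have "\<forall>\<^sub>F i in sequentially. (cmod (control_part u (r i) x - control_part u t x))\<^sup>2 = 0"
        by eventually_elim (simp add: control_part_def)
      then show ?case by (rule tendsto_eventually)
    qed
  qed simp
  then show "(\<lambda>i. (L2_norm (\<lambda>x. control_part u (r i) x - control_part u t x))\<^sup>2) \<longlonglongrightarrow> 0"
    by (simp add: L2_norm_square)
qed

lemma moment_continuous:
  assumes u: "u \<in> L2_real_on 0 T" and t: "t \<in> {0..T}"
  shows "((\<lambda>s. \<Sum>k. (cmod (moment u k s - moment u k t))\<^sup>2) \<longlongrightarrow> 0) (at t within {0..T})"
proof -
  obtain N where N: "max 1 (T / pi) < real N" using reals_Archimedean2 by blast
  have N': "N > 0" "T \<le> real N * pi" using N by (auto simp: field_simps)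
  show ?thesis
  proof (rule Lim_null_comparison)
    show "\<forall>\<^sub>F s in at t within {0..T}. norm (\<Sum>k. (cmod (moment u k s - moment u k t))\<^sup>2)
        \<le> real N * pi * (L2_norm (\<lambda>x. control_part u s x - control_part u t x))\<^sup>2"
      unfolding eventually_at_filter
    proof (intro always_eventually allI impI)
      fix s assume s: "s \<in> {0..T}"
      then show "norm (\<Sum>k. (cmod (moment u k s - moment u k t))\<^sup>2)
        \<le> real N * pi * (L2_norm (\<lambda>x. control_part u s x - control_part u t x))\<^sup>2"
        using moment_diff_Bessel[OF u _ _ N', of s t] t by (simp add: suminf_nonneg)
    qed
    show "((\<lambda>s. real N * pi * (L2_norm (\<lambda>x. control_part u s x - control_part u t x))\<^sup>2) \<longlongrightarrow> 0) (at t within {0..T})"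
      using tendsto_mult_right_zero[OF control_part_tendsto[OF u t]] .
  qed
qed

text \<open>On \<open>(0, \<pi>)\<close> the control is \<open>f + cnj f\<close> with \<open>f\<close> in the closed span of the \<open>exp (- 2 \<i> k s)\<close>, \<open>k \<ge> 0\<close>:
  \<open>cnj f\<close> only contributes to the moment of index \<open>0\<close>.\<close>

theorem moment_problem:
  assumes T: "T > pi" and d: "summable (\<lambda>k. (cmod (d k))\<^sup>2)" and d0: "Im (d 0) = 0"
  shows "\<exists>u\<in>L2_real_on 0 T. \<forall>k. moment u k T = d k"
proof -
  \<comment> \<open>Index 0 is halved because f and its conjugate contribute equally there; the
    division by sqrt pi compensates the normalization of \<open>trig 1\<close>.\<close>
  define b where "b k = (if k = 0 then d k / 2 else d k) / of_real (sqrt pi)" for k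
  note o = orthonormal_trig[of 1, simplified]
  have "summable (\<lambda>k. (cmod (b k))\<^sup>2)"
  proof (rule summable_comparison_test')
    show "summable (\<lambda>k. (cmod (d k))\<^sup>2 / pi)" using d by (rule summable_divide)
    show "norm ((cmod (b k))\<^sup>2) \<le> (cmod (d k))\<^sup>2 / pi" for k
      by (simp add: b_def norm_divide power_divide field_simps)
  qed
  then obtain f where f: "f \<in> L2" and lim: "(\<lambda>n. L2_norm (\<lambda>x. (\<Sum>k<n. b k * trig 1 k x) - f x)) \<longlonglongrightarrow> 0"
    using Riesz_Fischer[OF o] by (auto simp: numeral_eq_Suc)
  have f_trig: "L2_inner f (trig 1 k) = b k" for k
    using Riesz_Fischer_inner[OF o f, of b k] lim by simp
  have f_cnj: "L2_inner f (\<lambda>s. cnj (trig 1 k s)) = (if k = 0 then b 0 else 0)" for k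
  proof (cases "k = 0")
    case True
    then have "(\<lambda>s. cnj (trig 1 k s)) = trig 1 0" by (auto simp: trig_def fun_eq_iff split: split_indicator)
    then show ?thesis using True f_trig[of 0] by simp
  next
    case False
    have "(\<lambda>n. L2_inner (\<lambda>x. \<Sum>j<n. b j * trig 1 j x) (\<lambda>s. cnj (trig 1 k s))) \<longlonglongrightarrow> L2_inner f (\<lambda>s. cnj (trig 1 k s))"
      using lim by (intro L2_inner_tendsto f L2_cnj trig_L2 L2_sum L2_scale)
    moreover have "L2_inner (\<lambda>x. \<Sum>j<n. b j * trig 1 j x) (\<lambda>s. cnj (trig 1 k s)) = 0" for n
      using False by (subst L2_inner_sum_left)
        (auto simp: L2_inner_scale_left trig_inner_cnj intro!: L2_scale trig_L2 L2_cnj)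
    ultimately show ?thesis using False by (simp add: LIMSEQ_const_iff)
  qed
  \<comment> \<open>Twice the real part of f on one period and 0 afterwards; T > pi ensures that (0,
    pi] lies inside (0, T).\<close>
  define u where "u s = indicator {0<..pi} s * (2 * Re (f s))" for s
  have fm[measurable]: "f \<in> borel_measurable borel" using f by (rule L2_measurable_borel)
  have "u \<in> L2_real_on 0 T"
  proof -
    have "integrable lborel (\<lambda>s. indicator {0<..<T} s *\<^sub>R (u s)\<^sup>2)"
    proof (rule Bochner_Integration.integrable_bound)
      show "integrable lborel (\<lambda>s. 4 * (cmod (f s))\<^sup>2)" using L2_square_integrable[OF f] by simp
      have "(Re (f s))\<^sup>2 \<le> (cmod (f s))\<^sup>2" for s by (simp add: cmod_power2)
      then show "AE s in lborel. norm (indicator {0<..<T} s *\<^sub>R (u s)\<^sup>2) \<le> norm (4 * (cmod (f s))\<^sup>2)"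
        by (intro always_eventually) (auto simp: u_def power_mult_distrib split: split_indicator)
    qed (simp add: u_def[abs_def])
    then show ?thesis
      by (simp add: L2_real_on_def set_integrable_def set_borel_measurable_def u_def[abs_def])
  qed
  moreover have "moment u k T = d k" for k
  proof -
    have int1: "integrable lborel (\<lambda>s. f s * cnj (trig 1 k s))"
      by (intro L2_inner_integrable f trig_L2)
    have int2: "integrable lborel (\<lambda>s. cnj (f s * trig 1 k s))"
      by (intro integrable_cnj L2_mult_integrable f trig_L2)
    have "indicator {0<..<T} s *\<^sub>R (complex_of_real (u s) * iexp (2 * real k * s))
        = of_real (sqrt pi) * (f s * cnj (trig 1 k s) + cnj (f s * trig 1 k s))" for s
    proof -
      have e: "cnj (iexp (- (2 * real k * s))) = iexp (2 * real k * s)" by (simp add: exp_cnj)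
      have "complex_of_real (2 * Re (f s)) = f s + cnj (f s)" by (simp add: complex_add_cnj)
      moreover have "complex_of_real (sqrt pi) * (z / complex_of_real (sqrt pi)) = z" for z by simp
      ultimately show ?thesis using T e
        by (cases "s \<in> {0<..pi}") (simp_all add: u_def trig_def distrib_left distrib_right del: exp_cnj)
    qed
    then have "moment u k T = of_real (sqrt pi) * ((LINT s|lborel. f s * cnj (trig 1 k s)) + (LINT s|lborel. cnj (f s * trig 1 k s)))"
      unfolding moment_def set_lebesgue_integral_def
      by (simp only: integral_mult_right_zero Bochner_Integration.integral_add[OF int1 int2])
    also have "(LINT s|lborel. cnj (f s * trig 1 k s)) = cnj (L2_inner f (\<lambda>s. cnj (trig 1 k s)))"
      unfolding Bochner_Integration.integral_cnj by (simp add: L2_inner_def)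
    also have "\<dots> = (if k = 0 then b 0 else 0)"
    proof -
      have "cnj (b 0) = b 0" using d0 by (simp add: b_def complex_eq_iff)
      then show ?thesis unfolding f_cnj by simp
    qed
    also have "(LINT s|lborel. f s * cnj (trig 1 k s)) = b k"
      using f_trig[of k] by (simp add: L2_inner_def)
    also have "of_real (sqrt pi) * (b k + (if k = 0 then b 0 else 0)) = d k"
      by (simp add: b_def)
    finally show ?thesis .
  qed
  ultimately show ?thesis by blast
qed

section \<open>The mild solution\<close>

lemma Hha_weight:
  "hermite_fun j a \<noteq> 0 \<Longrightarrow>
    of_nat (Suc j) / ennreal ((hermite_fun j a)\<^sup>2) = ennreal (real (Suc j) / (hermite_fun j a)\<^sup>2)"
  by (subst divide_ennreal[symmetric]) (auto simp: ennreal_of_nat_eq_real_of_nat)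

text \<open>By the formula for the squared half-line coefficient, the weight cancels phi_j(a)^2 and
  leaves phi_0(a)^2 / 2. If phi_j(a) = 0, the infinite weight meets a coefficient that is 0, and the
  product is 0.\<close>

lemma Hha_term_bound:
  "of_nat (Suc j) / ennreal ((hermite_fun j a)\<^sup>2) * ennreal ((cmod (- \<i> * complex_of_real (half_line_coef a (Suc j)) * z))\<^sup>2)
    \<le> ennreal ((hermite_fun 0 a)\<^sup>2 * (cmod z)\<^sup>2)"
proof (cases "hermite_fun j a = 0")
  case True
  then show ?thesis using half_line_coef_eq_0_iff[of a j] by simp
next
  case False
  have "of_nat (Suc j) / ennreal ((hermite_fun j a)\<^sup>2) = ennreal (real (Suc j) / (hermite_fun j a)\<^sup>2)"
    using False by (rule Hha_weight)
  also have "\<dots> * ennreal ((cmod (- \<i> * complex_of_real (half_line_coef a (Suc j)) * z))\<^sup>2)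
      = ennreal (real (Suc j) / (hermite_fun j a)\<^sup>2 * ((half_line_coef a (Suc j))\<^sup>2 * (cmod z)\<^sup>2))"
    by (subst ennreal_mult) (auto simp: norm_mult power_mult_distrib)
  also have "real (Suc j) / (hermite_fun j a)\<^sup>2 * ((half_line_coef a (Suc j))\<^sup>2 * (cmod z)\<^sup>2)
      = (hermite_fun 0 a)\<^sup>2 * (cmod z)\<^sup>2 / 2"
  proof -
    have cancel: "n / y * (y * h / (2 * n) * c) = h * c / 2" if "n \<noteq> 0" "y \<noteq> 0" for n y h c :: real
      using that by (simp add: field_simps)
    show ?thesis unfolding half_line_coef_Suc_square by (rule cancel) (use False in auto)
  qed
  also have "ennreal \<dots> \<le> ennreal ((hermite_fun 0 a)\<^sup>2 * (cmod z)\<^sup>2)"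
    by (intro ennreal_leI) simp
  finally show ?thesis .
qed

text \<open>Transfers square summability of the data \<open>d\<close> to both norms. In the
  constant, 1 covers the coefficient of index 0, where the half-line coefficient is at most 1, and
  phi_0(a)^2 covers the weighted terms.\<close>

lemma Hha_bound:
  assumes f: "f \<in> L2" and coef_f: "\<And>k. coef f k = - \<i> * complex_of_real (half_line_coef a k) * d k"
    and d: "summable (\<lambda>k. (cmod (d k))\<^sup>2)"
  shows "f \<in> Hha a"
    and "Hha_norm a f \<le> ennreal (sqrt ((1 + (hermite_fun 0 a)\<^sup>2) * (\<Sum>k. (cmod (d k))\<^sup>2)))"
    and "L2_norm f \<le> sqrt (\<Sum>k. (cmod (d k))\<^sup>2)"
proof -
  define h where "h = (hermite_fun 0 a)\<^sup>2"
  have h: "0 \<le> h" by (simp add: h_def)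
  have coef_le: "(cmod (coef f k))\<^sup>2 \<le> (cmod (d k))\<^sup>2" for k
    unfolding coef_f using half_line_coef_le_1[of a k]
    by (intro power_mono) (auto simp: norm_mult mult_left_le_one_le)
  have d_Suc: "summable (\<lambda>j. (cmod (d (Suc j)))\<^sup>2)" using d by (subst summable_Suc_iff)
  have d_nn: "0 \<le> (\<Sum>k. (cmod (d k))\<^sup>2)" using d by (intro suminf_nonneg) auto
  have d_split: "(\<Sum>k. (cmod (d k))\<^sup>2) = (cmod (d 0))\<^sup>2 + (\<Sum>j. (cmod (d (Suc j)))\<^sup>2)"
    using suminf_split_head[OF d] by simp
  have "Hha_normsq a f \<le> ennreal ((cmod (d 0))\<^sup>2) + (\<Sum>j. ennreal (h * (cmod (d (Suc j)))\<^sup>2))"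
    unfolding Hha_normsq_def coef_f[of "Suc _"] h_def
    by (intro add_mono suminf_le Hha_term_bound ennreal_leI coef_le) auto
  also have "(\<Sum>j. ennreal (h * (cmod (d (Suc j)))\<^sup>2)) = ennreal (h * (\<Sum>j. (cmod (d (Suc j)))\<^sup>2))"
    using h d_Suc by (subst suminf_ennreal2) (auto simp: suminf_mult summable_mult)
  also have "ennreal ((cmod (d 0))\<^sup>2) + \<dots> = ennreal ((cmod (d 0))\<^sup>2 + h * (\<Sum>j. (cmod (d (Suc j)))\<^sup>2))"
    using h d_Suc by (intro ennreal_plus[symmetric]) (auto intro!: mult_nonneg_nonneg suminf_nonneg)
  also have "\<dots> \<le> ennreal ((1 + h) * (\<Sum>k. (cmod (d k))\<^sup>2))"
    unfolding d_split using h d_Suc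
    by (intro ennreal_leI) (auto simp: distrib_left distrib_right intro!: suminf_nonneg add_nonneg_nonneg mult_nonneg_nonneg)
  finally have le: "Hha_normsq a f \<le> ennreal ((1 + h) * (\<Sum>k. (cmod (d k))\<^sup>2))" .
  then have fin: "Hha_normsq a f \<noteq> \<infinity>" by (auto simp: top_unique)
  have "enn2real (Hha_normsq a f) \<le> (1 + h) * (\<Sum>k. (cmod (d k))\<^sup>2)"
    using le h d_nn by (intro enn2real_leI) auto
  then show "Hha_norm a f \<le> ennreal (sqrt ((1 + (hermite_fun 0 a)\<^sup>2) * (\<Sum>k. (cmod (d k))\<^sup>2)))"
    using fin by (simp add: Hha_norm_def h_def ennreal_leI)
  then show "f \<in> Hha a" using f by (simp add: Hha_def order_le_less_trans[OF _ ennreal_less_top])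
  have "(L2_norm f)\<^sup>2 \<le> (\<Sum>k. (cmod (d k))\<^sup>2)"
    unfolding L2_norm_square_coef[OF f] by (intro suminf_le coef_le coef_Bessel f d)
  then show "L2_norm f \<le> sqrt (\<Sum>k. (cmod (d k))\<^sup>2)" by (rule real_le_rsqrt)
qed

definition rotated_moment :: "(real \<Rightarrow> real) \<Rightarrow> nat \<Rightarrow> real \<Rightarrow> complex" where
  "rotated_moment u k t = iexp (- (eigval k * t)) * moment u k t"

text \<open>Defined by its coefficients, so that its space and regularity can be read off;
  \<open>solution_integral\<close> identifies it with Duhamel's integral.\<close>

definition solution :: "real \<Rightarrow> (real \<Rightarrow> real) \<Rightarrow> real \<Rightarrow> real \<Rightarrow> complex" where
  "solution a u t = synth (\<lambda>k. - \<i> * complex_of_real (half_line_coef a k) * rotated_moment u k t)"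

lemma cmod_rotated_moment: "cmod (rotated_moment u k t) = cmod (moment u k t)"
  unfolding rotated_moment_def norm_mult norm_exp_i_times by simp

lemma rotated_moment_summable:
  "u \<in> L2_real_on 0 T \<Longrightarrow> 0 \<le> t \<Longrightarrow> t \<le> T \<Longrightarrow> summable (\<lambda>k. (cmod (rotated_moment u k t))\<^sup>2)"
  unfolding cmod_rotated_moment by (rule moment_summable)

lemma solution:
  assumes u: "u \<in> L2_real_on 0 T" and t: "0 \<le> t" "t \<le> T"
  shows "solution a u t \<in> L2"
    and "coef (solution a u t) k = - \<i> * complex_of_real (half_line_coef a k) * rotated_moment u k t"
proof -
  have "summable (\<lambda>k. (cmod (- \<i> * complex_of_real (half_line_coef a k) * rotated_moment u k t))\<^sup>2)"
  proof (rule summable_comparison_test'[OF rotated_moment_summable[OF u t]])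
    have "(cmod (- \<i> * complex_of_real (half_line_coef a k) * rotated_moment u k t))\<^sup>2 \<le> (cmod (rotated_moment u k t))\<^sup>2" for k
      using half_line_coef_le_1[of a k] by (intro power_mono) (auto simp: norm_mult mult_left_le_one_le)
    then show "norm ((cmod (- \<i> * complex_of_real (half_line_coef a k) * rotated_moment u k t))\<^sup>2) \<le> (cmod (rotated_moment u k t))\<^sup>2" for k
      by simp
  qed
  from synth[OF this] show "solution a u t \<in> L2"
    and "coef (solution a u t) k = - \<i> * complex_of_real (half_line_coef a k) * rotated_moment u k t"
    unfolding solution_def by auto
qed

lemma solution_Hha: "u \<in> L2_real_on 0 T \<Longrightarrow> 0 \<le> t \<Longrightarrow> t \<le> T \<Longrightarrow> solution a u t \<in> Hha a"
  by (rule Hha_bound(1)[OF solution rotated_moment_summable])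

lemma coef_X_space: "L2_inner \<psi> (ground_state t) = iexp t * coef \<psi> 0"
proof -
  have "cnj (iexp (- t)) = iexp t" by (simp add: exp_cnj)
  then show ?thesis unfolding ground_state_eq L2_inner_scale_right by simp
qed

text \<open>A real control has a real moment of index 0, the phases of the state and of the ground
  state cancel, and the factor -i makes the inner product purely imaginary.\<close>

lemma solution_X_space:
  assumes "u \<in> L2_real_on 0 T" "0 \<le> t" "t \<le> T"
  shows "solution a u t \<in> X_space t"
proof -
  have "moment u 0 t = complex_of_real (LINT s|lborel. indicator {0<..<t} s * u s)"
    unfolding moment_def set_lebesgue_integral_def
    by (subst integral_complex_of_real[symmetric])
       (auto intro!: Bochner_Integration.integral_cong split: split_indicator)
  then have "Im (moment u 0 t) = 0" by simp
  moreover have "iexp t * coef (solution a u t) 0 = - \<i> * complex_of_real (half_line_coef a 0) * moment u 0 t"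
  proof -
    have "iexp t * iexp (- (eigval 0 * t)) = 1"
      unfolding exp_add[symmetric] by (simp add: eigval_def)
    then show ?thesis unfolding solution(2)[OF assms] rotated_moment_def
      by (metis (no_types, lifting) mult.assoc mult.left_commute mult_1)
  qed
  ultimately have "Re (iexp t * coef (solution a u t) 0) = 0" by (simp only:) simp
  then show ?thesis
    using solution(1)[OF assms] unfolding X_space_def coef_X_space by simp
qed

text \<open>The coefficients of the integrand are bounded by |u(s)| times the modulus of the
  half-line coefficient: integrable in s, square-summable in k, and separated as
  \<open>has_L2_integralI\<close> requires.\<close>

lemma solution_integral:
  assumes u: "u \<in> L2_real_on 0 T" and t: "0 \<le> t" "t \<le> T"
  shows "has_L2_integral {0<..<t} (\<lambda>s. propagator (t - s) (source a u s)) (\<lambda>x. \<i> * solution a u t x)"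
proof (rule has_L2_integralI)
  note int = control_iexp_integrable[OF u t(2)]
  show "propagator (t - s) (source a u s) \<in> L2" for s by (intro propagator_L2 source_L2)
  show "(\<lambda>x. \<i> * solution a u t x) \<in> L2" by (intro L2_scale solution[OF u t])
  show "set_integrable lborel {0<..<t} (\<lambda>s. coef (propagator (t - s) (source a u s)) k)" for k
    unfolding coef_propagator_source by (intro set_integrable_mult_right int)
  show "coef (\<lambda>x. \<i> * solution a u t x) k = (LINT s:{0<..<t}|lborel. coef (propagator (t - s) (source a u s)) k)" for k
    unfolding coef_propagator_source L2_inner_scale_left solution(2)[OF u t] rotated_moment_def
    by (simp add: moment_def mult.assoc)
  show "set_integrable lborel {0<..<t} (\<lambda>s. \<bar>u s\<bar>)" by (rule control_integrable[OF u t(2)])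
  show "cmod (coef (propagator (t - s) (source a u s)) k) \<le> \<bar>u s\<bar> * \<bar>half_line_coef a k\<bar>" for s k
    unfolding coef_propagator_source norm_mult norm_exp_i_times by simp
  show "summable (\<lambda>k. \<bar>half_line_coef a k\<bar>\<^sup>2)" by (rule half_line_coef_summable)
qed auto

section \<open>Continuity in time\<close>

lemma rotated_moment_diff_summable:
  assumes u: "u \<in> L2_real_on 0 T" and s: "s \<in> {0..T}" and t: "t \<in> {0..T}"
  shows "summable (\<lambda>k. (cmod (rotated_moment u k s - rotated_moment u k t))\<^sup>2)"
proof (rule summable_comparison_test')
  show "summable (\<lambda>k. 2 * (cmod (rotated_moment u k s))\<^sup>2 + 2 * (cmod (rotated_moment u k t))\<^sup>2)"
    using s t by (intro summable_add summable_mult rotated_moment_summable[OF u]) auto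
  show "norm ((cmod (rotated_moment u k s - rotated_moment u k t))\<^sup>2)
      \<le> 2 * (cmod (rotated_moment u k s))\<^sup>2 + 2 * (cmod (rotated_moment u k t))\<^sup>2" for k
    using cmod_add_square_le[of "rotated_moment u k s" "- rotated_moment u k t"] by simp
qed

text \<open>The difference splits into the change of the moments, with unimodular factor, and the
  change of the phases at the fixed time t. The first is controlled by Bessel's inequality; the
  second by dominated convergence with majorant 4 |moment|^2, since the eigenvalues are
  unbounded.\<close>

lemma rotated_moment_continuous:
  assumes u: "u \<in> L2_real_on 0 T" and t: "t \<in> {0..T}"
  shows "((\<lambda>s. \<Sum>k. (cmod (rotated_moment u k s - rotated_moment u k t))\<^sup>2) \<longlongrightarrow> 0) (at t within {0..T})"
proof -
  define A where "A k s = (cmod (moment u k s - moment u k t))\<^sup>2" for k s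
  define B where "B k s = (cmod ((iexp (- (eigval k * s)) - iexp (- (eigval k * t))) * moment u k t))\<^sup>2" for k s
  have M: "summable (\<lambda>k. (cmod (moment u k t))\<^sup>2)" using moment_summable[OF u] t by auto
  have B_le: "B k s \<le> 4 * (cmod (moment u k t))\<^sup>2" for k s
  proof -
    have "cmod (iexp (- (eigval k * s)) - iexp (- (eigval k * t))) \<le> 2"
      using norm_triangle_ineq4[of "iexp (- (eigval k * s))" "iexp (- (eigval k * t))"]
      unfolding norm_exp_i_times by simp
    then have "(cmod (iexp (- (eigval k * s)) - iexp (- (eigval k * t))))\<^sup>2 \<le> 2\<^sup>2"
      by (intro power_mono) auto
    then show ?thesis unfolding B_def norm_mult power_mult_distrib by (intro mult_right_mono) auto
  qed
  have B_nn: "0 \<le> B k s" and A_nn: "0 \<le> A k s" for k s by (simp_all add: A_def B_def)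
  have M4: "summable (\<lambda>k. 4 * (cmod (moment u k t))\<^sup>2)" using M by (rule summable_mult)
  have B_sum: "summable (\<lambda>k. B k s)" for s
    by (rule summable_comparison_test'[OF M4]) (simp add: B_nn B_le)
  have B_lim: "((\<lambda>s. \<Sum>k. B k s) \<longlongrightarrow> 0) (at t within {0..T})"
  proof (rule suminf_tendsto_0[OF _ _ M4])
    fix k
    have "((\<lambda>s. (iexp (- (eigval k * s)) - iexp (- (eigval k * t))) * moment u k t) \<longlongrightarrow>
      (iexp (- (eigval k * t)) - iexp (- (eigval k * t))) * moment u k t) (at t within {0..T})"
      by (intro tendsto_intros)
    then have "((\<lambda>s. (cmod ((iexp (- (eigval k * s)) - iexp (- (eigval k * t))) * moment u k t))\<^sup>2) \<longlongrightarrow> (cmod 0)\<^sup>2) (at t within {0..T})"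
      by (intro tendsto_power tendsto_norm) simp
    then show "(B k \<longlongrightarrow> 0) (at t within {0..T})" by (simp add: B_def[abs_def])
  qed (simp add: B_nn B_le)
  show ?thesis
  proof (rule Lim_null_comparison)
    show "\<forall>\<^sub>F s in at t within {0..T}. norm (\<Sum>k. (cmod (rotated_moment u k s - rotated_moment u k t))\<^sup>2)
        \<le> 2 * (\<Sum>k. A k s) + 2 * (\<Sum>k. B k s)"
      unfolding eventually_at_filter
    proof (intro always_eventually allI impI)
      fix s assume s: "s \<in> {0..T}"
      have A_sum: "summable (\<lambda>k. A k s)"
      proof -
        have "summable (\<lambda>k. 2 * (cmod (moment u k s))\<^sup>2 + 2 * (cmod (moment u k t))\<^sup>2)"
          using s t by (intro summable_add summable_mult moment_summable[OF u]) auto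
        then show ?thesis
          by (rule summable_comparison_test')
             (use cmod_add_square_le[of "moment u _ s" "- moment u _ t"] in \<open>simp add: A_def\<close>)
      qed
      have "(\<Sum>k. (cmod (rotated_moment u k s - rotated_moment u k t))\<^sup>2) \<le> (\<Sum>k. 2 * A k s + 2 * B k s)"
      proof (rule suminf_le[OF _ rotated_moment_diff_summable[OF u s t]])
        show "summable (\<lambda>k. 2 * A k s + 2 * B k s)" by (intro summable_add summable_mult A_sum B_sum)
        fix k
        have "rotated_moment u k s - rotated_moment u k t = iexp (- (eigval k * s)) * (moment u k s - moment u k t)
          + (iexp (- (eigval k * s)) - iexp (- (eigval k * t))) * moment u k t"
          by (simp only: rotated_moment_def) (simp add: algebra_simps)
        then have "(cmod (rotated_moment u k s - rotated_moment u k t))\<^sup>2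
          \<le> 2 * (cmod (iexp (- (eigval k * s)) * (moment u k s - moment u k t)))\<^sup>2 + 2 * B k s"
          unfolding B_def by (simp only: cmod_add_square_le)
        then show "(cmod (rotated_moment u k s - rotated_moment u k t))\<^sup>2 \<le> 2 * A k s + 2 * B k s"
          unfolding A_def norm_mult norm_exp_i_times by simp
      qed
      also have "\<dots> = 2 * (\<Sum>k. A k s) + 2 * (\<Sum>k. B k s)"
        using A_sum B_sum by (simp add: suminf_add[symmetric] suminf_mult summable_mult)
      finally show "norm (\<Sum>k. (cmod (rotated_moment u k s - rotated_moment u k t))\<^sup>2)
        \<le> 2 * (\<Sum>k. A k s) + 2 * (\<Sum>k. B k s)"
        using suminf_nonneg[OF rotated_moment_diff_summable[OF u s t]] by simp
    qed
    have "((\<lambda>s. 2 * (\<Sum>k. A k s) + 2 * (\<Sum>k. B k s)) \<longlongrightarrow> 2 * 0 + 2 * 0) (at t within {0..T})"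
      unfolding A_def by (intro tendsto_intros moment_continuous[OF u t] B_lim)
    then show "((\<lambda>s. 2 * (\<Sum>k. A k s) + 2 * (\<Sum>k. B k s)) \<longlongrightarrow> 0) (at t within {0..T})" by simp
  qed
qed

text \<open>Differences keep the shape required by \<open>Hha_bound\<close>, with differences of
  rotated moments as data; this yields continuity in L2 and in \<open>Hha\<close> from the same
  estimate.\<close>

lemma solution_diff:
  assumes u: "u \<in> L2_real_on 0 T" and s: "s \<in> {0..T}" and t: "t \<in> {0..T}"
  shows "(\<lambda>x. solution a u s x - solution a u t x) \<in> L2"
    and "coef (\<lambda>x. solution a u s x - solution a u t x) k
      = - \<i> * complex_of_real (half_line_coef a k) * (rotated_moment u k s - rotated_moment u k t)"
proof -
  have st: "0 \<le> s" "s \<le> T" "0 \<le> t" "t \<le> T" using s t by auto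
  note S = solution[OF u st(1,2), of a] and T = solution[OF u st(3,4), of a]
  show "(\<lambda>x. solution a u s x - solution a u t x) \<in> L2" by (intro L2_diff S T)
  show "coef (\<lambda>x. solution a u s x - solution a u t x) k
      = - \<i> * complex_of_real (half_line_coef a k) * (rotated_moment u k s - rotated_moment u k t)"
    unfolding coef_diff[OF S(1) T(1)] S(2) T(2) by (rule right_diff_distrib[symmetric])
qed

lemma solution_continuous_L2:
  assumes u: "u \<in> L2_real_on 0 T"
  shows "continuous_L2 T (solution a u)"
  unfolding continuous_L2_def
proof (intro ballI conjI)
  fix t assume t: "t \<in> {0..T}"
  show "solution a u t \<in> L2" using t by (intro solution(1)[OF u]) auto
  show "((\<lambda>s. L2_norm (\<lambda>x. solution a u s x - solution a u t x)) \<longlongrightarrow> 0) (at t within {0..T})"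
  proof (rule Lim_null_comparison)
    show "\<forall>\<^sub>F s in at t within {0..T}. norm (L2_norm (\<lambda>x. solution a u s x - solution a u t x))
        \<le> sqrt (\<Sum>k. (cmod (rotated_moment u k s - rotated_moment u k t))\<^sup>2)"
      unfolding eventually_at_filter
      using Hha_bound(3)[OF solution_diff[OF u _ t] rotated_moment_diff_summable[OF u _ t]]
      by (intro always_eventually) simp
    show "((\<lambda>s. sqrt (\<Sum>k. (cmod (rotated_moment u k s - rotated_moment u k t))\<^sup>2)) \<longlongrightarrow> 0) (at t within {0..T})"
      using tendsto_real_sqrt[OF rotated_moment_continuous[OF u t]] by simp
  qed
qed

lemma solution_continuous_Hha:
  assumes u: "u \<in> L2_real_on 0 T"
  shows "continuous_Hha a T (solution a u)"
  unfolding continuous_Hha_def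
proof (intro ballI conjI)
  fix t assume t: "t \<in> {0..T}"
  show "solution a u t \<in> Hha a" using t by (intro solution_Hha[OF u]) auto
  define C where "C = 1 + (hermite_fun 0 a)\<^sup>2"
  define b where "b s = ennreal (sqrt (C * (\<Sum>k. (cmod (rotated_moment u k s - rotated_moment u k t))\<^sup>2)))" for s
  have "((\<lambda>s. sqrt (C * (\<Sum>k. (cmod (rotated_moment u k s - rotated_moment u k t))\<^sup>2))) \<longlongrightarrow> sqrt (C * 0)) (at t within {0..T})"
    by (intro tendsto_real_sqrt tendsto_mult tendsto_const rotated_moment_continuous[OF u t])
  then have b: "(b \<longlongrightarrow> 0) (at t within {0..T})"
    unfolding b_def[abs_def] using tendsto_ennrealI by fastforce
  show "((\<lambda>s. Hha_norm a (\<lambda>x. solution a u s x - solution a u t x)) \<longlongrightarrow> 0) (at t within {0..T})"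
  proof (rule tendsto_sandwich[OF _ _ tendsto_const b])
    show "\<forall>\<^sub>F s in at t within {0..T}. Hha_norm a (\<lambda>x. solution a u s x - solution a u t x) \<le> b s"
      unfolding eventually_at_filter b_def C_def
      using Hha_bound(2)[OF solution_diff[OF u _ t] rotated_moment_diff_summable[OF u _ t]]
      by (intro always_eventually) simp
  qed simp
qed

section \<open>Existence and uniqueness of the mild solution\<close>

lemma propagator_zero: "ae_eq (propagator t (\<lambda>x. 0)) (\<lambda>x. 0)"
  by (rule coef_ae_eq) (simp_all add: propagator_L2 propagator_coef)

lemma solution_mild:
  assumes u: "u \<in> L2_real_on 0 T"
  shows "mild_solution T (source a u) (\<lambda>x. 0) (solution a u)"
  unfolding mild_solution_def
proof (intro conjI ballI solution_continuous_L2[OF u])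
  fix t assume t: "t \<in> {0..T}"
  have "ae_eq (solution a u t) (\<lambda>x. propagator t (\<lambda>x. 0) x - \<i> * (\<i> * solution a u t x))"
    using propagator_zero[of t] unfolding ae_eq_def by eventually_elim simp
  then show "\<exists>I. has_L2_integral {0<..<t} (\<lambda>s. propagator (t - s) (source a u s)) I \<and>
      ae_eq (solution a u t) (\<lambda>x. propagator t (\<lambda>x. 0) x - \<i> * I x)"
    using solution_integral[OF u, of t a] t by auto
qed

text \<open>Duhamel's formula is part of the notion of a mild solution, and the coefficients of its
  integral are determined by the integrand, so completeness gives equality almost
  everywhere.\<close>

lemma mild_solution_unique:
  assumes u: "u \<in> L2_real_on 0 T" and \<zeta>: "mild_solution T (source a u) (\<lambda>x. 0) \<zeta>" and t: "t \<in> {0..T}"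
  shows "ae_eq (\<zeta> t) (solution a u t)"
proof -
  have t': "0 \<le> t" "t \<le> T" using t by auto
  obtain I where I: "has_L2_integral {0<..<t} (\<lambda>s. propagator (t - s) (source a u s)) I"
    and eq: "ae_eq (\<zeta> t) (\<lambda>x. propagator t (\<lambda>x. 0) x - \<i> * I x)"
    using \<zeta> t unfolding mild_solution_def by blast
  have IL: "I \<in> L2" using I by (simp add: has_L2_integral_def)
  note J = solution_integral[OF u t', of a]
  have int: "set_integrable lborel {0<..<t} (\<lambda>s. coef (propagator (t - s) (source a u s)) k)" for k
    unfolding coef_propagator_source
    by (intro set_integrable_mult_right control_iexp_integrable[OF u t'(2)])
  have "ae_eq I (\<lambda>x. \<i> * solution a u t x)"
    by (rule coef_ae_eq[OF IL L2_scale[OF solution(1)[OF u t']]])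
       (simp only: has_L2_integral_coef[OF I int] has_L2_integral_coef[OF J int])
  then show ?thesis
    using eq propagator_zero[of t] unfolding ae_eq_def by eventually_elim simp
qed

section \<open>Controllability\<close>

text \<open>The converse of \<open>Hha_term_bound\<close>: the weighted term equals phi_0(a)^2 / 2
  times the squared modulus of the coefficient over the half-line coefficient. If phi_j(a) = 0, the
  coefficient vanishes, and both sides are 0 by division by 0.\<close>

lemma Hha_Suc_weighted:
  assumes \<psi>: "\<psi> \<in> Hha a"
  shows "hermite_fun j a = 0 \<Longrightarrow> coef \<psi> (Suc j) = 0"
    and "summable (\<lambda>j. (cmod (coef \<psi> (Suc j) / complex_of_real (half_line_coef a (Suc j))))\<^sup>2)"
proof -
  define w where "w j = of_nat (Suc j) / ennreal ((hermite_fun j a)\<^sup>2) * ennreal ((cmod (coef \<psi> (Suc j)))\<^sup>2)" for j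
  have "Hha_normsq a \<psi> \<noteq> \<infinity>"
    using \<psi> by (auto simp: Hha_def Hha_norm_def split: if_splits)
  then have w_sum: "(\<Sum>j. w j) \<noteq> \<infinity>" by (simp add: Hha_normsq_def w_def)
  have zero: "coef \<psi> (Suc j) = 0" if "hermite_fun j a = 0" for j
  \<comment> \<open>A nonzero coefficient with infinite weight would be an infinite term of a finite
    sum.\<close>
  proof (rule ccontr)
    assume "coef \<psi> (Suc j) \<noteq> 0"
    then have "w j = \<infinity>" using that by (simp add: w_def ennreal_mult_eq_top_iff ennreal_divide_eq_top_iff)
    moreover have "w j \<le> (\<Sum>j. w j)" using sum_le_suminf[of w "{j}"] by (simp add: summableI)
    ultimately show False using w_sum by (simp add: top_unique)
  qed
  then show "hermite_fun j a = 0 \<Longrightarrow> coef \<psi> (Suc j) = 0" .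
  define g where "g j = (cmod (coef \<psi> (Suc j) / complex_of_real (half_line_coef a (Suc j))))\<^sup>2" for j
  define h where "h = (hermite_fun 0 a)\<^sup>2"
  have h: "h > 0" using hermite_fun_0_pos[of a] by (simp add: h_def)
  have "ennreal (h / 2 * g j) = w j" for j
  proof (cases "hermite_fun j a = 0")
    case True
    then show ?thesis by (simp add: w_def g_def zero)
  next
    case False
    have "h / 2 * g j = real (Suc j) / (hermite_fun j a)\<^sup>2 * (cmod (coef \<psi> (Suc j)))\<^sup>2"
    proof -
      have cancel: "h / 2 * (c / (y * h / (2 * n))) = n / y * c" if "n \<noteq> 0" "y \<noteq> 0" "h \<noteq> 0" for n y h c :: real
        using that by (simp add: field_simps)
      have "g j = (cmod (coef \<psi> (Suc j)))\<^sup>2 / ((hermite_fun j a)\<^sup>2 * h / (2 * real (Suc j)))"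
        unfolding g_def norm_divide power_divide h_def half_line_coef_Suc_square[symmetric] by simp
      then show ?thesis using False h by (simp only:) (rule cancel, auto)
    qed
    also have "ennreal \<dots> = w j"
      unfolding w_def Hha_weight[OF False] by (rule ennreal_mult) auto
    finally show ?thesis .
  qed
  then have "(\<Sum>j. ennreal (h / 2 * g j)) \<noteq> \<infinity>" using w_sum by simp
  then have "summable (\<lambda>j. h / 2 * g j)"
    using h by (intro summable_suminf_not_top) (auto simp: g_def)
  then have "summable g" using h by (simp add: summable_cmult_iff)
  then show "summable (\<lambda>j. (cmod (coef \<psi> (Suc j) / complex_of_real (half_line_coef a (Suc j))))\<^sup>2)"
    by (simp add: g_def[abs_def])
qed

theorem solution_attains:
  assumes T: "T > pi" and \<psi>: "\<psi> \<in> Hha a" "\<psi> \<in> X_space T"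
  shows "\<exists>u\<in>L2_real_on 0 T. ae_eq (solution a u T) \<psi>"
proof -
  have \<psi>L: "\<psi> \<in> L2" using \<psi>(1) by (simp add: Hha_def)
  define m where "m k = complex_of_real (half_line_coef a k)" for k
  \<comment> \<open>Solves -i m_k exp(-i lambda_k T) d_k = coef psi k. Where m_k = 0, division
    yields d_k = 0, consistent with the vanishing coefficient of psi.\<close>
  define d where "d k = \<i> * iexp (eigval k * T) * (coef \<psi> k / m k)" for k
  have "summable (\<lambda>k. (cmod (coef \<psi> k / m k))\<^sup>2)"
    using Hha_Suc_weighted(2)[OF \<psi>(1)] unfolding m_def by (subst (asm) summable_Suc_iff)
  moreover have "cmod (d k) = cmod (coef \<psi> k / m k)" for k
    unfolding d_def norm_mult norm_exp_i_times by simp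
  ultimately have d: "summable (\<lambda>k. (cmod (d k))\<^sup>2)" by simp
  \<comment> \<open>Membership in \<open>X_space T\<close> says precisely that the moment prescribed
    at index 0 is real, as a real control demands.\<close>
  have "Re (iexp T * coef \<psi> 0) = 0" using \<psi>(2) unfolding X_space_def coef_X_space by simp
  moreover have "d 0 = \<i> * (iexp T * coef \<psi> 0) / complex_of_real (half_line_coef a 0)"
    by (simp add: d_def m_def eigval_def)
  ultimately have "Im (d 0) = 0" by (simp add: Im_divide_of_real)
  then obtain u where u: "u \<in> L2_real_on 0 T" and mom: "\<And>k. moment u k T = d k"
    using moment_problem[OF T d] by blast
  have T0: "0 \<le> T" using T pi_gt_zero by linarith
  note S = solution[OF u T0 order_refl, of a]
  have "ae_eq (solution a u T) \<psi>"
  proof (rule coef_ae_eq[OF S(1) \<psi>L])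
    fix k
    have m0: "coef \<psi> k = 0" if "m k = 0"
    proof (cases k)
      case 0
      then show ?thesis using that half_line_coef_0_pos[of a] by (simp add: m_def)
    next
      case (Suc j)
      then show ?thesis using that Hha_Suc_weighted(1)[OF \<psi>(1), of j] half_line_coef_eq_0_iff[of a j]
        by (simp add: m_def)
    qed
    have "iexp (- (eigval k * T)) * iexp (eigval k * T) = 1"
      unfolding exp_add[symmetric] by simp
    then have "iexp (- (eigval k * T)) * d k = \<i> * (coef \<psi> k / m k)"
      unfolding d_def by (metis (no_types, lifting) mult.assoc mult.left_commute mult_1)
    then have "coef (solution a u T) k = - \<i> * m k * (\<i> * (coef \<psi> k / m k))"
      unfolding S(2) rotated_moment_def mom m_def by simp
    also have "\<dots> = coef \<psi> k" using m0 by (cases "m k = 0") auto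
    finally show "coef (solution a u T) k = coef \<psi> k" .
  qed
  then show ?thesis using u by blast
qed

theorem theorem5p3:
  fixes a :: real
  shows "(\<forall>T>0. \<forall>u \<in> L2_real_on 0 T.
            \<exists>\<xi>. mild_solution T (source a u) (\<lambda>x. 0) \<xi> \<and>
                continuous_Hha a T \<xi> \<and>
                (\<forall>t\<in>{0..T}. \<xi> t \<in> Hha a \<inter> X_space t \<and>
                   (\<exists>I. has_L2_integral {0<..<t} (\<lambda>s. propagator (t - s) (source a u s)) I \<and>
                        ae_eq (\<xi> t) (\<lambda>x. - \<i> * I x))) \<and>
                (\<forall>\<zeta>. mild_solution T (source a u) (\<lambda>x. 0) \<zeta> \<longrightarrow>
                   (\<forall>t\<in>{0..T}. ae_eq (\<zeta> t) (\<xi> t))))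
       \<and> (\<forall>T>pi. \<forall>\<psi>\<^sub>1 \<in> Hha a \<inter> X_space T.
            \<exists>u \<in> L2_real_on 0 T. \<exists>\<xi>. mild_solution T (source a u) (\<lambda>x. 0) \<xi> \<and>
                ae_eq (\<xi> T) \<psi>\<^sub>1)"
proof (intro conjI allI impI ballI)
  fix T :: real and u assume u: "u \<in> L2_real_on 0 T"
  \<comment> \<open>The integral is i times the solution, so Duhamel's factor -i returns the
    solution itself.\<close>
  have "\<exists>I. has_L2_integral {0<..<t} (\<lambda>s. propagator (t - s) (source a u s)) I \<and>
      ae_eq (solution a u t) (\<lambda>x. - \<i> * I x)" if "t \<in> {0..T}" for t
    using solution_integral[OF u, of t a] that
    by (intro exI[of _ "\<lambda>x. \<i> * solution a u t x"]) simp
  then show "\<exists>\<xi>. mild_solution T (source a u) (\<lambda>x. 0) \<xi> \<and>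
                continuous_Hha a T \<xi> \<and>
                (\<forall>t\<in>{0..T}. \<xi> t \<in> Hha a \<inter> X_space t \<and>
                   (\<exists>I. has_L2_integral {0<..<t} (\<lambda>s. propagator (t - s) (source a u s)) I \<and>
                        ae_eq (\<xi> t) (\<lambda>x. - \<i> * I x))) \<and>
                (\<forall>\<zeta>. mild_solution T (source a u) (\<lambda>x. 0) \<zeta> \<longrightarrow>
                   (\<forall>t\<in>{0..T}. ae_eq (\<zeta> t) (\<xi> t)))"
    using solution_mild[OF u] solution_continuous_Hha[OF u] solution_Hha[OF u] solution_X_space[OF u]
      mild_solution_unique[OF u]
    by (intro exI[of _ "solution a u"]) auto
next
  fix T :: real and \<psi> assume "T > pi" "\<psi> \<in> Hha a \<inter> X_space T"
  then obtain u where "u \<in> L2_real_on 0 T" "ae_eq (solution a u T) \<psi>"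
    using solution_attains by blast
  then show "\<exists>u\<in>L2_real_on 0 T. \<exists>\<xi>. mild_solution T (source a u) (\<lambda>x. 0) \<xi> \<and> ae_eq (\<xi> T) \<psi>"
    using solution_mild by blast
qed

end
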